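(* Let $d_0,d_1,\ldots,d_{m_1},d_1',\ldots,d_{m_2}'$ be positive integers. Then there exists a finite set of polynomials $\varphi_1,\ldots,\varphi_L$ (cf. the polynomials in the list (a)–(d) in the context), which are in the coefficients of the polynomials $f\in\mathbb{R}[x]_{d_0}$, $h_i\in\mathbb{R}[x]_{d_i}$ ($1\le i\le m_1$), $g_j\in\mathbb{R}[x]_{d_j'}$ ($1\le j\le m_2$), such that if $\varphi_1,\ldots,\varphi_L$ do not vanish at the input polynomials $(f,h_1,\ldots,h_{m_1},g_1,\ldots,g_{m_2})$, then the constraint qualification, strict complementarity and second order sufficiency conditions hold at every local minimizer of the problem $$\min\ f(x)\quad\text{s.t.}\quad h_i(x)=0\ (1\le i\le m_1),\quad g_j(x)\ge0\ (1\le j\le m_2),\quad x\in\mathbb{R}^n.$$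
   Context: Here $x=(x_1,\ldots,x_n)$, $\tilde x=(x_0,x_1,\ldots,x_n)$ and $\mathbb{R}[x]_d=\{p\in\mathbb{R}[x]:\deg p\le d\}$. Optimality conditions at a local minimizer $u$, where $J(u)=\{j_1,\ldots,j_r\}=\{j: g_j(u)=0\}$ is the set of active inequality constraints: Constraint qualification condition: the gradients $\nabla h_1(u),\ldots,\nabla h_{m_1}(u),\nabla g_{j_1}(u),\ldots,\nabla g_{j_r}(u)$ are linearly independent. When it holds there exist Lagrange multipliers $\lambda_i,\mu_j\in\mathbb{R}$ with $\nabla f(u)=\sum_{i=1}^{m_1}\lambda_i\nabla h_i(u)+\sum_{j=1}^{m_2}\mu_j\nabla g_j(u)$, $\mu_jg_j(u)=0$ and $\mu_j\ge 0$ for all $j$. Strict complementarity condition: $\mu_j+g_j(u)>0$ for all $j=1,\ldots,m_2$. Second order sufficiency condition: with $L(x)=f(x)-\sum_{i=1}^{m_1}\lambda_ih_i(x)-\sum_{j\in J(u)}\mu_jg_j(x)$ and $G(u)$ the matrix with rows $\nabla h_1(u)^T,\ldots,\nabla h_{m_1}(u)^T,\nabla g_{j_1}(u)^T,\ldots,\nabla g_{j_r}(u)^T$, one has $v^T\nabla_x^2L(u)v>0$ for all $0\ne v$ in the null space of $G(u)$. The polynomials $\varphi_1,\ldots,\varphi_L$ referred to in the claim are those occurring in the following list (in which $m_1\le n$): (a) if $m_1+m_2\ge n+1$: $Res(h_1,\ldots,h_{m_1},g_{j_1},\ldots,g_{j_{n-m_1+1}})$ for all $1\le j_1<\cdots<j_{n-m_1+1}\le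 m_2$; (b) $\Delta(h_1,\ldots,h_{m_1},g_{j_1},\ldots,g_{j_r})$ for all $1\le j_1<\cdots<j_r\le m_2$ with $0\le r\le n-m_1$; (c) $\mathscr{R}(f,p_1,\ldots,p_k;p_{k+1})$ for all $1\le j_1<\cdots<j_r\le m_2$ with $0\le r\le n-m_1$, where $(p_1,\ldots,p_k,p_{k+1})$ is any re-ordering of $(h_1,\ldots,h_{m_1},g_{j_1},\ldots,g_{j_r})$; (d) $\mathscr{D}(f,h_1,\ldots,h_{m_1},g_{j_1},\ldots,g_{j_r})$ for all $1\le j_1<\cdots<j_r\le m_2$ with $0\le r\le n-m_1$. Entries (b), (c) are omitted for the empty tuple ($m_1=r=0$). Notation in the list: for $p\in\mathbb{R}[x]_d$, regarded as having degree $d$, $\widetilde p(\tilde x)=x_0^dp(x/x_0)$ is its homogenization; $\nabla_x,\nabla_x^2$ are taken with respect to $x_1,\ldots,x_n$ only. Resultant: $Res(f_0,\ldots,f_n)$, for $n+1$ polynomials in $x$, is the resultant of $\widetilde{f_0},\ldots,\widetilde{f_n}$, a polynomial in the coefficients that vanishes iff $\widetilde{f_0},\ldots,\widetilde{f_n}$ have a common zero $0\ne\tilde u\in\mathbb{C}^{n+1}$. Discriminant: $\Delta(f_1,\ldots,f_m)$, for $1\le m\le n$ polynomials in $x$, at least one of degree $>1$, is the discriminant of $\widetilde{f_1},\ldots,\widetilde{f_m}$, a polynomial in the coefficients that vanishes iff there is $0\ne\tilde u\in\mathbb{C}^{n+1}$ with $\widetilde{f_1}(\tilde u)=\cdots=\widetilde{f_m}(\tilde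 u)=0$ and the gradients of $\widetilde{f_1},\ldots,\widetilde{f_m}$ with respect to $\tilde x$ at $\tilde u$ having rank $<m$. (If all degrees are $1$, "$\Delta\ne0$" means that no such $\tilde u$ exists.) $\mathscr{R}$: for $0\le k\le n$, $\mathscr{R}(p_0,\ldots,p_k;q)=\sum_iR_i(p_0,\ldots,p_k;q)^2$, where $R_1,\ldots,R_t$ are polynomials (provided by elimination theory) with integer coefficients in the coefficients of $p_0,\ldots,p_k,q$, homogeneous in those of each of them, whose simultaneous vanishing is equivalent to the existence of $0\ne\tilde x\in\mathbb{C}^{n+1}$ with $\operatorname{rank}[\nabla_x\widetilde{p_0}(\tilde x)\ \cdots\ \nabla_x\widetilde{p_k}(\tilde x)]\le k$ and $\widetilde{p_1}(\tilde x)=\cdots=\widetilde{p_k}(\tilde x)=\widetilde q(\tilde x)=0$. $\mathscr{D}$: for $0\le k\le n$, $\mathscr{D}(p_0,\ldots,p_k)=\sum_iD_i(p_0,\ldots,p_k)^2$, where $D_1,\ldots,D_s$ are polynomials (provided by elimination theory) with integer coefficients in the coefficients of $p_0,\ldots,p_k$, homogeneous in those of each of them, whose simultaneous vanishing is equivalent to the existence of $0\ne\tilde x\in\mathbb{C}^{n+1}$ and $0\ne y\in\mathbb{C}^n$ with $\operatorname{rank}\widetilde P(\tilde x,y)\le2k$, $\widetilde{p_i}(\tilde x)=0$ and $(\nabla_x\widetilde{p_i}(\tilde x))^Ty=0$ for $i=1,\ldots,k$. Here $\widetilde P(\tilde x,y)$ is the $(2n)\times(2k+1)$ matrix with columns $\begin{bmatrix}\nabla_x\widetilde{p_i}\\(\nabla_x^2\widetilde{p_i})y\end{bmatrix}$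 ($i=0,\ldots,k$) and $\begin{bmatrix}0\\\nabla_x\widetilde{p_i}\end{bmatrix}$ ($i=1,\ldots,k$). *)

theory Defs
  imports "HOL-Analysis.Analysis" "HOL-Library.Poly_Mapping" "HOL-Library.Multiset"
begin

section \<open>Multivariate polynomials as finitely supported functions\<close>

type_synonym 'v expo = "'v \<Rightarrow>\<^sub>0 nat"
type_synonym ('v, 'a) mpol = "'v expo \<Rightarrow>\<^sub>0 'a"

definition expo_deg :: "'v expo \<Rightarrow> nat" where
  "expo_deg a = (\<Sum>v\<in>Poly_Mapping.keys a. Poly_Mapping.lookup a v)"

definition mpol_vars :: "('v, 'a::zero) mpol \<Rightarrow> 'v set" where
  "mpol_vars p = (\<Union>a\<in>Poly_Mapping.keys p. Poly_Mapping.keys a)"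

definition mpol_eval :: "('v, 'a::comm_semiring_1) mpol \<Rightarrow> ('v \<Rightarrow> 'a) \<Rightarrow> 'a" where
  "mpol_eval p x = (\<Sum>a\<in>Poly_Mapping.keys p. Poly_Mapping.lookup p a * (\<Prod>v\<in>Poly_Mapping.keys a. x v ^ Poly_Mapping.lookup a v))"

definition mpol_const :: "'a::zero \<Rightarrow> ('v, 'a) mpol" where
  "mpol_const c = Poly_Mapping.single 0 c"

text \<open>Formal partial derivative. If \<open>v\<close> does not occur in the monomial \<open>a\<close>, the truncated
  subtraction is harmless, since the new coefficient is zero.\<close>

definition mpol_diff :: "'v \<Rightarrow> ('v, 'a::comm_semiring_1) mpol \<Rightarrow> ('v, 'a) mpol" where
  "mpol_diff v p =
     (\<Sum>a\<in>Poly_Mapping.keys p. Poly_Mapping.single (a - Poly_Mapping.single v 1) (of_nat (Poly_Mapping.lookup a v) * Poly_Mapping.lookup p a))"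

text \<open>The space of real polynomials in \<open>x\<close> of degree at most \<open>d\<close>; here \<open>n = CARD('n)\<close>.\<close>

definition polys_deg_le :: "nat \<Rightarrow> ('n::finite, real) mpol set" where
  "polys_deg_le d = {p. \<forall>a\<in>Poly_Mapping.keys p. expo_deg a \<le> d}"

definition mpol_gradient :: "('n::finite, real) mpol \<Rightarrow> real^'n \<Rightarrow> real^'n" where
  "mpol_gradient p u = (\<chi> i. mpol_eval (mpol_diff i p) (($) u))"

definition mpol_hessian :: "('n::finite, real) mpol \<Rightarrow> real^'n \<Rightarrow> real^'n^'n" where
  "mpol_hessian p u = (\<chi> i j. mpol_eval (mpol_diff i (mpol_diff j p)) (($) u))"


section \<open>Homogenization\<close>

text \<open>The variables of the homogenization are indexed by \<open>'n option\<close>, where \<open>None\<close> stands for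
  \<open>x\<^sub>0\<close> and \<open>Some i\<close> for \<open>x\<^sub>i\<close>. The polynomial is regarded as having degree \<open>d\<close>, which need
  not be its actual degree. Coefficients are embedded into the complex numbers.\<close>

definition homog_expo :: "nat \<Rightarrow> 'n::finite expo \<Rightarrow> 'n option expo" where
  "homog_expo d a = Poly_Mapping.single None (d - expo_deg a)
     + (\<Sum>i\<in>UNIV. Poly_Mapping.single (Some i) (Poly_Mapping.lookup a i))"

definition homogenize :: "nat \<Rightarrow> ('n::finite, real) mpol \<Rightarrow> ('n option, complex) mpol" where
  "homogenize d p = (\<Sum>a\<in>Poly_Mapping.keys p. Poly_Mapping.single (homog_expo d a) (complex_of_real (Poly_Mapping.lookup p a)))"

definition ceval :: "('n::finite option, complex) mpol \<Rightarrow> complex^('n option) \<Rightarrow> complex" where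
  "ceval P z = mpol_eval P (($) z)"

definition full_gradient ::
  "('n::finite option, complex) mpol \<Rightarrow> complex^('n option) \<Rightarrow> complex^('n option)" where
  "full_gradient P z = (\<chi> i. ceval (mpol_diff i P) z)"

text \<open>Gradient and Hessian with respect to \<open>x\<^sub>1, \<dots>, x\<^sub>n\<close> only.\<close>

definition x_gradient ::
  "('n::finite option, complex) mpol \<Rightarrow> complex^('n option) \<Rightarrow> complex^'n" where
  "x_gradient P z = (\<chi> i. ceval (mpol_diff (Some i) P) z)"

definition x_hessian ::
  "('n::finite option, complex) mpol \<Rightarrow> complex^('n option) \<Rightarrow> complex^'n^'n" where
  "x_hessian P z = (\<chi> i j. ceval (mpol_diff (Some i) (mpol_diff (Some j) P)) z)"

text \<open>Rank of the matrix with the given columns (the number of columns varies, so it cannot be a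
  type).\<close>

definition columns_rank :: "(complex^'m) list \<Rightarrow> nat" where
  "columns_rank cs = vec.dim (set cs)"


section \<open>Vanishing conditions for tuples of forms\<close>

definition res_condition :: "('n::finite option, complex) mpol list \<Rightarrow> bool" where
  "res_condition Ps \<longleftrightarrow> (\<exists>z. z \<noteq> 0 \<and> (\<forall>P\<in>set Ps. ceval P z = 0))"

definition disc_condition :: "('n::finite option, complex) mpol list \<Rightarrow> bool" where
  "disc_condition Ps \<longleftrightarrow> (\<exists>z. z \<noteq> 0 \<and> (\<forall>P\<in>set Ps. ceval P z = 0) \<and>
     columns_rank (map (\<lambda>P. full_gradient P z) Ps) < length Ps)"

text \<open>In the next two conditions the tuple \<open>(p\<^sub>0, \<dots>, p\<^sub>k)\<close> is \<open>P0 # Ps\<close>, so \<open>k = length Ps\<close>.\<close>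

definition R_condition ::
  "('n::finite option, complex) mpol \<Rightarrow> ('n option, complex) mpol list \<Rightarrow>
   ('n option, complex) mpol \<Rightarrow> bool" where
  "R_condition P0 Ps Q \<longleftrightarrow> (\<exists>z. z \<noteq> 0 \<and>
     columns_rank (map (\<lambda>P. x_gradient P z) (P0 # Ps)) \<le> length Ps \<and>
     (\<forall>P\<in>set Ps. ceval P z = 0) \<and> ceval Q z = 0)"

definition stack :: "complex^'n \<Rightarrow> complex^'n \<Rightarrow> complex^('n + 'n)" where
  "stack v w = (\<chi> i. case i of Inl a \<Rightarrow> v $ a | Inr b \<Rightarrow> w $ b)"

definition D_columns ::
  "('n::finite option, complex) mpol \<Rightarrow> ('n option, complex) mpol list \<Rightarrow>
   complex^('n option) \<Rightarrow> complex^'n \<Rightarrow> (complex^('n + 'n)) list" where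
  "D_columns P0 Ps z y =
     map (\<lambda>P. stack (x_gradient P z) (x_hessian P z *v y)) (P0 # Ps) @
     map (\<lambda>P. stack 0 (x_gradient P z)) Ps"

definition D_condition ::
  "('n::finite option, complex) mpol \<Rightarrow> ('n option, complex) mpol list \<Rightarrow> bool" where
  "D_condition P0 Ps \<longleftrightarrow> (\<exists>z y. z \<noteq> 0 \<and> y \<noteq> 0 \<and>
     columns_rank (D_columns P0 Ps z y) \<le> 2 * length Ps \<and>
     (\<forall>P\<in>set Ps. ceval P z = 0 \<and> (\<Sum>i\<in>UNIV. x_gradient P z $ i * y $ i) = 0))"


section \<open>Polynomials in the coefficients of the input polynomials\<close>

text \<open>An input \<open>(f, h\<^sub>1, \<dots>, g\<^sub>1, \<dots>)\<close> is the function \<open>case_slot f h g\<close>, and its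
  degrees are \<open>case_slot d0 d d'\<close>. The variable \<open>(s, a)\<close> of a coefficient polynomial stands for
  the coefficient of the monomial \<open>a\<close> in the polynomial in slot \<open>s\<close>.\<close>

datatype slot = Obj | Eqn nat | Ineq nat

type_synonym 'n coeff_poly = "(slot \<times> 'n expo, real) mpol"

definition coeff_eval :: "'n::finite coeff_poly \<Rightarrow> (slot \<Rightarrow> ('n, real) mpol) \<Rightarrow> real" where
  "coeff_eval \<phi> p = mpol_eval \<phi> (\<lambda>(s, a). Poly_Mapping.lookup (p s) a)"

definition in_coeffs_of :: "(slot \<Rightarrow> nat) \<Rightarrow> slot list \<Rightarrow> 'n::finite coeff_poly \<Rightarrow> bool" where
  "in_coeffs_of dg ss \<phi> \<longleftrightarrow> mpol_vars \<phi> \<subseteq> {(s, a). s \<in> set ss \<and> expo_deg a \<le> dg s}"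

definition inputs_at :: "(slot \<Rightarrow> nat) \<Rightarrow> slot list \<Rightarrow> (slot \<Rightarrow> ('n::finite, real) mpol) \<Rightarrow> bool" where
  "inputs_at dg ss p \<longleftrightarrow> (\<forall>s\<in>set ss. p s \<in> polys_deg_le (dg s))"

definition hom_at :: "(slot \<Rightarrow> nat) \<Rightarrow> (slot \<Rightarrow> ('n::finite, real) mpol) \<Rightarrow> slot \<Rightarrow>
    ('n option, complex) mpol" where
  "hom_at dg p s = homogenize (dg s) (p s)"

definition integer_coeffs :: "'n::finite coeff_poly \<Rightarrow> bool" where
  "integer_coeffs \<phi> \<longleftrightarrow> (\<forall>m\<in>Poly_Mapping.keys \<phi>. Poly_Mapping.lookup \<phi> m \<in> \<int>)"

definition homogeneous_in_slot :: "slot \<Rightarrow> 'n::finite coeff_poly \<Rightarrow> bool" where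
  "homogeneous_in_slot s \<phi> \<longleftrightarrow>
     (\<exists>e. \<forall>m\<in>Poly_Mapping.keys \<phi>. (\<Sum>v\<in>{v \<in> Poly_Mapping.keys m. fst v = s}. Poly_Mapping.lookup m v) = e)"

text \<open>The tuple of input polynomials to which resultant, discriminant etc. are applied is given by
  the list \<open>ss\<close> of its slots.\<close>

definition is_Res :: "(slot \<Rightarrow> nat) \<Rightarrow> slot list \<Rightarrow> 'n::finite coeff_poly \<Rightarrow> bool" where
  "is_Res dg ss \<phi> \<longleftrightarrow> in_coeffs_of dg ss \<phi> \<and>
     (\<forall>p. inputs_at dg ss p \<longrightarrow> (coeff_eval \<phi> p = 0 \<longleftrightarrow> res_condition (map (hom_at dg p) ss)))"

text \<open>If all degrees are 1, there is no discriminant hypersurface over the complex numbers, but on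
  real inputs the same condition still is the vanishing of one polynomial (the sum of the squares of
  the maximal minors of the coefficient matrix).\<close>

definition is_Disc :: "(slot \<Rightarrow> nat) \<Rightarrow> slot list \<Rightarrow> 'n::finite coeff_poly \<Rightarrow> bool" where
  "is_Disc dg ss \<phi> \<longleftrightarrow> in_coeffs_of dg ss \<phi> \<and>
     (\<forall>p. inputs_at dg ss p \<longrightarrow> (coeff_eval \<phi> p = 0 \<longleftrightarrow> disc_condition (map (hom_at dg p) ss)))"

text \<open>\<open>Rs\<close> is a list of elimination polynomials for the condition \<open>C\<close> on the input tuple.\<close>

definition elimination_polys :: "(slot \<Rightarrow> nat) \<Rightarrow> slot list \<Rightarrow>
    ((slot \<Rightarrow> ('n::finite, real) mpol) \<Rightarrow> bool) \<Rightarrow> 'n coeff_poly list \<Rightarrow> bool" where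
  "elimination_polys dg ss C Rs \<longleftrightarrow>
     (\<forall>R\<in>set Rs. in_coeffs_of dg ss R \<and> integer_coeffs R \<and> (\<forall>s\<in>set ss. homogeneous_in_slot s R)) \<and>
     (\<forall>p. inputs_at dg ss p \<longrightarrow> ((\<forall>R\<in>set Rs. coeff_eval R p = 0) \<longleftrightarrow> C p))"

definition is_R :: "(slot \<Rightarrow> nat) \<Rightarrow> slot \<Rightarrow> slot list \<Rightarrow> slot \<Rightarrow> 'n::finite coeff_poly \<Rightarrow> bool" where
  "is_R dg s0 ss t \<phi> \<longleftrightarrow> (\<exists>Rs.
     elimination_polys dg (s0 # ss @ [t])
       (\<lambda>p. R_condition (hom_at dg p s0) (map (hom_at dg p) ss) (hom_at dg p t)) Rs \<and>
     \<phi> = (\<Sum>R\<leftarrow>Rs. R\<^sup>2))"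

definition is_D :: "(slot \<Rightarrow> nat) \<Rightarrow> slot \<Rightarrow> slot list \<Rightarrow> 'n::finite coeff_poly \<Rightarrow> bool" where
  "is_D dg s0 ss \<phi> \<longleftrightarrow> (\<exists>Ds.
     elimination_polys dg (s0 # ss)
       (\<lambda>p. D_condition (hom_at dg p s0) (map (hom_at dg p) ss)) Ds \<and>
     \<phi> = (\<Sum>D\<leftarrow>Ds. D\<^sup>2))"


section \<open>The list of polynomials\<close>

text \<open>The tuples \<open>(h\<^sub>1, \<dots>, h\<^bsub>m1\<^esub>, g\<^bsub>j1\<^esub>, \<dots>, g\<^bsub>jr\<^esub>)\<close> with \<open>j1 < \<dots> < jr\<close>.\<close>

definition constr_tuples :: "nat \<Rightarrow> nat \<Rightarrow> nat \<Rightarrow> slot list set" where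
  "constr_tuples m1 m2 r = {map Eqn [1..<Suc m1] @ map Ineq js | js.
     sorted_wrt (<) js \<and> set js \<subseteq> {1..m2} \<and> length js = r}"

definition tuples_a :: "nat \<Rightarrow> nat \<Rightarrow> nat \<Rightarrow> slot list set" where
  "tuples_a n m1 m2 = (if m1 + m2 \<ge> n + 1 then constr_tuples m1 m2 (n - m1 + 1) else {})"

definition tuples_d :: "nat \<Rightarrow> nat \<Rightarrow> nat \<Rightarrow> slot list set" where
  "tuples_d n m1 m2 = (\<Union>r\<in>{0..n - m1}. constr_tuples m1 m2 r)"

definition tuples_b :: "nat \<Rightarrow> nat \<Rightarrow> nat \<Rightarrow> slot list set" where
  "tuples_b n m1 m2 = tuples_d n m1 m2 - {[]}"

definition tuples_c :: "nat \<Rightarrow> nat \<Rightarrow> nat \<Rightarrow> slot list set" where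
  "tuples_c n m1 m2 = {ts. \<exists>ss\<in>tuples_b n m1 m2. mset ts = mset ss}"

text \<open>\<open>\<Phi>\<close> consists of one polynomial for each entry of the list. In the third family
  \<open>(p\<^sub>1, \<dots>, p\<^sub>k, p\<^bsub>k+1\<^esub>)\<close> is split into \<open>butlast ss\<close> and \<open>last ss\<close>.\<close>

definition genericity_list ::
  "(slot \<Rightarrow> nat) \<Rightarrow> nat \<Rightarrow> nat \<Rightarrow> 'n::finite coeff_poly set \<Rightarrow> bool" where
  "genericity_list dg m1 m2 \<Phi> \<longleftrightarrow> (let n = CARD('n) in
     \<exists>A B C D.
       (\<forall>ss\<in>tuples_a n m1 m2. is_Res dg ss (A ss)) \<and>
       (\<forall>ss\<in>tuples_b n m1 m2. is_Disc dg ss (B ss)) \<and>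
       (\<forall>ss\<in>tuples_c n m1 m2. is_R dg Obj (butlast ss) (last ss) (C ss)) \<and>
       (\<forall>ss\<in>tuples_d n m1 m2. is_D dg Obj ss (D ss)) \<and>
       \<Phi> = A ` tuples_a n m1 m2 \<union> B ` tuples_b n m1 m2 \<union>
            C ` tuples_c n m1 m2 \<union> D ` tuples_d n m1 m2)"


section \<open>The optimization problem and its optimality conditions\<close>

definition feasible_set :: "nat \<Rightarrow> nat \<Rightarrow> (nat \<Rightarrow> ('n::finite, real) mpol) \<Rightarrow>
    (nat \<Rightarrow> ('n, real) mpol) \<Rightarrow> (real^'n) set" where
  "feasible_set m1 m2 h g = {x. (\<forall>i\<in>{1..m1}. mpol_eval (h i) (($) x) = 0) \<and>
                               (\<forall>j\<in>{1..m2}. mpol_eval (g j) (($) x) \<ge> 0)}"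

definition local_minimizer :: "nat \<Rightarrow> nat \<Rightarrow> ('n::finite, real) mpol \<Rightarrow>
    (nat \<Rightarrow> ('n, real) mpol) \<Rightarrow> (nat \<Rightarrow> ('n, real) mpol) \<Rightarrow> real^'n \<Rightarrow> bool" where
  "local_minimizer m1 m2 f h g u \<longleftrightarrow> u \<in> feasible_set m1 m2 h g \<and>
     (\<exists>\<epsilon>>0. \<forall>x\<in>feasible_set m1 m2 h g \<inter> ball u \<epsilon>. mpol_eval f (($) u) \<le> mpol_eval f (($) x))"

definition active_set :: "nat \<Rightarrow> (nat \<Rightarrow> ('n::finite, real) mpol) \<Rightarrow> real^'n \<Rightarrow> nat set" where
  "active_set m2 g u = {j\<in>{1..m2}. mpol_eval (g j) (($) u) = 0}"

text \<open>Linear independence of a family (not merely of the set of its values), hence the injectivity.\<close>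

definition constraint_qualification :: "nat \<Rightarrow> nat \<Rightarrow> (nat \<Rightarrow> ('n::finite, real) mpol) \<Rightarrow>
    (nat \<Rightarrow> ('n, real) mpol) \<Rightarrow> real^'n \<Rightarrow> bool" where
  "constraint_qualification m1 m2 h g u \<longleftrightarrow>
     (let K = Eqn ` {1..m1} \<union> Ineq ` active_set m2 g u;
          G = (\<lambda>s. mpol_gradient (case_slot 0 h g s) u)
      in inj_on G K \<and> independent (G ` K))"

definition lagrange_multipliers :: "nat \<Rightarrow> nat \<Rightarrow> ('n::finite, real) mpol \<Rightarrow>
    (nat \<Rightarrow> ('n, real) mpol) \<Rightarrow> (nat \<Rightarrow> ('n, real) mpol) \<Rightarrow> real^'n \<Rightarrow>
    (nat \<Rightarrow> real) \<Rightarrow> (nat \<Rightarrow> real) \<Rightarrow> bool" where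
  "lagrange_multipliers m1 m2 f h g u lam mu \<longleftrightarrow>
     mpol_gradient f u = (\<Sum>i\<in>{1..m1}. lam i *\<^sub>R mpol_gradient (h i) u)
                       + (\<Sum>j\<in>{1..m2}. mu j *\<^sub>R mpol_gradient (g j) u) \<and>
     (\<forall>j\<in>{1..m2}. mu j * mpol_eval (g j) (($) u) = 0 \<and> mu j \<ge> 0)"

definition strict_complementarity :: "nat \<Rightarrow> (nat \<Rightarrow> ('n::finite, real) mpol) \<Rightarrow> real^'n \<Rightarrow>
    (nat \<Rightarrow> real) \<Rightarrow> bool" where
  "strict_complementarity m2 g u mu \<longleftrightarrow> (\<forall>j\<in>{1..m2}. mu j + mpol_eval (g j) (($) u) > 0)"

definition lagrangian :: "nat \<Rightarrow> nat set \<Rightarrow> ('n::finite, real) mpol \<Rightarrow>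
    (nat \<Rightarrow> ('n, real) mpol) \<Rightarrow> (nat \<Rightarrow> ('n, real) mpol) \<Rightarrow>
    (nat \<Rightarrow> real) \<Rightarrow> (nat \<Rightarrow> real) \<Rightarrow> ('n, real) mpol" where
  "lagrangian m1 J f h g lam mu =
     f - (\<Sum>i\<in>{1..m1}. mpol_const (lam i) * h i) - (\<Sum>j\<in>J. mpol_const (mu j) * g j)"

definition second_order_sufficiency :: "nat \<Rightarrow> nat \<Rightarrow> ('n::finite, real) mpol \<Rightarrow>
    (nat \<Rightarrow> ('n, real) mpol) \<Rightarrow> (nat \<Rightarrow> ('n, real) mpol) \<Rightarrow> real^'n \<Rightarrow>
    (nat \<Rightarrow> real) \<Rightarrow> (nat \<Rightarrow> real) \<Rightarrow> bool" where
  "second_order_sufficiency m1 m2 f h g u lam mu \<longleftrightarrow>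
     (let J = active_set m2 g u in
      \<forall>v. v \<noteq> 0 \<and> (\<forall>i\<in>{1..m1}. mpol_gradient (h i) u \<bullet> v = 0) \<and>
             (\<forall>j\<in>J. mpol_gradient (g j) u \<bullet> v = 0) \<longrightarrow>
          v \<bullet> (mpol_hessian (lagrangian m1 J f h g lam mu) u *v v) > 0)"

end

theory Submission
  imports Defs "HOL-Computational_Algebra.Fundamental_Theorem_Algebra"
begin

text \<open>Existence of the polynomials is elimination theory, carried out with polynomial functions.
  A condition that is invariant under scaling of some variables is eliminated variable by variable:
  forms in \<open>x\<^sub>1, \<dots>, x\<^sub>n\<close>, read as univariate polynomials \<open>f\<^sub>1, \<dots>, f\<^sub>s\<close> in one variable, have a common
  root, or all their leading coefficients vanish, iff some nonzero linear functional on
  polynomials of degree less than \<open>2D\<close> kills all the shifts of the \<open>f\<^sub>i\<close>; that is the nontrivial solvability of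
  a homogeneous linear system, which is again expressed by polynomials. Rank conditions
  are linear dependencies, hence of the same kind. Homogeneity in each slot comes for free by
  passing to homogeneous components.

  At a local minimizer \<open>u\<close> every violated optimality condition yields a point of one of the excluded
  varieties over \<open>z = (1, u)\<close>: too many active constraints are a common zero, dependent
  gradients stay dependent after adding the \<open>x\<^sub>0\<close>-derivatives because of Euler's identity, a vanishing
  multiplier leaves the objective gradient in the span of the remaining ones, and a degenerate direction \<open>v\<close> in the
  second order condition is a kernel vector of a positive semidefinite form on the tangent
  space, so that its image under the Hessian of the Lagrangian is a combination of the
  gradients.\<close>

section \<open>Graded integer polynomial functions\<close>

text \<open>Projections of affine closed sets need not be closed, so each eliminated variable must
  also account for a value at infinity: the point with that coordinate 1 and the other eliminated
  coordinates 0, where a form equals its top coefficient. The bound \<open>2 * D\<close> comes from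
  a Bezout identity: if some \<open>f k\<close> attains its formal degree, the cofactors can be
  reduced modulo it to degree below \<open>D\<close>, and their products with forms of degree at
  most \<open>D\<close> stay below \<open>2 * D\<close>. Equations have integer coefficients, their
  zeros are sought over the complex numbers, and the inputs are real. Reality of the inputs lets one
  sum of squares stand for a whole system; resultants and discriminants also take this form, since
  their specification fixes only the variables and the zeros on real inputs. On the analytic side,
  the curve that follows the active constraints comes from the inverse function theorem and is used
  only as a curve differentiable at its starting point. Second order information therefore cannot be
  had by differentiating twice along it; it comes from the Lagrangian, whose gradient vanishes at
  the minimizer.\<close>

inductive gpoly :: "'i set \<Rightarrow> ('i \<Rightarrow> nat) \<Rightarrow> nat \<Rightarrow> (('i \<Rightarrow> complex) \<Rightarrow> complex) \<Rightarrow> bool"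
  for I w where
  gpoly_const: "gpoly I w 0 (\<lambda>x. of_int k)"
| gpoly_zero: "gpoly I w d (\<lambda>x. 0)"
| gpoly_var: "i \<in> I \<Longrightarrow> gpoly I w (w i) (\<lambda>x. x i)"
| gpoly_add: "gpoly I w d F \<Longrightarrow> gpoly I w d G \<Longrightarrow> gpoly I w d (\<lambda>x. F x + G x)"
| gpoly_mult: "gpoly I w d F \<Longrightarrow> gpoly I w e G \<Longrightarrow> gpoly I w (d + e) (\<lambda>x. F x * G x)"

text \<open>With all weights 0 the grading is void, which leaves arbitrary integer polynomial
  functions in the variables \<open>I\<close>.\<close>

abbreviation ipoly :: "'i set \<Rightarrow> (('i \<Rightarrow> complex) \<Rightarrow> complex) \<Rightarrow> bool" where
  "ipoly I \<equiv> gpoly I (\<lambda>_. 0) 0"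

lemma gpoly_imp_ipoly: "gpoly I w d F \<Longrightarrow> ipoly I F"
proof (induction rule: gpoly.induct)
  case (gpoly_var i)
  then show ?case using gpoly.gpoly_var[of i I "\<lambda>_. 0"] by simp
next
  case (gpoly_mult d F e G)
  then show ?case using gpoly.gpoly_mult[of I "\<lambda>_. 0" 0 F 0 G] by simp
qed (auto intro: gpoly.intros)

lemma gpoly_mono: "gpoly I w d F \<Longrightarrow> I \<subseteq> J \<Longrightarrow> gpoly J w d F"
  by (induction rule: gpoly.induct) (auto intro: gpoly.intros)

lemma gpoly_sum: "finite A \<Longrightarrow> (\<And>a. a \<in> A \<Longrightarrow> gpoly I w d (F a)) \<Longrightarrow> gpoly I w d (\<lambda>x. \<Sum>a\<in>A. F a x)"
  by (induction rule: finite_induct) (auto intro: gpoly.intros)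

lemma ipoly_const: "ipoly I (\<lambda>x. of_int k)"
  by (rule gpoly_const)

lemma ipoly_1: "ipoly I (\<lambda>x. 1)"
  using ipoly_const[of I 1] by simp

lemma ipoly_var: "i \<in> I \<Longrightarrow> ipoly I (\<lambda>x. x i)"
  using gpoly_var[of i I "\<lambda>_. 0"] by simp

lemma ipoly_mult: "ipoly I F \<Longrightarrow> ipoly I G \<Longrightarrow> ipoly I (\<lambda>x. F x * G x)"
  using gpoly_mult[of I "\<lambda>_. 0" 0 F 0 G] by simp

lemma ipoly_diff:
  assumes "ipoly I F" "ipoly I G" shows "ipoly I (\<lambda>x. F x - G x)"
  using gpoly_add[OF assms(1) ipoly_mult[OF ipoly_const[of I "-1"] assms(2)]] by simp

lemma ipoly_prod: "finite A \<Longrightarrow> (\<And>a. a \<in> A \<Longrightarrow> ipoly I (F a)) \<Longrightarrow> ipoly I (\<lambda>x. \<Prod>a\<in>A. F a x)"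
  by (induction rule: finite_induct) (auto intro: ipoly_1 ipoly_mult)

lemma ipoly_power: "ipoly I F \<Longrightarrow> ipoly I (\<lambda>x. F x ^ k)"
  by (induction k) (auto intro: ipoly_1 ipoly_mult)

text \<open>The case \<open>c = 0\<close> is included: as \<open>0 ^ 0 = 1\<close>, it kills the
  variables of positive weight and keeps the others, which is how top coefficients are read off
  later.\<close>

lemma gpoly_scale: "gpoly I w d F \<Longrightarrow> F (\<lambda>i. c ^ w i * x i) = c ^ d * F x"
  by (induction rule: gpoly.induct) (auto simp: algebra_simps power_add)

lemma gpoly_cong: "gpoly I w d F \<Longrightarrow> (\<And>i. i \<in> I \<Longrightarrow> x i = y i) \<Longrightarrow> F x = F y"
  by (induction rule: gpoly.induct) auto

text \<open>Substituting an integer keeps the coefficients integral. With the value 1 this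
  dehomogenizes the last variable to be eliminated.\<close>

lemma ipoly_subst:
  "gpoly I w d F \<Longrightarrow> ipoly (I - {v}) (\<lambda>x. F (x(v := of_int k)))"
proof (induction rule: gpoly.induct)
  case (gpoly_var i)
  then show ?case by (cases "i = v") (auto intro: ipoly_const ipoly_var)
qed (auto intro: gpoly.intros ipoly_mult)

text \<open>The polynomial \<open>f x\<close> is \<open>F\<close> with each \<open>x i\<close>
  multiplied by the power \<open>w i\<close> of an auxiliary variable. Its coefficients are the
  components of given weighted degree, and the value 1 gives back \<open>F\<close>. Since
  \<open>N\<close> does not depend on \<open>x\<close>, finitely many components suffice.\<close>

lemma ipoly_components:
  assumes "ipoly I F"
  shows "\<exists>N f. (\<forall>e. gpoly I w e (\<lambda>x. coeff (f x) e)) \<and> (\<forall>x. degree (f x) \<le> N \<and> F x = poly (f x) 1)"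
  using assms
proof (induction rule: gpoly.induct)
  case (gpoly_const k)
  have "gpoly I w e (\<lambda>x. coeff [:of_int k:] e)" for e
    by (cases e) (auto intro: gpoly.intros)
  then show ?case by (intro exI[of _ 0] exI[of _ "\<lambda>x. [:of_int k:]"]) auto
next
  case (gpoly_zero d)
  show ?case by (intro exI[of _ 0] exI[of _ "\<lambda>x. 0"]) (auto intro: gpoly.intros)
next
  case (gpoly_var i)
  have "gpoly I w e (\<lambda>x. coeff (monom (x i) (w i)) e)" for e
    using gpoly_var by (cases "e = w i") (auto intro: gpoly.intros)
  then show ?case
    by (intro exI[of _ "w i"] exI[of _ "\<lambda>x. monom (x i) (w i)"]) (auto simp: poly_monom degree_monom_le)
next
  case (gpoly_add d F G)
  then obtain N f M g where "\<forall>e. gpoly I w e (\<lambda>x. coeff (f x) e)" "\<forall>x. degree (f x) \<le> N \<and> F x = poly (f x) 1"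
    "\<forall>e. gpoly I w e (\<lambda>x. coeff (g x) e)" "\<forall>x. degree (g x) \<le> M \<and> G x = poly (g x) 1" by metis
  then show ?case
    by (intro exI[of _ "max N M"] exI[of _ "\<lambda>x. f x + g x"])
      (auto intro!: gpoly.gpoly_add degree_add_le intro: order.trans[OF _ max.cobounded1] order.trans[OF _ max.cobounded2])
next
  case (gpoly_mult d F d' G)
  then obtain N f M g where fg: "\<forall>e. gpoly I w e (\<lambda>x. coeff (f x) e)" "\<forall>x. degree (f x) \<le> N \<and> F x = poly (f x) 1"
    "\<forall>e. gpoly I w e (\<lambda>x. coeff (g x) e)" "\<forall>x. degree (g x) \<le> M \<and> G x = poly (g x) 1" by metis
  have "gpoly I w e (\<lambda>x. coeff (f x * g x) e)" for e
    unfolding coeff_mult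
  proof (rule gpoly_sum)
    fix i assume "i \<in> {..e}"
    then show "gpoly I w e (\<lambda>x. coeff (f x) i * coeff (g x) (e - i))"
      using gpoly.gpoly_mult[of I w i "\<lambda>x. coeff (f x) i" "e - i" "\<lambda>x. coeff (g x) (e - i)"] fg by simp
  qed simp
  with fg show ?case
    by (intro exI[of _ "N + M"] exI[of _ "\<lambda>x. f x * g x"])
       (fastforce intro!: order.trans[OF degree_mult_le] add_mono)+
qed

text \<open>Reads \<open>F\<close> as a univariate polynomial in the coordinate \<open>v\<close>.
  Because \<open>v\<close> has weight 1, its exponent never exceeds \<open>d\<close>, so
  \<open>d\<close> serves as a formal degree even where the top coefficient happens to
  vanish.\<close>

lemma gpoly_expand_var:
  assumes "gpoly I w d F" "w v = 1"
  shows "\<exists>f. (\<forall>k\<le>d. gpoly (I - {v}) w (d - k) (\<lambda>x. coeff (f x) k)) \<and>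
    (\<forall>x. degree (f x) \<le> d \<and> F x = poly (f x) (x v))"
  using assms(1)
proof (induction rule: gpoly.induct)
  case (gpoly_const k)
  show ?case by (rule exI[of _ "\<lambda>x. [:of_int k:]"]) (auto intro: gpoly.intros)
next
  case (gpoly_zero d)
  show ?case by (rule exI[of _ "\<lambda>x. 0"]) (auto intro: gpoly.intros)
next
  case (gpoly_var i)
  show ?case
  proof (cases "i = v")
    case True
    have "gpoly (I - {v}) w (1 - k) (\<lambda>x. coeff [:0, 1:] k)" if "k \<le> 1" for k
      using that gpoly.gpoly_const[of "I - {v}" w 1] by (cases k) (auto intro: gpoly.intros)
    with True assms(2) show ?thesis by (intro exI[of _ "\<lambda>x. [:0,1:]"]) auto
  next
    case False
    have "gpoly (I - {v}) w (w i - k) (\<lambda>x. coeff [:x i:] k)" for k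
      using False gpoly_var by (cases k) (auto intro: gpoly.intros)
    then show ?thesis by (intro exI[of _ "\<lambda>x. [:x i:]"]) auto
  qed
next
  case (gpoly_add d F G)
  then obtain f g where "\<forall>k\<le>d. gpoly (I - {v}) w (d - k) (\<lambda>x. coeff (f x) k)" "\<forall>x. degree (f x) \<le> d \<and> F x = poly (f x) (x v)"
    "\<forall>k\<le>d. gpoly (I - {v}) w (d - k) (\<lambda>x. coeff (g x) k)" "\<forall>x. degree (g x) \<le> d \<and> G x = poly (g x) (x v)" by metis
  then show ?case
    by (intro exI[of _ "\<lambda>x. f x + g x"]) (auto intro: gpoly.gpoly_add degree_add_le)
next
  case (gpoly_mult d F e G)
  then obtain f g where fg: "\<forall>k\<le>d. gpoly (I - {v}) w (d - k) (\<lambda>x. coeff (f x) k)" "\<forall>x. degree (f x) \<le> d \<and> F x = poly (f x) (x v)"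
    "\<forall>k\<le>e. gpoly (I - {v}) w (e - k) (\<lambda>x. coeff (g x) k)" "\<forall>x. degree (g x) \<le> e \<and> G x = poly (g x) (x v)" by metis
  have "gpoly (I - {v}) w (d + e - k) (\<lambda>x. coeff (f x * g x) k)" if k: "k \<le> d + e" for k
    unfolding coeff_mult
  proof (rule gpoly_sum)
    fix i assume i: "i \<in> {..k}"
    show "gpoly (I - {v}) w (d + e - k) (\<lambda>x. coeff (f x) i * coeff (g x) (k - i))"
    \<comment> \<open>Outside this range a factor vanishes, and the truncated differences
      \<open>d - i\<close> and \<open>e - (k - i)\<close> need not add up.\<close>
    proof (cases "i \<le> d \<and> k - i \<le> e")
      case True
      have "d - i + (e - (k - i)) = d + e - k" using True i by auto
      with True fg gpoly.gpoly_mult[of "I - {v}" w "d - i" "\<lambda>x. coeff (f x) i" "e - (k - i)" "\<lambda>x. coeff (g x) (k - i)"]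
      show ?thesis by auto
    next
      case False
      then have "coeff (f x) i * coeff (g x) (k - i) = 0" for x
        using fg(2,4) by (metis coeff_eq_0 le_less_trans linorder_not_le mult_eq_0_iff)
      then show ?thesis by (simp only: gpoly.gpoly_zero)
    qed
  qed simp
  with fg show ?case
    by (intro exI[of _ "\<lambda>x. f x * g x"]) (fastforce intro!: order.trans[OF degree_mult_le] add_mono)
qed

section \<open>Zariski closed conditions over the integers\<close>

definition zclosed :: "'i set \<Rightarrow> (('i \<Rightarrow> complex) \<Rightarrow> bool) \<Rightarrow> bool" where
  "zclosed I P \<longleftrightarrow> (\<exists>Gs. finite Gs \<and> (\<forall>G\<in>Gs. ipoly I G) \<and> (\<forall>x. P x \<longleftrightarrow> (\<forall>G\<in>Gs. G x = 0)))"

lemma zclosedI: "finite Gs \<Longrightarrow> (\<And>G. G \<in> Gs \<Longrightarrow> ipoly I G) \<Longrightarrow> (\<And>x. P x \<longleftrightarrow> (\<forall>G\<in>Gs. G x = 0)) \<Longrightarrow> zclosed I P"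
  unfolding zclosed_def by blast

lemma zclosed_eq0: "ipoly I G \<Longrightarrow> zclosed I (\<lambda>x. G x = 0)"
  by (rule zclosedI[of "{G}"]) auto

lemma zclosed_True: "zclosed I (\<lambda>x. True)"
  by (rule zclosedI[of "{}"]) auto

lemma zclosed_False: "zclosed I (\<lambda>x. False)"
  by (rule zclosedI[of "{\<lambda>x. 1}"]) (auto intro: ipoly_1)

lemma zclosed_conj:
  assumes "zclosed I P" "zclosed I Q" shows "zclosed I (\<lambda>x. P x \<and> Q x)"
proof -
  obtain A where A: "finite A" "\<forall>G\<in>A. ipoly I G" "\<forall>x. P x \<longleftrightarrow> (\<forall>G\<in>A. G x = 0)"
    using assms(1) unfolding zclosed_def by metis
  obtain B where B: "finite B" "\<forall>G\<in>B. ipoly I G" "\<forall>x. Q x \<longleftrightarrow> (\<forall>G\<in>B. G x = 0)"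
    using assms(2) unfolding zclosed_def by metis
  show ?thesis by (rule zclosedI[of "A \<union> B"]) (use A B in auto)
qed

lemma zclosed_disj:
  assumes "zclosed I P" "zclosed I Q" shows "zclosed I (\<lambda>x. P x \<or> Q x)"
proof -
  obtain A where A: "finite A" "\<forall>G\<in>A. ipoly I G" "\<forall>x. P x \<longleftrightarrow> (\<forall>G\<in>A. G x = 0)"
    using assms(1) unfolding zclosed_def by metis
  obtain B where B: "finite B" "\<forall>G\<in>B. ipoly I G" "\<forall>x. Q x \<longleftrightarrow> (\<forall>G\<in>B. G x = 0)"
    using assms(2) unfolding zclosed_def by metis
  show ?thesis
    by (rule zclosedI[of "(\<lambda>(F, G) x. F x * G x) ` (A \<times> B)"]) (use A B in \<open>auto intro: ipoly_mult\<close>)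
qed

lemma zclosed_ball:
  assumes "finite A" "\<And>a. a \<in> A \<Longrightarrow> zclosed I (P a)" shows "zclosed I (\<lambda>x. \<forall>a\<in>A. P a x)"
  using assms by (induction rule: finite_induct) (auto intro: zclosed_True zclosed_conj)

text \<open>Fraction-free Gaussian elimination instead of minors. Taking row \<open>i\<close> as
  pivot row for the unknown \<open>j\<close> leads to the system \<open>m' i\<close> in the
  remaining unknowns. A pivot cannot be chosen uniformly in \<open>x\<close>, but requiring for
  every row that its pivot vanishes or its reduced system is solvable is equivalent, and
  closed.\<close>

lemma zclosed_linear_system:
  assumes "finite J" "finite R" "\<And>r j. r \<in> R \<Longrightarrow> j \<in> J \<Longrightarrow> ipoly I (m r j)"
  shows "zclosed I (\<lambda>x. \<exists>c. (\<exists>j\<in>J. c j \<noteq> 0) \<and> (\<forall>r\<in>R. (\<Sum>j\<in>J. m r j x * c j) = 0))"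
  using assms
proof (induction J arbitrary: m rule: finite_induct)
  case empty
  then show ?case by (simp add: zclosed_False)
next
  case (insert j J)
  define m' where "m' i r k x = m i j x * m r k x - m r j x * m i k x" for i r k x
  let ?S = "\<lambda>J m x. \<exists>c. (\<exists>j\<in>J. c j \<noteq> 0) \<and> (\<forall>r\<in>R. (\<Sum>j\<in>J. m r j x * c j) = (0::complex))"
  have *: "?S (insert j J) m x \<longleftrightarrow> (\<forall>i\<in>R. m i j x = 0 \<or> ?S J (m' i) x)" for x
  proof (intro iffI ballI disjCI)
    fix i assume i: "i \<in> R" and nz: "\<not> ?S J (m' i) x" and "?S (insert j J) m x"
    then obtain c where c: "\<exists>k\<in>insert j J. c k \<noteq> 0"
      and s: "\<And>r. r \<in> R \<Longrightarrow> m r j x * c j + (\<Sum>k\<in>J. m r k x * c k) = 0"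
      using insert.hyps by auto
    have "(\<Sum>k\<in>J. m' i r k x * c k) = 0" if r: "r \<in> R" for r
    proof -
      have "(\<Sum>k\<in>J. m' i r k x * c k) = m i j x * (\<Sum>k\<in>J. m r k x * c k) - m r j x * (\<Sum>k\<in>J. m i k x * c k)"
        by (simp add: m'_def sum_distrib_left sum_subtractf[symmetric] algebra_simps)
      also have "(\<Sum>k\<in>J. m r k x * c k) = - (m r j x * c j)" using s[OF r] by (simp add: add_eq_0_iff)
      also have "(\<Sum>k\<in>J. m i k x * c k) = - (m i j x * c j)" using s[OF i] by (simp add: add_eq_0_iff)
      finally show ?thesis by simp
    qed
    \<comment> \<open>The rest of \<open>c\<close> solves the reduced system and so is zero; then
      \<open>c j\<close> is nonzero and row \<open>i\<close> forces its pivot to vanish.\<close>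
    with nz have z: "\<forall>k\<in>J. c k = 0" by blast
    with c have "c j \<noteq> 0" by auto
    with s[OF i] z show "m i j x = 0" by simp
  next
    assume a: "\<forall>i\<in>R. m i j x = 0 \<or> ?S J (m' i) x"
    show "?S (insert j J) m x"
    proof (cases "\<forall>i\<in>R. m i j x = 0")
      case True
      \<comment> \<open>Column \<open>j\<close> is zero, so its unit vector is a solution.\<close>
      show ?thesis
        by (rule exI[of _ "\<lambda>k. if k = j then 1 else 0"]) (use True insert.hyps in \<open>auto intro!: sum.neutral\<close>)
    next
      case False
      then obtain i where i: "i \<in> R" "m i j x \<noteq> 0" by blast
      with a obtain c where c: "\<exists>k\<in>J. c k \<noteq> 0" "\<And>r. r \<in> R \<Longrightarrow> (\<Sum>k\<in>J. m' i r k x * c k) = 0" by blast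
      \<comment> \<open>Back substitution: the pivot row determines the eliminated unknown.\<close>
      define t where "t = - (\<Sum>k\<in>J. m i k x * c k) / m i j x"
      have "m r j x * t + (\<Sum>k\<in>J. m r k x * c k) = 0" if r: "r \<in> R" for r
      proof -
        have "m i j x * (\<Sum>k\<in>J. m r k x * c k) - m r j x * (\<Sum>k\<in>J. m i k x * c k) = 0"
          using c(2)[OF r] by (simp add: m'_def sum_distrib_left sum_subtractf[symmetric] algebra_simps)
        with i(2) show ?thesis by (simp add: t_def field_simps)
      qed
      moreover have "(\<Sum>k\<in>J. m r k x * (c(j := t)) k) = (\<Sum>k\<in>J. m r k x * c k)" for r
        using insert.hyps by (intro sum.cong) auto
      moreover have "\<exists>k\<in>insert j J. (c(j := t)) k \<noteq> 0" using c(1) insert.hyps by force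
      ultimately show ?thesis
        using insert.hyps by (intro exI[of _ "c(j := t)"]) auto
    qed
  qed
  show ?case
    unfolding *
  proof (intro zclosed_ball zclosed_disj zclosed_eq0)
    fix i assume i: "i \<in> R"
    show "zclosed I (?S J (m' i))"
      using insert.prems i
      by (intro insert.IH) (auto simp: m'_def[abs_def] intro!: ipoly_diff ipoly_mult)
  qed (use insert.prems in auto)
qed

section \<open>Common roots of univariate polynomials\<close>

lemma bezout_no_common_root:
  fixes f :: "'k \<Rightarrow> complex poly"
  assumes K: "finite K" and nr: "\<not> (\<exists>r. \<forall>k\<in>K. poly (f k) r = 0)"
  shows "\<exists>A. (\<Sum>k\<in>K. A k * f k) = 1"
proof -
  \<comment> \<open>The nonzero elements of the ideal generated by the \<open>f k\<close>. One of
    least degree divides all generators, by division with remainder.\<close>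
  define S where "S = {q. q \<noteq> 0 \<and> (\<exists>A. (\<Sum>k\<in>K. A k * f k) = q)}"
  have fS: "f k \<in> S" if "k \<in> K" "f k \<noteq> 0" for k
  proof -
    have "(\<Sum>i\<in>K. (if i = k then 1 else 0) * f i) = (\<Sum>i\<in>K. if i = k then f i else 0)"
      by (rule sum.cong) auto
    then show ?thesis unfolding S_def using that K by (auto intro!: exI[of _ "\<lambda>i. if i = k then 1 else 0"])
  qed
  from nr obtain k0 where "k0 \<in> K" "poly (f k0) 0 \<noteq> 0" by blast
  moreover from this have "f k0 \<noteq> 0" by auto
  ultimately have "S \<noteq> {}" using fS[of k0] by auto
  then obtain g where g: "g \<in> S" "\<And>q. q \<in> S \<Longrightarrow> degree g \<le> degree q"
    using arg_min_nat_lemma[of "\<lambda>q. q \<in> S" _ degree] by blast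
  then obtain A where A: "(\<Sum>k\<in>K. A k * f k) = g" and g0: "g \<noteq> 0" unfolding S_def by blast
  have dv: "g dvd f k" if k: "k \<in> K" for k
  proof (rule ccontr)
    assume nd: "\<not> g dvd f k"
    then have nz: "f k mod g \<noteq> 0" by (simp add: mod_eq_0_iff_dvd)
    have "(\<Sum>i\<in>K. ((if i = k then 1 else 0) - (f k div g) * A i) * f i)
       = (\<Sum>i\<in>K. if i = k then f i else 0) - (f k div g) * g"
      unfolding A[symmetric] sum_distrib_left sum_subtractf[symmetric]
      by (rule sum.cong) (auto simp: algebra_simps)
    also have "\<dots> = f k mod g" using k K by (simp add: minus_div_mult_eq_mod)
    finally have "\<exists>A. (\<Sum>i\<in>K. A i * f i) = f k mod g"
      by (intro exI[of _ "\<lambda>i. (if i = k then 1 else 0) - (f k div g) * A i"])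
    then have "f k mod g \<in> S" using nz unfolding S_def by simp
    then have "degree g \<le> degree (f k mod g)" by (rule g(2))
    moreover have "degree (f k mod g) < degree g"
      by (rule degree_mod_less') (use g0 nz in auto)
    ultimately show False by simp
  qed
  \<comment> \<open>A root of \<open>g\<close> would be a root of every \<open>f k\<close>.\<close>
  have "degree g = 0"
  proof (rule ccontr)
    assume "degree g \<noteq> 0"
    then have "\<not> constant (poly g)" by (simp add: constant_degree)
    then obtain r where "poly g r = 0" using fundamental_theorem_of_algebra by blast
    with dv nr show False by (metis dvd_trans poly_eq_0_iff_dvd)
  qed
  then obtain c where c: "g = [:c:]" "c \<noteq> 0" using g0 by (metis degree_eq_zeroE pCons_eq_0_iff)
  have "(\<Sum>k\<in>K. [:1/c:] * A k * f k) = [:1/c:] * g"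
    unfolding A[symmetric] by (simp only: sum_distrib_left mult.assoc)
  also have "\<dots> = 1" using c by (simp add: one_pCons)
  finally show ?thesis by (rule exI[of _ "\<lambda>k. [:1/c:] * A k"])
qed

text \<open>The functional \<open>l\<close> is evaluation at a common zero of the binary forms of degrees \<open>d k\<close>; the
  second alternative is a zero at infinity.\<close>

lemma common_zero_iff_functional:
  fixes f :: "'k \<Rightarrow> complex poly"
  assumes K: "finite K" and deg: "\<And>k. k \<in> K \<Longrightarrow> degree (f k) \<le> d k" and D: "\<And>k. k \<in> K \<Longrightarrow> d k \<le> D" "D \<ge> 1"
  shows "(\<exists>l. (\<exists>j\<in>{..<2*D}. l j \<noteq> 0) \<and>
      (\<forall>(k, e)\<in>{(k, e). k \<in> K \<and> e + d k < 2*D}. (\<Sum>j\<in>{..<2*D}. coeff (monom 1 e * f k) j * l j) = 0))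
    \<longleftrightarrow> (\<exists>r. \<forall>k\<in>K. poly (f k) r = 0) \<or> (\<forall>k\<in>K. coeff (f k) (d k) = 0)" (is "?L \<longleftrightarrow> ?R")
proof
  assume ?R
  then show ?L
  proof
    assume "\<exists>r. \<forall>k\<in>K. poly (f k) r = 0"
    then obtain r where r: "\<And>k. k \<in> K \<Longrightarrow> poly (f k) r = 0" by blast
    have "(\<Sum>j\<in>{..<2*D}. coeff (monom 1 e * f k) j * r ^ j) = 0" if "k \<in> K" "e + d k < 2*D" for k e
    proof -
      have "degree (monom 1 e * f k) \<le> e + d k"
        by (rule order.trans[OF degree_mult_le] add_mono degree_monom_le deg that)+
      then have "poly (monom 1 e * f k) r = (\<Sum>j\<in>{..<2*D}. coeff (monom 1 e * f k) j * r ^ j)"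
        unfolding poly_altdef using that(2)
        by (intro sum.mono_neutral_left) (auto simp: coeff_eq_0)
      with r[OF that(1)] show ?thesis by simp
    qed
    then show ?L
      using D by (intro exI[of _ "\<lambda>j. r ^ j"]) (auto intro!: bexI[of _ 0])
  next
    assume z: "\<forall>k\<in>K. coeff (f k) (d k) = 0"
    \<comment> \<open>A shift reaches degree \<open>2*D - 1\<close> only if
      \<open>e + d k = 2*D - 1\<close>, and then through the coefficient \<open>d k\<close> of
      \<open>f k\<close>, which is zero here. So the functional that reads off the top coefficient
      kills all shifts.\<close>
    have "coeff (monom 1 e * f k) (2*D - 1) = 0" if "k \<in> K" "e + d k < 2*D" for k e
    proof (cases "2*D - 1 - e = d k")
      case True with z that show ?thesis by (simp add: coeff_monom_mult)
    next
      case False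
      then have "2*D - 1 - e > degree (f k)" using that deg[OF that(1)] by linarith
      then show ?thesis by (simp add: coeff_monom_mult coeff_eq_0)
    qed
    then show ?L
      using D by (intro exI[of _ "\<lambda>j. if j = 2*D - 1 then 1 else 0"]) (auto simp: if_distrib cong: if_cong intro!: bexI[of _ "2*D - 1"])
  qed
next
  assume ?L
  then obtain l where l: "\<exists>j\<in>{..<2*D}. l j \<noteq> 0"
    and l0: "\<And>k e. k \<in> K \<Longrightarrow> e + d k < 2*D \<Longrightarrow> (\<Sum>j\<in>{..<2*D}. coeff (monom 1 e * f k) j * l j) = 0"
    by blast
  define L where "L q = (\<Sum>j\<in>{..<2*D}. coeff q j * l j)" for q
  have L_add: "L (p + q) = L p + L q" for p q
    by (simp add: L_def algebra_simps sum.distrib)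
  have L_sum: "L (\<Sum>k\<in>A. p k) = (\<Sum>k\<in>A. L (p k))" for A and p :: "'b \<Rightarrow> complex poly"
    by (induction A rule: infinite_finite_induct) (auto simp: L_add, auto simp: L_def)
  have L_smult: "L (smult c p) = c * L p" for c p
    by (simp add: L_def sum_distrib_left algebra_simps)
  have L_mult: "L (A * f k) = 0" if "k \<in> K" "degree A + d k < 2*D" for A k
  proof -
    have "A * f k = (\<Sum>e\<le>degree A. smult (coeff A e) (monom 1 e * f k))"
      by (subst poly_as_sum_of_monoms[of A, symmetric])
        (simp add: sum_distrib_right smult_monom flip: mult_smult_left)
    then have "L (A * f k) = (\<Sum>e\<le>degree A. coeff A e * L (monom 1 e * f k))"
      by (simp add: L_sum L_smult)
    also have "\<dots> = 0" using l0[OF that(1)] that(2) by (intro sum.neutral) (auto simp: L_def)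
    finally show ?thesis .
  qed
  show ?R
  proof (rule ccontr)
    assume nR: "\<not> ?R"
    then obtain k1 where k1: "k1 \<in> K" "coeff (f k1) (d k1) \<noteq> 0" by blast
    then have d1: "degree (f k1) = d k1" using deg[OF k1(1)] le_degree by (metis le_antisym)
    have f1: "f k1 \<noteq> 0" using k1(2) by auto
    from nR obtain A where A: "(\<Sum>k\<in>K. A k * f k) = 1" using bezout_no_common_root[OF K] by blast
    have "L q = 0" if q: "degree q < 2*D" for q
    \<comment> \<open>For a constant \<open>f k1\<close> every \<open>q\<close> is a multiple of it;
      the strict degree bound on remainders used below would fail, as no degree is below 0.\<close>
    proof (cases "d k1 = 0")
      case True
      then obtain c where c: "f k1 = [:c:]" "c \<noteq> 0" using d1 f1 by (metis degree_eq_zeroE pCons_eq_0_iff)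
      have "q = smult (1/c) q * f k1" using c by simp
      then show ?thesis using L_mult[OF k1(1), of "smult (1/c) q"] True q by (auto simp: c)
    next
      case False
      \<comment> \<open>The remainders are small enough for \<open>L\<close> to kill their products
        with \<open>f k\<close>; the quotients are collected in the single cofactor
        \<open>C\<close>.\<close>
      define B where "B k = (q * A k) mod f k1" for k
      have dB: "degree (B k) < d k1" for k
        unfolding B_def using False d1 degree_mod_less[OF f1, of "q * A k"] by auto
      define C where "C = q * A k1 + (\<Sum>k\<in>K-{k1}. (q * A k) div f k1 * f k)"
      have "q = (\<Sum>k\<in>K. q * A k * f k)" using A by (simp add: mult.assoc flip: sum_distrib_left)
      also have "\<dots> = q * A k1 * f k1 + (\<Sum>k\<in>K-{k1}. q * A k * f k)"
        using K k1 by (simp add: sum.remove)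
      also have "(\<Sum>k\<in>K-{k1}. q * A k * f k) = (\<Sum>k\<in>K-{k1}. B k * f k + ((q * A k) div f k1 * f k) * f k1)"
      proof (rule sum.cong)
        fix k
        have "q * A k = B k + (q * A k) div f k1 * f k1" unfolding B_def by (metis mod_div_mult_eq)
        then have "q * A k * f k = (B k + (q * A k) div f k1 * f k1) * f k" by simp
        then show "q * A k * f k = B k * f k + ((q * A k) div f k1 * f k) * f k1"
          by (simp only: distrib_right mult.assoc mult.commute[of "f k1"])
      qed simp
      finally have C: "q = C * f k1 + (\<Sum>k\<in>K-{k1}. B k * f k)"
        unfolding C_def distrib_right sum.distrib sum_distrib_right by (simp only: add_ac)
      have "degree (\<Sum>k\<in>K-{k1}. B k * f k) \<le> 2*D - 1"
      proof (rule degree_sum_le)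
        fix k assume k: "k \<in> K - {k1}"
        have "degree (B k * f k) \<le> degree (B k) + degree (f k)" by (rule degree_mult_le)
        then show "degree (B k * f k) \<le> 2*D - 1" using dB[of k] deg[of k] D(1)[of k] D(1)[OF k1(1)] k by auto
      qed (use K in auto)
      moreover have "C * f k1 = q - (\<Sum>k\<in>K-{k1}. B k * f k)" using C by (metis add_diff_cancel_right')
      ultimately have dC: "degree (C * f k1) \<le> 2*D - 1" using q by (auto intro: degree_diff_le)
      \<comment> \<open>Since \<open>f k1\<close> has degree exactly \<open>d k1\<close>, the degree
        of the product bounds that of \<open>C\<close>, and \<open>L\<close> kills
        \<open>C * f k1\<close> too.\<close>
      have "C = 0 \<or> degree C + d k1 < 2*D"
        using dC degree_mult_eq[of C "f k1"] f1 d1 D(2) by fastforce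
      then have "L (C * f k1) = 0" using L_mult[OF k1(1), of C] by (auto simp: L_def)
      moreover have "L (B k * f k) = 0" if "k \<in> K - {k1}" for k
        using that dB[of k] D(1)[of k] D(1)[OF k1(1)] by (intro L_mult) auto
      ultimately show ?thesis by (subst C) (simp add: L_add L_sum)
    qed
    then have "L (monom 1 j) = 0" if "j < 2*D" for j using that by (simp add: degree_monom_eq)
    moreover have "L (monom 1 j) = l j" if "j < 2*D" for j
      using that by (simp add: L_def if_distrib if_distribR cong: if_cong)
    ultimately show False using l by auto
  qed
qed

section \<open>Projective elimination\<close>

lemma zclosed_homogeneous_system:
  assumes P: "zclosed I P" and inv: "\<And>c x. c \<noteq> 0 \<Longrightarrow> P x \<Longrightarrow> P (\<lambda>i. c ^ w i * x i)"
  shows "\<exists>Fs. finite Fs \<and> (\<forall>(d, F)\<in>Fs. gpoly I w d F) \<and> (\<forall>x. P x \<longleftrightarrow> (\<forall>(d, F)\<in>Fs. F x = 0))"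
proof -
  obtain Gs where Gs: "finite Gs" "\<forall>G\<in>Gs. ipoly I G" "\<forall>x. P x \<longleftrightarrow> (\<forall>G\<in>Gs. G x = 0)"
    using P unfolding zclosed_def by metis
  have "\<forall>G\<in>Gs. \<exists>N f. (\<forall>e. gpoly I w e (\<lambda>x. coeff (f x) e)) \<and> (\<forall>x. degree (f x) \<le> N \<and> G x = poly (f x) 1)"
    using Gs(2) ipoly_components by blast
  then obtain N f where Nf: "\<And>G e. G \<in> Gs \<Longrightarrow> gpoly I w e (\<lambda>x. coeff (f G x) e)"
    "\<And>G x. G \<in> Gs \<Longrightarrow> degree (f G x) \<le> N G" "\<And>G x. G \<in> Gs \<Longrightarrow> G x = poly (f G x) 1" by metis
  define Fs where "Fs = (\<Union>G\<in>Gs. (\<lambda>e. (e, \<lambda>x. coeff (f G x) e)) ` {..N G})"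
  have "P x \<longleftrightarrow> (\<forall>(d, F)\<in>Fs. F x = 0)" for x
  proof
    assume "P x"
    have "f G x = 0" if G: "G \<in> Gs" for G
    proof -
      have sc: "poly (f G x) c = 0" if "c \<noteq> 0" for c
      proof -
        \<comment> \<open>Scaling the point with the weights is scaling the auxiliary variable by
          \<open>c\<close>. Invariance of \<open>P\<close> thus makes every nonzero \<open>c\<close>
          a root of \<open>f G x\<close>, which is then the zero polynomial.\<close>
        have "f G (\<lambda>i. c ^ w i * x i) = pcompose (f G x) [:0, c:]"
        proof (rule poly_eqI)
          fix e
          show "coeff (f G (\<lambda>i. c ^ w i * x i)) e = coeff (f G x \<circ>\<^sub>p [:0, c:]) e"
            using gpoly_scale[OF Nf(1)[OF G, of e], of c x] by (simp add: coeff_pcompose_linear)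
        qed
        moreover have "G (\<lambda>i. c ^ w i * x i) = 0" using inv[OF that \<open>P x\<close>] Gs(3) G by blast
        ultimately show ?thesis using Nf(3)[OF G] by (simp add: poly_pcompose)
      qed
      show ?thesis
      proof (rule ccontr)
        assume "f G x \<noteq> 0"
        then have "finite {c. poly (f G x) c = 0}" by (rule poly_roots_finite)
        then have "finite (UNIV - {0::complex})" by (rule rev_finite_subset) (use sc in auto)
        then show False by (simp add: infinite_UNIV_char_0)
      qed
    qed
    then show "\<forall>(d, F)\<in>Fs. F x = 0" unfolding Fs_def by auto
  next
    assume a: "\<forall>(d, F)\<in>Fs. F x = 0"
    have "G x = 0" if G: "G \<in> Gs" for G
    proof -
      have "coeff (f G x) e = 0" if "e \<le> N G" for e using a G that unfolding Fs_def by auto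
      then have "f G x = 0" using Nf(2)[OF G, of x] by (metis leading_coeff_0_iff)
      then show ?thesis using Nf(3)[OF G] by simp
    qed
    then show "P x" using Gs(3) by blast
  qed
  moreover have "finite Fs" "\<forall>(d, F)\<in>Fs. gpoly I w d F" unfolding Fs_def using Gs(1) Nf(1) by auto
  ultimately show ?thesis by blast
qed

text \<open>The main theorem of elimination theory, with \<open>X\<close> as homogeneous
  coordinates. The induction works because the condition \<open>Q\<close> left after eliminating
  \<open>v\<close> is again invariant under scaling of the remaining coordinates.\<close>

theorem zclosed_projective_elimination:
  assumes "finite X" "zclosed I P"
    and "\<And>c x. c \<noteq> 0 \<Longrightarrow> P x \<Longrightarrow> P (\<lambda>i. if i \<in> X then c * x i else x i)"
  shows "zclosed (I - X) (\<lambda>x. \<exists>y. (\<forall>i. i \<notin> X \<longrightarrow> y i = x i) \<and> (\<exists>i\<in>X. y i \<noteq> 0) \<and> P y)"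
  using assms
proof (induction X arbitrary: I P rule: finite_induct)
  case empty
  then show ?case by (simp add: zclosed_False)
next
  case (insert v X)
  note P = insert.prems(1) and inv = insert.prems(2)
  \<comment> \<open>Up to scaling, the only point whose coordinates in \<open>X\<close> all vanish;
    eliminating \<open>v\<close> over the affine line would lose it.\<close>
  define pt where "pt x = (\<lambda>i. if i = v then 1 else if i \<in> X then 0 else x i)" for x :: "'a \<Rightarrow> complex"
  have pt_if: "P (pt x)" if y: "\<forall>i. i \<notin> insert v X \<longrightarrow> y i = x i" "\<forall>i\<in>X. y i = 0" "y v \<noteq> 0" "P y" for x y
  proof -
    have "P (\<lambda>i. if i \<in> insert v X then (1 / y v) * y i else y i)" using y(3,4) by (intro inv) auto
    moreover have "(\<lambda>i. if i \<in> insert v X then (1 / y v) * y i else y i) = pt x"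
      using y insert.hyps by (auto simp: pt_def fun_eq_iff)
    ultimately show ?thesis by simp
  qed
  show ?case
  \<comment> \<open>With \<open>v\<close> as the only coordinate, scaling makes it 1 and elimination
    is substitution. The general step would fail here: for empty \<open>X\<close> the induction
    hypothesis speaks of no point at all.\<close>
  proof (cases "X = {}")
    case True
    obtain Gs where Gs: "finite Gs" "\<forall>G\<in>Gs. ipoly I G" "\<forall>x. P x \<longleftrightarrow> (\<forall>G\<in>Gs. G x = 0)"
      using P unfolding zclosed_def by metis
    have pt: "pt x = x(v := of_int 1)" for x using True by (auto simp: pt_def fun_eq_iff)
    have "zclosed (I - {v}) (\<lambda>x. P (pt x))"
      unfolding pt by (rule zclosedI[of "(\<lambda>G x. G (x(v := of_int 1))) ` Gs"])
        (use Gs in \<open>auto simp del: of_int_1 intro: ipoly_subst\<close>)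
    moreover have "(\<exists>y. (\<forall>i. i \<notin> insert v X \<longrightarrow> y i = x i) \<and> (\<exists>i\<in>insert v X. y i \<noteq> 0) \<and> P y) \<longleftrightarrow> P (pt x)" for x
    proof
      assume "P (pt x)"
      then show "\<exists>y. (\<forall>i. i \<notin> insert v X \<longrightarrow> y i = x i) \<and> (\<exists>i\<in>insert v X. y i \<noteq> 0) \<and> P y"
        by (intro exI[of _ "pt x"]) (auto simp: pt_def)
    next
      assume "\<exists>y. (\<forall>i. i \<notin> insert v X \<longrightarrow> y i = x i) \<and> (\<exists>i\<in>insert v X. y i \<noteq> 0) \<and> P y"
      then show "P (pt x)" using pt_if True by blast
    qed
    ultimately show ?thesis using True by simp
  next
    case False
    \<comment> \<open>Only the eliminated coordinates carry weight, so degrees count these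
      alone.\<close>
    define w where "w i = (if i \<in> insert v X then 1 else 0 :: nat)" for i
    have "P (\<lambda>i. c ^ w i * x i)" if "c \<noteq> 0" "P x" for c x
    proof -
      have "(\<lambda>i. c ^ w i * x i) = (\<lambda>i. if i \<in> insert v X then c * x i else x i)" by (auto simp: w_def)
      with inv[OF that] show ?thesis by simp
    qed
    from zclosed_homogeneous_system[OF P, of w, OF this] obtain Fs where Fs: "finite Fs"
      "\<And>d F. (d, F) \<in> Fs \<Longrightarrow> gpoly I w d F" "\<And>x. P x \<longleftrightarrow> (\<forall>(d, F)\<in>Fs. F x = 0)" by blast
    have "\<forall>p\<in>Fs. \<exists>f. (\<forall>k\<le>fst p. gpoly (I - {v}) w (fst p - k) (\<lambda>x. coeff (f x) k)) \<and>
        (\<forall>x. degree (f x) \<le> fst p \<and> snd p x = poly (f x) (x v))"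
    proof
      fix p assume "p \<in> Fs"
      then have "gpoly I w (fst p) (snd p)" using Fs(2) by (cases p) auto
      from gpoly_expand_var[OF this, of v]
      show "\<exists>f. (\<forall>k\<le>fst p. gpoly (I - {v}) w (fst p - k) (\<lambda>x. coeff (f x) k)) \<and>
        (\<forall>x. degree (f x) \<le> fst p \<and> snd p x = poly (f x) (x v))" by (simp add: w_def)
    qed
    then obtain f where f: "\<And>p k. p \<in> Fs \<Longrightarrow> k \<le> fst p \<Longrightarrow> gpoly (I - {v}) w (fst p - k) (\<lambda>x. coeff (f p x) k)"
      "\<And>p x. p \<in> Fs \<Longrightarrow> degree (f p x) \<le> fst p" "\<And>p x. p \<in> Fs \<Longrightarrow> snd p x = poly (f p x) (x v)" by metis
    \<comment> \<open>A common bound for the degrees that is at least 1 even when all of them are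
      0.\<close>
    define D where "D = Suc (\<Sum>p\<in>Fs. fst p)"
    have D: "fst p \<le> D" if "p \<in> Fs" for p
      using member_le_sum[of p Fs fst] that Fs(1) by (simp add: D_def)
    define Q where "Q x \<longleftrightarrow> (\<exists>l. (\<exists>j\<in>{..<2*D}. l j \<noteq> 0) \<and>
      (\<forall>r\<in>{(p, e). p \<in> Fs \<and> e + fst p < 2*D}. (\<Sum>j\<in>{..<2*D}. coeff (monom 1 (snd r) * f (fst r) x) j * l j) = 0))" for x
    have zQ: "zclosed (I - {v}) Q"
      unfolding Q_def
    proof (rule zclosed_linear_system)
      show "finite {(p, e). p \<in> Fs \<and> e + fst p < 2*D}"
        by (rule finite_subset[of _ "Fs \<times> {..<2*D}"]) (use Fs(1) in auto)
      fix r j assume r: "r \<in> {(p, e). p \<in> Fs \<and> e + fst p < 2*D}"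
      show "ipoly (I - {v}) (\<lambda>x. coeff (monom 1 (snd r) * f (fst r) x) j)"
      proof (cases "snd r \<le> j \<and> j - snd r \<le> fst (fst r)")
        case True
        with r f(1)[of "fst r" "j - snd r"] show ?thesis
          by (auto simp: coeff_monom_mult intro: gpoly_imp_ipoly)
      next
        case False
        then have "coeff (monom 1 (snd r) * f (fst r) x) j = 0" for x
          using r f(2)[of "fst r" x] by (auto simp: coeff_monom_mult intro!: coeff_eq_0)
        then show ?thesis by (simp add: gpoly_zero)
      qed
    qed simp
    \<comment> \<open>The coefficients lie over \<open>I - {v}\<close>, so the univariate polynomial
      does not change with the coordinate \<open>v\<close>.\<close>
    have fv: "f p (x(v := t)) = f p x" if "p \<in> Fs" for p x t
    proof (rule poly_eqI)
      fix k
      show "coeff (f p (x(v := t))) k = coeff (f p x) k"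
      proof (cases "k \<le> fst p")
        case True
        show ?thesis by (rule gpoly_cong[OF f(1)[OF that True]]) auto
      next
        case False
        then have "coeff (f p z) k = 0" for z using f(2)[OF that, of z] by (intro coeff_eq_0) auto
        then show ?thesis by simp
      qed
    qed
    have root: "(\<forall>p\<in>Fs. poly (f p x) r = 0) \<longleftrightarrow> P (x(v := r))" for x r
    proof -
      have "P (x(v := r)) \<longleftrightarrow> (\<forall>p\<in>Fs. snd p (x(v := r)) = 0)" using Fs(3) by (auto simp: case_prod_beta)
      also have "\<dots> \<longleftrightarrow> (\<forall>p\<in>Fs. poly (f p x) r = 0)" using f(3) fv by auto
      finally show ?thesis by simp
    qed
    have lead: "(\<forall>p\<in>Fs. coeff (f p x) (fst p) = 0) \<longleftrightarrow> P (pt x)" for x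
    proof -
      have "snd p (pt x) = coeff (f p x) (fst p)" if p: "p \<in> Fs" for p
      proof -
        \<comment> \<open>As \<open>0 ^ 0 = 1\<close>, exactly the eliminated coordinates become 0.
          The coefficient of the \<open>k\<close>-th power of \<open>v\<close> has degree
          \<open>fst p - k\<close> in them, so only the top one survives, with its value at
          \<open>x\<close> unchanged.\<close>
        define x0 where "x0 = (\<lambda>i. 0 ^ w i * x i)"
        have "f p x0 = monom (coeff (f p x) (fst p)) (fst p)"
        proof (rule poly_eqI)
          fix k
          show "coeff (f p x0) k = coeff (monom (coeff (f p x) (fst p)) (fst p)) k"
          proof (cases "k \<le> fst p")
            case True
            then show ?thesis using gpoly_scale[OF f(1)[OF p True], of 0 x] by (auto simp: x0_def)
          next
            case False
            then have "coeff (f p x0) k = 0" using f(2)[OF p, of x0] by (intro coeff_eq_0) auto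
            then show ?thesis using False by simp
          qed
        qed
        moreover have "pt x = x0(v := 1)" by (auto simp: pt_def x0_def w_def fun_eq_iff)
        ultimately show ?thesis using f(3)[OF p, of "pt x"] fv[OF p, of x0 1] by (simp add: poly_monom)
      qed
      then show ?thesis using Fs(3)[of "pt x"] by (auto simp: case_prod_beta)
    qed
    have Q: "Q x \<longleftrightarrow> (\<exists>r. P (x(v := r))) \<or> P (pt x)" for x
      using common_zero_iff_functional[OF Fs(1), of "\<lambda>p. f p x" fst D] f(2) D
      by (simp add: Q_def root lead case_prod_beta D_def)
    have invQ: "Q (\<lambda>i. if i \<in> X then c * x i else x i)" if c: "c \<noteq> 0" and "Q x" for c x
    proof -
      let ?x = "\<lambda>i. if i \<in> X then c * x i else x i"
      from \<open>Q x\<close> show ?thesis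
        unfolding Q
      proof (elim disjE exE)
        fix r assume "P (x(v := r))"
        \<comment> \<open>Scaling the coordinates in \<open>X\<close> moves the root
          \<open>r\<close> to \<open>c * r\<close>.\<close>
        from inv[OF c this] have "P (?x(v := c * r))"
          by (rule back_subst[of P]) (use insert.hyps in \<open>auto simp: fun_eq_iff\<close>)
        then show "(\<exists>r. P (?x(v := r))) \<or> P (pt ?x)" by blast
      next
        assume "P (pt x)"
        also have "pt x = pt ?x" by (auto simp: pt_def)
        finally show "(\<exists>r. P (?x(v := r))) \<or> P (pt ?x)" by blast
      qed
    qed
    have "(\<exists>y. (\<forall>i. i \<notin> insert v X \<longrightarrow> y i = x i) \<and> (\<exists>i\<in>insert v X. y i \<noteq> 0) \<and> P y) \<longleftrightarrow>
      (\<exists>y. (\<forall>i. i \<notin> X \<longrightarrow> y i = x i) \<and> (\<exists>i\<in>X. y i \<noteq> 0) \<and> Q y)" (is "?A \<longleftrightarrow> ?B") for x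
    proof
      assume ?A
      then obtain y where y: "\<forall>i. i \<notin> insert v X \<longrightarrow> y i = x i" "\<exists>i\<in>insert v X. y i \<noteq> 0" "P y" by blast
      show ?B
      proof (cases "\<forall>i\<in>X. y i = 0")
        case True
        with y have "P (pt x)" by (intro pt_if[of y x]) auto
        \<comment> \<open>\<open>pt\<close> ignores the coordinates in \<open>X\<close>, so these
          may be made nonzero; the value 1 is an arbitrary choice.\<close>
        also have "pt x = pt (\<lambda>i. if i \<in> X then 1 else x i)" by (auto simp: pt_def)
        finally show ?thesis using False unfolding Q
          by (intro exI[of _ "\<lambda>i. if i \<in> X then 1 else x i"]) auto
      next
        case nz: False
        have "Q (y(v := x v))" unfolding Q using y(3) by (intro disjI1 exI[of _ "y v"]) simp
        then show ?thesis using nz y insert.hyps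
          by (intro exI[of _ "y(v := x v)"]) auto
      qed
    next
      assume ?B
      then obtain y where y: "\<forall>i. i \<notin> X \<longrightarrow> y i = x i" "\<exists>i\<in>X. y i \<noteq> 0" "Q y" by blast
      from \<open>Q y\<close>[unfolded Q] show ?A
      proof (elim disjE exE)
        fix r assume "P (y(v := r))"
        then show ?A using y insert.hyps by (intro exI[of _ "y(v := r)"]) auto
      next
        assume "P (pt y)"
        then show ?A using y by (intro exI[of _ "pt y"]) (auto simp: pt_def)
      qed
    qed
    moreover have "I - insert v X = I - {v} - X" by auto
    ultimately show ?thesis using insert.IH[OF zQ invQ] by simp
  qed
qed

section \<open>Evaluation and differentiation of polynomials\<close>

definition monom_val :: "'v expo \<Rightarrow> ('v \<Rightarrow> 'a::comm_semiring_1) \<Rightarrow> 'a" where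
  "monom_val a x = (\<Prod>v\<in>Poly_Mapping.keys a. x v ^ Poly_Mapping.lookup a v)"

lemma monom_val_superset:
  assumes "finite K" "Poly_Mapping.keys a \<subseteq> K"
  shows "monom_val a x = (\<Prod>v\<in>K. x v ^ Poly_Mapping.lookup a v)"
  unfolding monom_val_def using assms
  by (intro prod.mono_neutral_left) (auto simp: in_keys_iff)

lemma monom_val_UNIV: "monom_val a x = (\<Prod>v\<in>UNIV. x v ^ Poly_Mapping.lookup a v)" for a :: "'v::finite expo"
  by (rule monom_val_superset) auto

lemma monom_val_0 [simp]: "monom_val 0 x = 1"
  by (simp add: monom_val_def)

lemma monom_val_single [simp]: "monom_val (Poly_Mapping.single v k) x = x v ^ k"
  by (subst monom_val_superset[of "{v}"]) (auto split: if_splits)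

lemma monom_val_add: "monom_val (a + b) x = monom_val a x * monom_val b x"
proof -
  let ?K = "Poly_Mapping.keys a \<union> Poly_Mapping.keys b"
  have "Poly_Mapping.keys (a + b) \<subseteq> ?K" by (rule keys_add)
  then show ?thesis
    by (simp add: monom_val_superset[of ?K] lookup_add power_add prod.distrib)
qed

lemma mpol_eval_alt: "mpol_eval p x = (\<Sum>a\<in>Poly_Mapping.keys p. Poly_Mapping.lookup p a * monom_val a x)"
  by (simp add: mpol_eval_def monom_val_def)

lemma mpol_eval_superset:
  assumes "finite K" "Poly_Mapping.keys p \<subseteq> K"
  shows "mpol_eval p x = (\<Sum>a\<in>K. Poly_Mapping.lookup p a * monom_val a x)"
  unfolding mpol_eval_alt using assms
  by (intro sum.mono_neutral_left) (auto simp: in_keys_iff)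

lemma mpol_eval_0 [simp]: "mpol_eval 0 x = 0"
  by (simp add: mpol_eval_def)

lemma mpol_eval_single [simp]: "mpol_eval (Poly_Mapping.single a c) x = c * monom_val a x"
  by (subst mpol_eval_superset[of "{a}"]) (auto split: if_splits)

lemma mpol_eval_const [simp]: "mpol_eval (mpol_const c) x = c"
  by (simp add: mpol_const_def)

lemma mpol_eval_add: "mpol_eval (p + q) x = mpol_eval p x + mpol_eval q x"
proof -
  let ?K = "Poly_Mapping.keys p \<union> Poly_Mapping.keys q"
  have "Poly_Mapping.keys (p + q) \<subseteq> ?K" by (rule keys_add)
  then show ?thesis
    by (simp add: mpol_eval_superset[of ?K] lookup_add sum.distrib algebra_simps)
qed

lemma mpol_eval_diff: "mpol_eval (p - q) x = mpol_eval p x - mpol_eval q (x :: _ \<Rightarrow> 'a::comm_ring_1)"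
  using mpol_eval_add[of "p - q" q x] by simp

lemma mpol_eval_sum: "mpol_eval (\<Sum>i\<in>A. f i) x = (\<Sum>i\<in>A. mpol_eval (f i) x)"
  by (induction A rule: infinite_finite_induct) (auto simp: mpol_eval_add)

lemma mpol_eval_sum_list: "mpol_eval (\<Sum>i\<leftarrow>as. f i) x = (\<Sum>i\<leftarrow>as. mpol_eval (f i) x)"
  by (induction as) (auto simp: mpol_eval_add)

lemma sum_single_lookup: "(\<Sum>a\<in>Poly_Mapping.keys p. Poly_Mapping.single a (Poly_Mapping.lookup p a)) = p"
  by (rule poly_mapping_eqI) (auto simp: lookup_sum lookup_single when_def in_keys_iff)

lemma mult_as_sum: "p * q = (\<Sum>a\<in>Poly_Mapping.keys p. \<Sum>b\<in>Poly_Mapping.keys q.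
    Poly_Mapping.single (a + b) (Poly_Mapping.lookup p a * Poly_Mapping.lookup q b))"
  for p q :: "('v, 'a::comm_semiring_1) mpol"
proof -
  have "p * q = (\<Sum>a\<in>Poly_Mapping.keys p. Poly_Mapping.single a (Poly_Mapping.lookup p a)) *
      (\<Sum>b\<in>Poly_Mapping.keys q. Poly_Mapping.single b (Poly_Mapping.lookup q b))"
    by (simp only: sum_single_lookup)
  then show ?thesis by (simp only: sum_product mult_single)
qed

lemma mpol_eval_mult: "mpol_eval (p * q) x = mpol_eval p x * mpol_eval q x"
  unfolding mult_as_sum mpol_eval_sum mpol_eval_single monom_val_add
  by (simp add: mpol_eval_alt sum_product algebra_simps)

lemma lookup_const_mult: "Poly_Mapping.lookup (mpol_const c * p) a = c * Poly_Mapping.lookup p a"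
  unfolding mpol_const_def mult_map_scale_conv_mult[symmetric]
  by (simp add: Poly_Mapping.map.rep_eq when_def)

lemma single_plus_diff: "0 < Poly_Mapping.lookup a v \<Longrightarrow> a - Poly_Mapping.single v 1 + Poly_Mapping.single v (1::nat) = a"
  by (rule poly_mapping_eqI) (auto simp: lookup_add lookup_minus lookup_single when_def)

text \<open>Truncated subtraction can send further exponents to \<open>b\<close>, but those do not
  contain \<open>v\<close> and carry the factor 0. The formula reduces linearity and the symmetry of
  mixed derivatives to comparing coefficients.\<close>

lemma lookup_mpol_diff:
  "Poly_Mapping.lookup (mpol_diff v p) b = of_nat (Poly_Mapping.lookup b v + 1) * Poly_Mapping.lookup p (b + Poly_Mapping.single v 1)"
proof -
  let ?c = "b + Poly_Mapping.single v 1"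
  have c: "?c - Poly_Mapping.single v 1 = b" by simp
  have "Poly_Mapping.lookup (mpol_diff v p) b =
      (\<Sum>a\<in>Poly_Mapping.keys p. (of_nat (Poly_Mapping.lookup a v) * Poly_Mapping.lookup p a when a - Poly_Mapping.single v 1 = b))"
    by (simp add: mpol_diff_def lookup_sum lookup_single)
  also have "\<dots> = (\<Sum>a\<in>Poly_Mapping.keys p. if a = ?c then of_nat (Poly_Mapping.lookup b v + 1) * Poly_Mapping.lookup p ?c else 0)"
  proof (rule sum.cong)
    fix a
    show "(of_nat (Poly_Mapping.lookup a v) * Poly_Mapping.lookup p a when a - Poly_Mapping.single v 1 = b)
      = (if a = ?c then of_nat (Poly_Mapping.lookup b v + 1) * Poly_Mapping.lookup p ?c else 0)"
    proof (cases "a = ?c")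
      case True
      then show ?thesis using c by (simp add: lookup_add)
    next
      case False
      then have "a - Poly_Mapping.single v 1 = b \<Longrightarrow> Poly_Mapping.lookup a v = 0"
        using single_plus_diff[of a v] by auto
      with False show ?thesis by (auto simp: when_def)
    qed
  qed simp
  also have "\<dots> = of_nat (Poly_Mapping.lookup b v + 1) * Poly_Mapping.lookup p ?c"
    by (auto simp: in_keys_iff)
  finally show ?thesis .
qed

lemma mpol_diff_add: "mpol_diff v (p + q) = mpol_diff v p + mpol_diff v q"
  by (rule poly_mapping_eqI) (simp add: lookup_mpol_diff lookup_add algebra_simps)

lemma mpol_diff_0 [simp]: "mpol_diff v 0 = 0"
  by (simp add: mpol_diff_def)

lemma mpol_diff_diff: "mpol_diff v (p - q) = mpol_diff v p - mpol_diff v (q :: (_, 'a::comm_ring_1) mpol)"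
  using mpol_diff_add[of v "p - q" q] by simp

lemma mpol_diff_sum: "mpol_diff v (\<Sum>i\<in>A. f i) = (\<Sum>i\<in>A. mpol_diff v (f i))"
  by (induction A rule: infinite_finite_induct) (auto simp: mpol_diff_add)

lemma mpol_diff_const_mult: "mpol_diff v (mpol_const c * p) = mpol_const c * mpol_diff v p"
  by (rule poly_mapping_eqI) (simp only: lookup_mpol_diff lookup_const_mult mult.left_commute)

lemma mpol_diff_single: "mpol_diff v (Poly_Mapping.single a c) =
    Poly_Mapping.single (a - Poly_Mapping.single v 1) (of_nat (Poly_Mapping.lookup a v) * c)"
  by (cases "c = 0") (auto simp: mpol_diff_def)

lemma keys_mpol_diff: "b \<in> Poly_Mapping.keys (mpol_diff v p) \<Longrightarrow> b + Poly_Mapping.single v 1 \<in> Poly_Mapping.keys p"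
  by (auto simp: in_keys_iff lookup_mpol_diff)

lemma mpol_eval_mpol_diff: "mpol_eval (mpol_diff v p) x =
   (\<Sum>a\<in>Poly_Mapping.keys p. Poly_Mapping.lookup p a * (of_nat (Poly_Mapping.lookup a v) * monom_val (a - Poly_Mapping.single v 1) x))"
  unfolding mpol_diff_def mpol_eval_sum by (simp add: algebra_simps)

lemma monom_val_diff_single:
  fixes a :: "'v::finite expo"
  shows "monom_val (a - Poly_Mapping.single v 1) x =
    x v ^ (Poly_Mapping.lookup a v - 1) * (\<Prod>w\<in>UNIV - {v}. x w ^ Poly_Mapping.lookup a w)"
  unfolding monom_val_UNIV
  by (subst prod.remove[of _ v]) (auto simp: lookup_minus lookup_single when_def intro!: prod.cong)

text \<open>Ties the formal partial derivatives to the Frechet derivative, on which the analytic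
  arguments rest.\<close>

lemma has_derivative_mpol_eval:
  fixes p :: "('n::finite, real) mpol"
  shows "((\<lambda>u::real^'n. mpol_eval p (($) u)) has_derivative (\<lambda>h. mpol_gradient p u \<bullet> h)) (at u)"
proof -
  have mono: "((\<lambda>u::real^'n. monom_val a (($) u)) has_derivative
     (\<lambda>h. \<Sum>i\<in>UNIV. (of_nat (Poly_Mapping.lookup a i) * monom_val (a - Poly_Mapping.single i 1) (($) u)) * h $ i)) (at u)" for a
    unfolding monom_val_UNIV[of a]
  proof (rule has_derivative_eq_rhs[OF has_derivative_prod])
    fix i :: 'n
    show "((\<lambda>u::real^'n. u $ i ^ Poly_Mapping.lookup a i) has_derivative
        (\<lambda>h. of_nat (Poly_Mapping.lookup a i) * h $ i * u $ i ^ (Poly_Mapping.lookup a i - 1))) (at u)"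
      by (auto intro!: derivative_eq_intros bounded_linear_imp_has_derivative[OF bounded_linear_vec_nth])
  qed (unfold monom_val_diff_single, simp add: algebra_simps)
  have "((\<lambda>u::real^'n. mpol_eval p (($) u)) has_derivative
     (\<lambda>h. \<Sum>a\<in>Poly_Mapping.keys p. Poly_Mapping.lookup p a *
       (\<Sum>i\<in>UNIV. (of_nat (Poly_Mapping.lookup a i) * monom_val (a - Poly_Mapping.single i 1) (($) u)) * h $ i))) (at u)"
    unfolding mpol_eval_alt by (intro has_derivative_sum has_derivative_mult_right mono)
  moreover have "(\<lambda>h. \<Sum>a\<in>Poly_Mapping.keys p. Poly_Mapping.lookup p a *
       (\<Sum>i\<in>UNIV. (of_nat (Poly_Mapping.lookup a i) * monom_val (a - Poly_Mapping.single i 1) (($) u)) * h $ i))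
     = (\<lambda>h. mpol_gradient p u \<bullet> h)"
  proof
    fix h
    have "mpol_gradient p u \<bullet> h = (\<Sum>i\<in>UNIV. \<Sum>a\<in>Poly_Mapping.keys p. Poly_Mapping.lookup p a *
       ((of_nat (Poly_Mapping.lookup a i) * monom_val (a - Poly_Mapping.single i 1) (($) u)) * h $ i))"
      by (simp add: inner_vec_def mpol_gradient_def mpol_eval_mpol_diff sum_distrib_right mult.assoc)
    then show "(\<Sum>a\<in>Poly_Mapping.keys p. Poly_Mapping.lookup p a *
       (\<Sum>i\<in>UNIV. (of_nat (Poly_Mapping.lookup a i) * monom_val (a - Poly_Mapping.single i 1) (($) u)) * h $ i))
       = mpol_gradient p u \<bullet> h"
      by (subst (asm) sum.swap) (simp add: sum_distrib_left)
  qed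
  ultimately show ?thesis by simp
qed

section \<open>Degrees, homogenization and Euler's identity\<close>

lemma expo_deg_UNIV: "expo_deg a = (\<Sum>v\<in>UNIV. Poly_Mapping.lookup a v)" for a :: "'v::finite expo"
  unfolding expo_deg_def by (rule sum.mono_neutral_left) (auto simp: in_keys_iff)

lemma expo_deg_add: "expo_deg (a + b) = expo_deg a + expo_deg b" for a b :: "'v::finite expo"
  by (simp add: expo_deg_UNIV lookup_add sum.distrib)

lemma expo_deg_single [simp]: "expo_deg (Poly_Mapping.single v k) = k" for v :: "'v::finite"
  by (simp add: expo_deg_UNIV lookup_single when_def)

lemma finite_expo_deg_le: "finite {a :: 'n::finite expo. expo_deg a \<le> d}"
proof -
  have "Poly_Mapping.lookup ` {a :: 'n expo. expo_deg a \<le> d} \<subseteq> (UNIV :: 'n set) \<rightarrow>\<^sub>E {..d}"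
  proof clarify
    fix a :: "'n expo" assume a: "expo_deg a \<le> d"
    have "Poly_Mapping.lookup a i \<le> d" for i
      using member_le_sum[of i UNIV "Poly_Mapping.lookup a"] a by (simp add: expo_deg_UNIV)
    then show "Poly_Mapping.lookup a \<in> UNIV \<rightarrow>\<^sub>E {..d}" by auto
  qed
  then have "finite (Poly_Mapping.lookup ` {a :: 'n expo. expo_deg a \<le> d})"
    by (rule finite_subset) (rule finite_PiE; simp)
  then show ?thesis by (rule finite_imageD) (simp add: inj_on_def lookup_inject)
qed

lemma lookup_homog_expo [simp]:
  "Poly_Mapping.lookup (homog_expo d a) None = d - expo_deg a"
  "Poly_Mapping.lookup (homog_expo d a) (Some i) = Poly_Mapping.lookup a i"
  by (simp_all add: homog_expo_def lookup_add lookup_sum lookup_single when_def)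

lemma UNIV_option_sum: "(\<Sum>v\<in>UNIV. f v) = f None + (\<Sum>i\<in>UNIV. f (Some i))" for f :: "'n::finite option \<Rightarrow> 'a::comm_monoid_add"
  by (simp add: UNIV_option_conv sum.reindex)

lemma expo_deg_homog_expo: "expo_deg a \<le> d \<Longrightarrow> expo_deg (homog_expo d a) = d"
  by (simp add: expo_deg_UNIV[of "homog_expo d a"] UNIV_option_sum flip: expo_deg_UNIV)

lemma homogenize_superset:
  assumes "finite K" "Poly_Mapping.keys p \<subseteq> K"
  shows "homogenize d p = (\<Sum>a\<in>K. Poly_Mapping.single (homog_expo d a) (complex_of_real (Poly_Mapping.lookup p a)))"
  unfolding homogenize_def using assms
  by (intro sum.mono_neutral_left) (auto simp: in_keys_iff)

lemma homogenize_0 [simp]: "homogenize d 0 = 0"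
  by (simp add: homogenize_def)

lemma homogenize_add: "homogenize d (p + q) = homogenize d p + homogenize d q"
proof -
  let ?K = "Poly_Mapping.keys p \<union> Poly_Mapping.keys q"
  have "Poly_Mapping.keys (p + q) \<subseteq> ?K" by (rule keys_add)
  then show ?thesis
    by (simp add: homogenize_superset[of ?K] lookup_add sum.distrib single_add)
qed

lemma homogenize_sum: "homogenize d (\<Sum>i\<in>A. f i) = (\<Sum>i\<in>A. homogenize d (f i))"
  by (induction A rule: infinite_finite_induct) (auto simp: homogenize_add)

lemma homogenize_single: "homogenize d (Poly_Mapping.single a c) = Poly_Mapping.single (homog_expo d a) (complex_of_real c)"
  by (subst homogenize_superset[of "{a}"]) (auto split: if_splits)

text \<open>If \<open>a\<close> contains the variable, its degree is positive, and the exponent of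
  x_0 is the same computed from \<open>d\<close> and \<open>a\<close> or from both lowered by one,
  also under truncated subtraction. All other terms have coefficient 0.\<close>

lemma mpol_diff_homogenize: "mpol_diff (Some i) (homogenize d p) = homogenize (d - 1) (mpol_diff i p)"
proof -
  have "Poly_Mapping.single (homog_expo d a - Poly_Mapping.single (Some i) 1) (of_nat (Poly_Mapping.lookup a i) * complex_of_real c)
    = Poly_Mapping.single (homog_expo (d - 1) (a - Poly_Mapping.single i 1)) (complex_of_real (of_nat (Poly_Mapping.lookup a i) * c))" for a c
  proof (cases "Poly_Mapping.lookup a i = 0")
    case False
    then have a: "a - Poly_Mapping.single i 1 + Poly_Mapping.single i 1 = a" by (intro single_plus_diff) simp
    have "expo_deg a = expo_deg (a - Poly_Mapping.single i 1) + 1"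
      by (subst a[symmetric]) (simp add: expo_deg_add)
    then have "homog_expo d a - Poly_Mapping.single (Some i) 1 = homog_expo (d - 1) (a - Poly_Mapping.single i 1)"
      by (intro poly_mapping_eqI, rename_tac v, case_tac v) (auto simp: lookup_minus lookup_single when_def)
    then show ?thesis by simp
  qed simp
  then show ?thesis
    unfolding homogenize_def[of d p] mpol_diff_def[of i p]
    by (simp add: mpol_diff_sum homogenize_sum mpol_diff_single homogenize_single)
qed

lemma monom_val_homog_expo:
  assumes "z None = 1" "\<And>i. z (Some i) = complex_of_real (x i)"
  shows "monom_val (homog_expo d a) z = complex_of_real (monom_val a x)"
proof -
  have "monom_val (homog_expo d a) z = (\<Prod>v\<in>range Some. z v ^ Poly_Mapping.lookup (homog_expo d a) v)"
    unfolding monom_val_UNIV by (simp add: UNIV_option_conv assms)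
  also have "\<dots> = complex_of_real (monom_val a x)"
    by (simp add: prod.reindex assms monom_val_UNIV)
  finally show ?thesis .
qed

lemma mpol_eval_homogenize:
  assumes "z None = 1" "\<And>i. z (Some i) = complex_of_real (x i)"
  shows "mpol_eval (homogenize d p) z = complex_of_real (mpol_eval p x)"
  by (simp add: homogenize_def mpol_eval_sum monom_val_homog_expo[OF assms] mpol_eval_alt[of p])

text \<open>What \<open>k\<close> differentiations make of a form of degree \<open>d\<close>. The
  additive condition avoids a truncated \<open>d - k\<close> and leaves only the zero polynomial
  when \<open>k > d\<close>.\<close>

definition shifted_form :: "nat \<Rightarrow> nat \<Rightarrow> ('v, 'a::zero) mpol \<Rightarrow> bool" where
  "shifted_form d k p \<longleftrightarrow> (\<forall>a\<in>Poly_Mapping.keys p. expo_deg a + k = d)"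

lemma shifted_form_diff: "shifted_form d k p \<Longrightarrow> shifted_form d (Suc k) (mpol_diff v p)"
  for p :: "('v::finite, 'a::comm_semiring_1) mpol"
  using keys_mpol_diff[of _ v p] unfolding shifted_form_def by (fastforce simp: expo_deg_add)

lemma shifted_form_eval:
  fixes p :: "('v::finite, 'a::comm_semiring_1) mpol"
  assumes "shifted_form d k p"
  shows "c ^ k * mpol_eval p (\<lambda>v. c * z v) = c ^ d * mpol_eval p z"
proof -
  have "monom_val a (\<lambda>v. c * z v) = c ^ expo_deg a * monom_val a z" for a :: "'v expo"
    by (simp add: monom_val_UNIV power_mult_distrib prod.distrib expo_deg_UNIV power_sum)
  then have "c ^ k * (Poly_Mapping.lookup p a * monom_val a (\<lambda>v. c * z v)) = c ^ d * (Poly_Mapping.lookup p a * monom_val a z)"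
    if "a \<in> Poly_Mapping.keys p" for a
    using assms that unfolding shifted_form_def by (auto simp: power_add algebra_simps)
  then show ?thesis unfolding mpol_eval_alt sum_distrib_left by (rule sum.cong[OF refl])
qed

text \<open>Monomial by monomial: \<open>z v\<close> times the derivative in \<open>v\<close>
  multiplies a monomial by its exponent of \<open>v\<close>, and the exponents add up to
  \<open>d\<close>.\<close>

lemma euler_homogeneous:
  fixes p :: "('v::finite, 'a::comm_semiring_1) mpol"
  assumes "shifted_form d 0 p"
  shows "(\<Sum>v\<in>UNIV. z v * mpol_eval (mpol_diff v p) z) = of_nat d * mpol_eval p z"
proof -
  have *: "z v * (of_nat (Poly_Mapping.lookup a v) * monom_val (a - Poly_Mapping.single v 1) z) =
      of_nat (Poly_Mapping.lookup a v) * monom_val a z" for a v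
  proof (cases "Poly_Mapping.lookup a v = 0")
    case False
    then have "monom_val a z = monom_val (a - Poly_Mapping.single v 1 + Poly_Mapping.single v 1) z"
      by (subst single_plus_diff) simp_all
    then have "monom_val a z = monom_val (a - Poly_Mapping.single v 1) z * z v"
      by (simp only: monom_val_add monom_val_single power_one_right)
    then show ?thesis by (simp add: algebra_simps)
  qed simp
  have "(\<Sum>v\<in>UNIV. z v * mpol_eval (mpol_diff v p) z) =
     (\<Sum>v\<in>UNIV. \<Sum>a\<in>Poly_Mapping.keys p. Poly_Mapping.lookup p a * (of_nat (Poly_Mapping.lookup a v) * monom_val a z))"
    unfolding mpol_eval_mpol_diff sum_distrib_left by (intro sum.cong refl, subst mult.left_commute, simp only: *)
  also have "\<dots> = (\<Sum>a\<in>Poly_Mapping.keys p. Poly_Mapping.lookup p a * (of_nat (expo_deg a) * monom_val a z))"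
    by (subst sum.swap) (simp add: sum_distrib_left[symmetric] sum_distrib_right[symmetric] expo_deg_UNIV)
  also have "\<dots> = (\<Sum>a\<in>Poly_Mapping.keys p. Poly_Mapping.lookup p a * (of_nat d * monom_val a z))"
    using assms unfolding shifted_form_def by (intro sum.cong) auto
  finally show ?thesis by (simp add: mpol_eval_alt sum_distrib_left mult.left_commute)
qed

section \<open>Generic forms\<close>

text \<open>Rank deficiency as nontrivial solvability of a linear system, the form accepted by
  \<open>zclosed_linear_system\<close>. The columns are an indexed family, so a repeated column
  counts as a dependency.\<close>

definition dependent_columns :: "('r \<Rightarrow> nat \<Rightarrow> complex) \<Rightarrow> nat \<Rightarrow> bool" where
  "dependent_columns M m \<longleftrightarrow> (\<exists>c. (\<exists>j\<in>{..<m}. c j \<noteq> 0) \<and> (\<forall>r\<in>UNIV. (\<Sum>j\<in>{..<m}. M r j * c j) = 0))"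

text \<open>Column factors are divided out of the dependency; row factors merely multiply its
  equations and may be arbitrary.\<close>

lemma dependent_columns_scale:
  assumes "dependent_columns M m" "\<And>r j. j < m \<Longrightarrow> M' r j = \<rho> r * k j * M r j" "\<And>j. j < m \<Longrightarrow> k j \<noteq> 0"
  shows "dependent_columns M' m"
proof -
  obtain c where c: "\<exists>j\<in>{..<m}. c j \<noteq> 0" "\<And>r. (\<Sum>j\<in>{..<m}. M r j * c j) = 0"
    using assms(1) unfolding dependent_columns_def by blast
  have "(\<Sum>j\<in>{..<m}. M' r j * (c j / k j)) = \<rho> r * (\<Sum>j\<in>{..<m}. M r j * c j)" for r
    unfolding sum_distrib_left using assms(2,3) by (intro sum.cong) auto
  then show ?thesis
    using c assms(3) unfolding dependent_columns_def by (intro exI[of _ "\<lambda>j. c j / k j"]) auto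
qed

lemma zclosed_dependent_columns:
  fixes M :: "('i \<Rightarrow> complex) \<Rightarrow> 'r::finite \<Rightarrow> nat \<Rightarrow> complex"
  assumes "\<And>r j. j < m \<Longrightarrow> ipoly I (\<lambda>x. M x r j)"
  shows "zclosed I (\<lambda>x. dependent_columns (M x) m)"
  unfolding dependent_columns_def using assms by (intro zclosed_linear_system) auto

text \<open>The rank refers to the set of columns, a dependency to positions in the list. A repeated
  column makes both sides true; for distinct columns the indexing bijection translates one into the
  other.\<close>

lemma columns_rank_less_iff: "columns_rank cs < length cs \<longleftrightarrow> dependent_columns (\<lambda>r j. cs ! j $ r) (length cs)"
proof
  assume "dependent_columns (\<lambda>r j. cs ! j $ r) (length cs)"
  then obtain c where c: "\<exists>j<length cs. c j \<noteq> 0" "\<And>r. (\<Sum>j<length cs. cs ! j $ r * c j) = 0"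
    unfolding dependent_columns_def by blast
  show "columns_rank cs < length cs"
  proof (cases "distinct cs")
    case False
    then show ?thesis
      unfolding columns_rank_def using vec.dim_le_card'[of "set cs"] card_length[of cs] card_distinct[of cs]
      by fastforce
  next
    case True
    have "vec.dim (set cs) < card (set cs)"
    proof (rule ccontr)
      assume "\<not> vec.dim (set cs) < card (set cs)"
      then have ind: "vec.independent (set cs)"
        by (intro vec.card_le_dim_spanning[of "set cs" "set cs"]) (auto intro: vec.span_base)
      define u where "u v = (\<Sum>j<length cs. if cs ! j = v then c j else 0)" for v
      have u: "u (cs ! j) = c j" if "j < length cs" for j
      proof -
        have "u (cs ! j) = (\<Sum>i<length cs. if i = j then c i else 0)"
          unfolding u_def using that True by (intro sum.cong) (auto simp: nth_eq_iff_index_eq)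
        then show ?thesis using that by simp
      qed
      have bij: "bij_betw ((!) cs) {..<length cs} (set cs)" by (rule bij_betw_nth[OF True]) auto
      have "(\<Sum>v\<in>set cs. u v *s v) = (\<Sum>j<length cs. u (cs ! j) *s cs ! j)"
        by (rule sum.reindex_bij_betw[OF bij, symmetric])
      also have "\<dots> = 0"
        using c(2) by (simp add: vec_eq_iff u mult.commute)
      finally have "\<forall>v\<in>set cs. u v = 0"
        using vec.independentD[OF ind, of "set cs" u] by auto
      with c(1) u show False by auto
    qed
    then show ?thesis unfolding columns_rank_def using distinct_card[OF True] by simp
  qed
next
  assume less: "columns_rank cs < length cs"
  show "dependent_columns (\<lambda>r j. cs ! j $ r) (length cs)"
  proof (cases "distinct cs")
    case False
    then obtain i j where ij: "i < length cs" "j < length cs" "i \<noteq> j" "cs ! i = cs ! j"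
      unfolding distinct_conv_nth by blast
    define c where "c = (\<lambda>k. (if k = i then 1 else 0) - (if k = j then 1 else 0 :: complex))"
    have "(\<Sum>k<length cs. cs ! k $ r * c k) =
        (\<Sum>k<length cs. (if k = i then cs ! k $ r else 0) - (if k = j then cs ! k $ r else 0))" for r
      by (intro sum.cong) (auto simp: c_def)
    then have "(\<Sum>k<length cs. cs ! k $ r * c k) = 0" for r
      using ij by (simp add: sum_subtractf)
    then show ?thesis
      unfolding dependent_columns_def using ij by (intro exI[of _ c]) (auto simp: c_def)
  next
    case True
    have "vec.dependent (set cs)"
      using less vec.dim_eq_card_independent[of "set cs"] distinct_card[OF True] unfolding columns_rank_def by auto
    then obtain u where u: "\<exists>v\<in>set cs. u v \<noteq> 0" "(\<Sum>v\<in>set cs. u v *s v) = 0"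
      using vec.dependent_finite[of "set cs"] by auto
    have bij: "bij_betw ((!) cs) {..<length cs} (set cs)" by (rule bij_betw_nth[OF True]) auto
    have "(\<Sum>j<length cs. u (cs ! j) *s cs ! j) = 0"
      using u(2) sum.reindex_bij_betw[OF bij, of "\<lambda>v. u v *s v"] by simp
    then have "(\<Sum>j<length cs. cs ! j $ r * u (cs ! j)) = 0" for r
      by (simp add: vec_eq_iff mult.commute)
    then show ?thesis
      unfolding dependent_columns_def using u(1) by (intro exI[of _ "\<lambda>j. u (cs ! j)"]) (auto simp: in_set_conv_nth)
  qed
qed

text \<open>The common finite support makes evaluation one sum over an index set independent of
  \<open>x\<close>, hence a polynomial function.\<close>

definition poly_family :: "'i set \<Rightarrow> (('i \<Rightarrow> complex) \<Rightarrow> ('v, complex) mpol) \<Rightarrow> bool" where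
  "poly_family I Q \<longleftrightarrow> (\<exists>K. finite K \<and> (\<forall>x. Poly_Mapping.keys (Q x) \<subseteq> K)) \<and>
     (\<forall>b. ipoly I (\<lambda>x. Poly_Mapping.lookup (Q x) b))"

lemma poly_family_diff: assumes "poly_family I Q" shows "poly_family I (\<lambda>x. mpol_diff v (Q x))"
proof -
  obtain K where K: "finite K" "\<And>x. Poly_Mapping.keys (Q x) \<subseteq> K"
    using assms unfolding poly_family_def by blast
  have "Poly_Mapping.keys (mpol_diff v (Q x)) \<subseteq> (\<lambda>a. a - Poly_Mapping.single v 1) ` K" for x
    using K(2)[of x] keys_mpol_diff[of _ v "Q x"] by force
  moreover have "ipoly I (\<lambda>x. Poly_Mapping.lookup (mpol_diff v (Q x)) b)" for b
  proof -
    have "ipoly I (\<lambda>x. of_int (int (Poly_Mapping.lookup b v + 1)) * Poly_Mapping.lookup (Q x) (b + Poly_Mapping.single v 1))"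
      using assms unfolding poly_family_def by (intro ipoly_mult ipoly_const) auto
    then show ?thesis by (simp only: lookup_mpol_diff of_int_of_nat_eq)
  qed
  ultimately show ?thesis using K(1) unfolding poly_family_def by blast
qed

lemma poly_family_eval:
  assumes "poly_family I Q" "\<And>v. e v \<in> I"
  shows "ipoly I (\<lambda>x. mpol_eval (Q x) (\<lambda>v. x (e v)))"
proof -
  obtain K where K: "finite K" "\<And>x. Poly_Mapping.keys (Q x) \<subseteq> K"
    using assms(1) unfolding poly_family_def by blast
  have "ipoly I (\<lambda>x. Poly_Mapping.lookup (Q x) b)" for b
    using assms(1) unfolding poly_family_def by blast
  then have "ipoly I (\<lambda>x. \<Sum>a\<in>K. Poly_Mapping.lookup (Q x) a * (\<Prod>v\<in>Poly_Mapping.keys a. x (e v) ^ Poly_Mapping.lookup a v))"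
    by (intro gpoly_sum[OF K(1)] ipoly_mult ipoly_prod[OF finite_keys] ipoly_power ipoly_var assms(2))
  then show ?thesis by (simp only: mpol_eval_superset[OF K(1) K(2)] monom_val_def)
qed

text \<open>\<open>Par (s, a)\<close> stands for the coefficient of \<open>a\<close> in slot \<open>s\<close>, while \<open>Zv\<close> and \<open>Yv\<close> stand for the
  coordinates of the points that are eliminated.\<close>

datatype ('p, 'z, 'y) elim_var = Par 'p | Zv 'z | Yv 'y

type_synonym 'n evar = "(slot \<times> 'n expo, 'n option, 'n) elim_var"

text \<open>The generic form of formal degree \<open>dg s\<close>: a homogenized input whose
  coefficients are independent complex variables.\<close>

definition gform :: "(slot \<Rightarrow> nat) \<Rightarrow> slot \<Rightarrow> ('n::finite evar \<Rightarrow> complex) \<Rightarrow> ('n option, complex) mpol" where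
  "gform dg s x = (\<Sum>a\<in>{a. expo_deg a \<le> dg s}. Poly_Mapping.single (homog_expo (dg s) a) (x (Par (s, a))))"

lemma lookup_gform: "Poly_Mapping.lookup (gform dg s x) b =
    (\<Sum>a\<in>{a. expo_deg a \<le> dg s}. if homog_expo (dg s) a = b then x (Par (s, a)) else 0)"
  by (simp add: gform_def lookup_sum lookup_single when_def)

lemma keys_gform: "Poly_Mapping.keys (gform dg s x) \<subseteq> homog_expo (dg s) ` {a. expo_deg a \<le> dg s}"
proof
  fix b assume "b \<in> Poly_Mapping.keys (gform dg s x)"
  then have "(\<Sum>a\<in>{a. expo_deg a \<le> dg s}. if homog_expo (dg s) a = b then x (Par (s, a)) else 0) \<noteq> 0"
    by (simp add: in_keys_iff lookup_gform)
  then obtain a where "expo_deg a \<le> dg s" "homog_expo (dg s) a = b"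
    by (auto elim!: sum.not_neutral_contains_not_neutral split: if_splits)
  then show "b \<in> homog_expo (dg s) ` {a. expo_deg a \<le> dg s}" by auto
qed

lemma poly_family_gform:
  assumes "\<And>a. expo_deg a \<le> dg s \<Longrightarrow> Par (s, a) \<in> I"
  shows "poly_family I (gform dg s)"
  unfolding poly_family_def
proof (intro conjI exI[of _ "homog_expo (dg s) ` {a. expo_deg a \<le> dg s}"] allI)
  fix b
  have "ipoly I (\<lambda>x. if homog_expo (dg s) a = b then x (Par (s, a)) else 0)" if "expo_deg a \<le> dg s" for a
    using assms[OF that] by (cases "homog_expo (dg s) a = b") (auto intro: ipoly_var gpoly_zero)
  then show "ipoly I (\<lambda>x. Poly_Mapping.lookup (gform dg s x) b)"
    unfolding lookup_gform by (intro gpoly_sum finite_expo_deg_le) auto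
qed (rule keys_gform finite_imageI finite_expo_deg_le)+

lemma shifted_form_gform: "shifted_form (dg s) 0 (gform dg s x)"
  using keys_gform[of dg s x] unfolding shifted_form_def by (auto simp: expo_deg_homog_expo)

definition form_val :: "(slot \<Rightarrow> nat) \<Rightarrow> ('n::finite evar \<Rightarrow> complex) \<Rightarrow> slot \<Rightarrow> complex" where
  "form_val dg x s = mpol_eval (gform dg s x) (\<lambda>i. x (Zv i))"

definition form_grad :: "(slot \<Rightarrow> nat) \<Rightarrow> ('n::finite evar \<Rightarrow> complex) \<Rightarrow> slot \<Rightarrow> 'n option \<Rightarrow> complex" where
  "form_grad dg x s v = mpol_eval (mpol_diff v (gform dg s x)) (\<lambda>i. x (Zv i))"

definition form_hess :: "(slot \<Rightarrow> nat) \<Rightarrow> ('n::finite evar \<Rightarrow> complex) \<Rightarrow> slot \<Rightarrow> 'n \<Rightarrow> complex" where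
  "form_hess dg x s i = (\<Sum>j\<in>UNIV. mpol_eval (mpol_diff (Some i) (mpol_diff (Some j) (gform dg s x))) (\<lambda>i. x (Zv i)) * x (Yv j))"

definition pars :: "(slot \<Rightarrow> nat) \<Rightarrow> slot list \<Rightarrow> (slot \<times> 'n::finite expo) set" where
  "pars dg ss = {(s, a). s \<in> set ss \<and> expo_deg a \<le> dg s}"

lemma ipoly_form_val: "s \<in> set ss \<Longrightarrow> Par ` pars dg ss \<union> range Zv \<subseteq> I \<Longrightarrow> ipoly I (\<lambda>x. form_val dg x s)"
  unfolding form_val_def pars_def by (intro poly_family_eval poly_family_gform) auto

lemma ipoly_form_grad: "s \<in> set ss \<Longrightarrow> Par ` pars dg ss \<union> range Zv \<subseteq> I \<Longrightarrow> ipoly I (\<lambda>x. form_grad dg x s v)"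
  unfolding form_grad_def pars_def by (intro poly_family_eval poly_family_diff poly_family_gform) auto

lemma ipoly_form_hess: "s \<in> set ss \<Longrightarrow> Par ` pars dg ss \<union> range Zv \<union> range Yv \<subseteq> I \<Longrightarrow> ipoly I (\<lambda>x. form_hess dg x s v)"
  unfolding form_hess_def pars_def
  by (intro gpoly_sum ipoly_mult poly_family_eval poly_family_diff poly_family_gform ipoly_var) auto

section \<open>The four conditions on generic forms at given points\<close>

definition Res_x where "Res_x dg ss x \<longleftrightarrow> (\<forall>s\<in>set ss. form_val dg x s = 0)"

definition Disc_x where
  "Disc_x dg ss x \<longleftrightarrow> Res_x dg ss x \<and> dependent_columns (\<lambda>r j. form_grad dg x (ss ! j) r) (length ss)"

definition R_x where
  "R_x dg s0 ss t x \<longleftrightarrow> Res_x dg ss x \<and> form_val dg x t = 0 \<and> dependent_columns (\<lambda>r j. form_grad dg x ((s0 # ss) ! j) (Some r)) (Suc (length ss))"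

text \<open>Entries of the matrix whose columns \<open>D_columns\<close> lists: indices up to
  \<open>length ss\<close> run over the objective and the constraints, later ones over the
  constraints again, with zero upper block.\<close>

definition D_matrix :: "(slot \<Rightarrow> nat) \<Rightarrow> slot \<Rightarrow> slot list \<Rightarrow> ('n::finite evar \<Rightarrow> complex) \<Rightarrow> 'n + 'n \<Rightarrow> nat \<Rightarrow> complex" where
  "D_matrix dg s0 ss x r j = (if j \<le> length ss
     then (case r of Inl a \<Rightarrow> form_grad dg x ((s0 # ss) ! j) (Some a) | Inr b \<Rightarrow> form_hess dg x ((s0 # ss) ! j) b)
     else (case r of Inl a \<Rightarrow> 0 | Inr b \<Rightarrow> form_grad dg x (ss ! (j - Suc (length ss))) (Some b)))"

definition D_x where
  "D_x dg s0 ss x \<longleftrightarrow> (\<forall>s\<in>set ss. form_val dg x s = 0 \<and> (\<Sum>i\<in>UNIV. form_grad dg x s (Some i) * x (Yv i)) = 0) \<and>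
     dependent_columns (D_matrix dg s0 ss x) (Suc (2 * length ss))"

lemma zclosed_Res_x: "Par ` pars dg ss \<union> range Zv \<subseteq> I \<Longrightarrow> set us \<subseteq> set ss \<Longrightarrow> zclosed I (Res_x dg us)"
  unfolding Res_x_def[abs_def] by (intro zclosed_ball zclosed_eq0 ipoly_form_val[of _ ss]) auto

lemma zclosed_Disc_x: "Par ` pars dg ss \<union> range Zv \<subseteq> I \<Longrightarrow> zclosed I (Disc_x dg ss)"
  unfolding Disc_x_def[abs_def]
  by (rule zclosed_conj[OF zclosed_Res_x[of dg ss] zclosed_dependent_columns[OF ipoly_form_grad[of _ ss]]]) auto

lemma zclosed_R_x:
  assumes "Par ` pars dg (s0 # ss @ [t]) \<union> range Zv \<subseteq> I" shows "zclosed I (R_x dg s0 ss t)"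
proof -
  have "(s0 # ss) ! j \<in> set (s0 # ss)" if "j < Suc (length ss)" for j
    using that by (intro nth_mem) simp
  then show ?thesis
    unfolding R_x_def[abs_def] using assms
    by (intro zclosed_conj[OF zclosed_Res_x[of dg "s0 # ss @ [t]"] zclosed_conj[OF zclosed_eq0 zclosed_dependent_columns]]
        ipoly_form_grad[of _ "s0 # ss @ [t]"] ipoly_form_val[of _ "s0 # ss @ [t]"]) auto
qed

lemma zclosed_D_x:
  assumes "Par ` pars dg (s0 # ss) \<union> range Zv \<union> range Yv \<subseteq> I" shows "zclosed I (D_x dg s0 ss)"
proof -
  have "ipoly I (\<lambda>x. D_matrix dg s0 ss x r j)" if "j < Suc (2 * length ss)" for r j
  proof (cases "j \<le> length ss")
    case True
    then have "(s0 # ss) ! j \<in> set (s0 # ss)" by (intro nth_mem) simp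
    with True assms show ?thesis unfolding D_matrix_def
      by (cases r) (auto intro!: ipoly_form_grad[of _ "s0 # ss"] ipoly_form_hess[of _ "s0 # ss"])
  next
    case False
    then have "ss ! (j - Suc (length ss)) \<in> set (s0 # ss)" using that by auto
    with False assms show ?thesis unfolding D_matrix_def
      by (cases r) (auto intro!: ipoly_form_grad[of _ "s0 # ss"] gpoly_zero)
  qed
  then have "zclosed I (\<lambda>x. dependent_columns (D_matrix dg s0 ss x) (Suc (2 * length ss)))"
    by (rule zclosed_dependent_columns)
  moreover have "zclosed I (\<lambda>x. form_val dg x s = 0)" if "s \<in> set ss" for s
    using assms that by (intro zclosed_eq0 ipoly_form_val[of _ "s0 # ss"]) auto
  moreover have "zclosed I (\<lambda>x. (\<Sum>i\<in>UNIV. form_grad dg x s (Some i) * x (Yv i)) = 0)" if "s \<in> set ss" for s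
    using assms that by (intro zclosed_eq0 gpoly_sum ipoly_mult ipoly_form_grad[of _ "s0 # ss"] ipoly_var) auto
  ultimately show ?thesis
    unfolding D_x_def[abs_def] by (intro zclosed_conj zclosed_ball) auto
qed

section \<open>Invariance of the conditions under rescaling\<close>

lemma Res_x_scale:
  assumes "Res_x dg ss x" "\<And>s. s \<in> set ss \<Longrightarrow> form_val dg x' s = \<kappa> s * form_val dg x s"
  shows "Res_x dg ss x'"
  using assms unfolding Res_x_def by auto

text \<open>Serves two purposes, as do its analogues: scaling the point, for projective elimination,
  and scaling one input, for homogeneity in each slot. Either way the whole gradient of a slot takes
  one nonzero factor.\<close>

lemma Disc_x_scale:
  assumes "Disc_x dg ss x" "\<And>s. s \<in> set ss \<Longrightarrow> form_val dg x' s = \<kappa> s * form_val dg x s"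
    and "\<And>s v. s \<in> set ss \<Longrightarrow> form_grad dg x' s v = \<mu> s * form_grad dg x s v" "\<And>s. s \<in> set ss \<Longrightarrow> \<mu> s \<noteq> 0"
  shows "Disc_x dg ss x'"
proof -
  have "dependent_columns (\<lambda>r j. form_grad dg x' (ss ! j) r) (length ss)"
    by (rule dependent_columns_scale[where \<rho> = "\<lambda>_. 1" and k = "\<lambda>j. \<mu> (ss ! j)" and M = "\<lambda>r j. form_grad dg x (ss ! j) r"])
      (use assms in \<open>auto simp: Disc_x_def\<close>)
  then show ?thesis using assms(1) Res_x_scale[OF _ assms(2)] unfolding Disc_x_def by blast
qed

lemma R_x_scale:
  assumes "R_x dg s0 ss t x" "\<And>s. s \<in> set (s0 # ss @ [t]) \<Longrightarrow> form_val dg x' s = \<kappa> s * form_val dg x s"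
    and "\<And>s v. s \<in> set (s0 # ss @ [t]) \<Longrightarrow> form_grad dg x' s v = \<mu> s * form_grad dg x s v" "\<And>s. s \<in> set (s0 # ss @ [t]) \<Longrightarrow> \<mu> s \<noteq> 0"
  shows "R_x dg s0 ss t x'"
proof -
  have mem: "(s0 # ss) ! j \<in> set (s0 # ss @ [t])" if "j < Suc (length ss)" for j
    using that nth_mem[of j "s0 # ss"] by auto
  have "dependent_columns (\<lambda>r j. form_grad dg x' ((s0 # ss) ! j) (Some r)) (Suc (length ss))"
  proof (rule dependent_columns_scale[where \<rho> = "\<lambda>_. 1" and k = "\<lambda>j. \<mu> ((s0 # ss) ! j)"])
    show "dependent_columns (\<lambda>r j. form_grad dg x ((s0 # ss) ! j) (Some r)) (Suc (length ss))"
      using assms(1) by (simp add: R_x_def)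
  next
    fix r j assume "j < Suc (length ss)"
    from assms(3)[OF mem[OF this]] show "form_grad dg x' ((s0 # ss) ! j) (Some r) = 1 * \<mu> ((s0 # ss) ! j) * form_grad dg x ((s0 # ss) ! j) (Some r)" by simp
  qed (rule assms(4)[OF mem])
  moreover have "Res_x dg ss x'"
  proof (rule Res_x_scale)
    show "Res_x dg ss x" using assms(1) by (simp add: R_x_def)
    show "form_val dg x' s = \<kappa> s * form_val dg x s" if "s \<in> set ss" for s using that by (intro assms(2)) simp
  qed
  moreover have "form_val dg x' t = 0" using assms(1) assms(2)[of t] by (simp add: R_x_def)
  ultimately show ?thesis unfolding R_x_def by blast
qed

text \<open>Hessian entries pick up an extra factor \<tau> over gradients. It is absorbed by scaling
  the lower block of rows with \<tau> and the pure gradient columns with its inverse.\<close>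

lemma D_x_scale:
  assumes "D_x dg s0 ss x" "\<And>s. s \<in> set (s0 # ss) \<Longrightarrow> form_val dg x' s = \<kappa> s * form_val dg x s"
    and form_grad: "\<And>s v. s \<in> set (s0 # ss) \<Longrightarrow> form_grad dg x' s v = \<mu> s * form_grad dg x s v" and \<mu>: "\<And>s. s \<in> set (s0 # ss) \<Longrightarrow> \<mu> s \<noteq> 0"
    and form_hess: "\<And>s v. s \<in> set (s0 # ss) \<Longrightarrow> form_hess dg x' s v = \<tau> * \<mu> s * form_hess dg x s v" and "\<tau> \<noteq> 0"
    and Y: "\<And>i. x' (Yv i) = \<sigma> * x (Yv i)"
  shows "D_x dg s0 ss x'"
proof -
  have mem: "(s0 # ss) ! j \<in> set (s0 # ss)" if "j < Suc (length ss)" for j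
    using that nth_mem[of j "s0 # ss"] by auto
  have mem': "ss ! (j - Suc (length ss)) \<in> set (s0 # ss)" if "\<not> j \<le> length ss" "j < Suc (2 * length ss)" for j
    using that by auto
  have "dependent_columns (D_matrix dg s0 ss x') (Suc (2 * length ss))"
  proof (rule dependent_columns_scale[where \<rho> = "\<lambda>r. case r of Inl _ \<Rightarrow> 1 | Inr _ \<Rightarrow> \<tau>" and M = "D_matrix dg s0 ss x" and
        k = "\<lambda>j. if j \<le> length ss then \<mu> ((s0 # ss) ! j) else \<mu> (ss ! (j - Suc (length ss))) / \<tau>"])
    show "dependent_columns (D_matrix dg s0 ss x) (Suc (2 * length ss))" using assms(1) by (simp add: D_x_def)
  next
    fix r :: "'a + 'a" and j assume j: "j < Suc (2 * length ss)"
    show "D_matrix dg s0 ss x' r j = (case r of Inl _ \<Rightarrow> 1 | Inr _ \<Rightarrow> \<tau>) *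
        (if j \<le> length ss then \<mu> ((s0 # ss) ! j) else \<mu> (ss ! (j - Suc (length ss))) / \<tau>) * D_matrix dg s0 ss x r j"
    proof (cases "j \<le> length ss")
      case True
      with form_grad[OF mem, of j] form_hess[OF mem, of j] show ?thesis by (cases r) (simp_all add: D_matrix_def)
    next
      case False
      with form_grad[OF mem'[OF False j]] \<open>\<tau> \<noteq> 0\<close> show ?thesis by (cases r) (simp_all add: D_matrix_def)
    qed
  next
    fix j assume j: "j < Suc (2 * length ss)"
    show "(if j \<le> length ss then \<mu> ((s0 # ss) ! j) else \<mu> (ss ! (j - Suc (length ss))) / \<tau>) \<noteq> 0"
      using \<mu>[OF mem, of j] \<mu>[OF mem'[OF _ j]] \<open>\<tau> \<noteq> 0\<close> by simp
  qed
  moreover have "(\<Sum>i\<in>UNIV. form_grad dg x' s (Some i) * x' (Yv i)) = 0" if "s \<in> set ss" for s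
  proof -
    have "(\<Sum>i\<in>UNIV. form_grad dg x' s (Some i) * x' (Yv i)) = \<mu> s * \<sigma> * (\<Sum>i\<in>UNIV. form_grad dg x s (Some i) * x (Yv i))"
      using that form_grad Y by (simp add: sum_distrib_left algebra_simps)
    then show ?thesis using assms(1) that unfolding D_x_def by simp
  qed
  moreover have "form_val dg x' s = 0" if "s \<in> set ss" for s
    using assms(1) assms(2)[of s] that by (simp add: D_x_def)
  ultimately show ?thesis unfolding D_x_def by blast
qed

section \<open>From polynomial functions to coefficient polynomials\<close>

definition slot_deg :: "slot \<Rightarrow> (slot \<times> 'n::finite expo) expo \<Rightarrow> nat" where
  "slot_deg s m = (\<Sum>v\<in>{v \<in> Poly_Mapping.keys m. fst v = s}. Poly_Mapping.lookup m v)"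

definition slot_component :: "slot \<Rightarrow> nat \<Rightarrow> 'n::finite coeff_poly \<Rightarrow> 'n coeff_poly" where
  "slot_component s e \<phi> = (\<Sum>m\<in>{m \<in> Poly_Mapping.keys \<phi>. slot_deg s m = e}. Poly_Mapping.single m (Poly_Mapping.lookup \<phi> m))"

lemma lookup_slot_component:
  "Poly_Mapping.lookup (slot_component s e \<phi>) m = (if slot_deg s m = e then Poly_Mapping.lookup \<phi> m else 0)"
  by (auto simp: slot_component_def lookup_sum lookup_single when_def in_keys_iff)

lemma keys_slot_component:
  "Poly_Mapping.keys (slot_component s e \<phi>) = {m \<in> Poly_Mapping.keys \<phi>. slot_deg s m = e}"
  by (auto simp: in_keys_iff lookup_slot_component split: if_splits)

lemma homogeneous_slot_component:
  "homogeneous_in_slot s (slot_component s e \<phi>)"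
  "homogeneous_in_slot s' \<phi> \<Longrightarrow> homogeneous_in_slot s' (slot_component s e \<phi>)"
  unfolding homogeneous_in_slot_def keys_slot_component by (auto simp: slot_deg_def)

lemma monom_val_scale_slot:
  "monom_val m (\<lambda>v. if fst v = s then t * y v else y v) = t ^ slot_deg s m * monom_val m y"
proof -
  have "monom_val m (\<lambda>v. if fst v = s then t * y v else y v)
      = (\<Prod>v\<in>Poly_Mapping.keys m. (if fst v = s then t ^ Poly_Mapping.lookup m v else 1) * y v ^ Poly_Mapping.lookup m v)"
    unfolding monom_val_def by (intro prod.cong) (auto simp: power_mult_distrib)
  also have "\<dots> = (\<Prod>v\<in>Poly_Mapping.keys m. (if fst v = s then t ^ Poly_Mapping.lookup m v else 1)) * monom_val m y"
    by (simp add: prod.distrib monom_val_def)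
  also have "(\<Prod>v\<in>Poly_Mapping.keys m. (if fst v = s then t ^ Poly_Mapping.lookup m v else 1)) = t ^ slot_deg s m"
    unfolding slot_deg_def power_sum by (rule prod.inter_filter[symmetric]) simp
  finally show ?thesis .
qed

definition scale_slot :: "slot \<Rightarrow> real \<Rightarrow> (slot \<Rightarrow> ('n, real) mpol) \<Rightarrow> slot \<Rightarrow> ('n, real) mpol" where
  "scale_slot s t p = p(s := mpol_const t * p s)"

lemma lookup_scale_slot: "Poly_Mapping.lookup (scale_slot s t p s') a = (if s' = s then t else 1) * Poly_Mapping.lookup (p s') a"
  by (simp add: scale_slot_def lookup_const_mult)

lemma coeff_eval_scale_slot:
  "coeff_eval \<phi> (scale_slot s t p) = (\<Sum>e\<in>slot_deg s ` Poly_Mapping.keys \<phi>. t ^ e * coeff_eval (slot_component s e \<phi>) p)"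
proof -
  let ?y = "\<lambda>(s, a). Poly_Mapping.lookup (p s) a"
  have "(\<lambda>(s', a). Poly_Mapping.lookup (scale_slot s t p s') a) = (\<lambda>v. if fst v = s then t * ?y v else ?y v)"
    by (auto simp: lookup_scale_slot)
  then have "coeff_eval \<phi> (scale_slot s t p) =
      (\<Sum>m\<in>Poly_Mapping.keys \<phi>. Poly_Mapping.lookup \<phi> m * (t ^ slot_deg s m * monom_val m ?y))"
    by (simp only: coeff_eval_def mpol_eval_alt monom_val_scale_slot)
  also have "\<dots> = (\<Sum>e\<in>slot_deg s ` Poly_Mapping.keys \<phi>. \<Sum>m\<in>{m \<in> Poly_Mapping.keys \<phi>. slot_deg s m = e}.
      Poly_Mapping.lookup \<phi> m * (t ^ slot_deg s m * monom_val m ?y))"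
    by (rule sum.image_gen) simp
  also have "\<dots> = (\<Sum>e\<in>slot_deg s ` Poly_Mapping.keys \<phi>. t ^ e * coeff_eval (slot_component s e \<phi>) p)"
    unfolding coeff_eval_def mpol_eval_alt keys_slot_component sum_distrib_left
    by (intro sum.cong) (auto simp: lookup_slot_component)
  finally show ?thesis .
qed

text \<open>In \<open>t\<close>, the value at the scaled input is a polynomial whose coefficients
  are the values of the components; having infinitely many roots, it is zero.\<close>

lemma coeff_eval_components_eq_0:
  assumes "\<And>t. t \<noteq> 0 \<Longrightarrow> coeff_eval \<phi> (scale_slot s t p) = 0"
  shows "coeff_eval (slot_component s e \<phi>) p = 0"
proof (cases "e \<in> slot_deg s ` Poly_Mapping.keys \<phi>")
  case True
  define q where "q = (\<Sum>e\<in>slot_deg s ` Poly_Mapping.keys \<phi>. monom (coeff_eval (slot_component s e \<phi>) p) e)"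
  have "poly q t = 0" if "t \<noteq> 0" for t
    using assms[OF that] by (simp add: q_def poly_sum poly_monom coeff_eval_scale_slot mult.commute)
  then have "UNIV - {0} \<subseteq> {t. poly q t = 0}" by auto
  then have "infinite {t. poly q t = 0}"
    using infinite_UNIV_char_0[where 'a = real] by (metis finite.emptyI finite_Diff2 finite_insert finite_subset)
  then have "q = 0" using poly_roots_finite by blast
  moreover have "coeff q e = coeff_eval (slot_component s e \<phi>) p"
    unfolding q_def coeff_sum using True by (simp add: sum.delta)
  ultimately show ?thesis by simp
next
  case False
  then have "slot_component s e \<phi> = 0"
    by (intro poly_mapping_eqI) (auto simp: lookup_slot_component in_keys_iff image_iff)
  then show ?thesis by (simp add: coeff_eval_def)
qed

lemma coeff_eval_component_sum:
  "coeff_eval \<phi> p = (\<Sum>e\<in>slot_deg s ` Poly_Mapping.keys \<phi>. coeff_eval (slot_component s e \<phi>) p)"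
proof -
  have "scale_slot s 1 p = p" by (auto simp: scale_slot_def fun_eq_iff intro: poly_mapping_eqI simp: lookup_const_mult)
  then show ?thesis using coeff_eval_scale_slot[of \<phi> s 1 p] by simp
qed

text \<open>The point coordinates get the default 0; \<open>updz\<close> and \<open>updy\<close>
  overwrite those that a condition reads.\<close>

definition assignment :: "(slot \<Rightarrow> ('n::finite, real) mpol) \<Rightarrow> 'n evar \<Rightarrow> complex" where
  "assignment p v = (case v of Par q \<Rightarrow> complex_of_real (Poly_Mapping.lookup (p (fst q)) (snd q)) | _ \<Rightarrow> 0)"

lemma mpol_vars_add: "mpol_vars (p + q) \<subseteq> mpol_vars p \<union> mpol_vars q"
  using keys_add[of p q] unfolding mpol_vars_def by blast

lemma mpol_vars_mult: "mpol_vars (p * q) \<subseteq> mpol_vars p \<union> mpol_vars (q :: ('v, 'a::comm_semiring_1) mpol)"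
proof
  fix v assume "v \<in> mpol_vars (p * q)"
  then obtain a b where ab: "a \<in> Poly_Mapping.keys p" "b \<in> Poly_Mapping.keys q" "v \<in> Poly_Mapping.keys (a + b)"
    using keys_mult[of p q] unfolding mpol_vars_def by blast
  then have "v \<in> Poly_Mapping.keys a \<union> Poly_Mapping.keys b" using keys_add[of a b] by blast
  with ab show "v \<in> mpol_vars p \<union> mpol_vars q" unfolding mpol_vars_def by blast
qed

text \<open>The way back from functions to formal polynomials. Agreement is claimed at real inputs
  only, where integer coefficients make the complex value real.\<close>

lemma ipoly_to_coeff_poly:
  fixes F :: "('n::finite evar \<Rightarrow> complex) \<Rightarrow> complex"
  assumes "ipoly (Par ` V) F"
  shows "\<exists>\<phi> :: 'n coeff_poly. mpol_vars \<phi> \<subseteq> V \<and> (\<forall>m. Poly_Mapping.lookup \<phi> m \<in> \<int>) \<and>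
    (\<forall>p. F (assignment p) = complex_of_real (coeff_eval \<phi> p))"
  using assms
proof (induction rule: gpoly.induct)
  case (gpoly_const k)
  show ?case
    by (intro exI[of _ "mpol_const (of_int k)"])
      (auto simp: coeff_eval_def mpol_vars_def mpol_const_def lookup_single when_def simp del: single_of_int split: if_splits)
next
  case (gpoly_zero d)
  show ?case by (intro exI[of _ 0]) (auto simp: coeff_eval_def mpol_vars_def)
next
  case (gpoly_var i)
  then obtain v where v: "i = Par v" "v \<in> V" by auto
  then show ?case
    by (intro exI[of _ "Poly_Mapping.single (Poly_Mapping.single v 1) 1"])
      (auto simp: coeff_eval_def mpol_vars_def lookup_single when_def assignment_def split_beta split: if_splits)
next
  case (gpoly_add d F G)
  then obtain f g :: "'n coeff_poly" where fg: "mpol_vars f \<subseteq> V" "\<forall>m. Poly_Mapping.lookup f m \<in> \<int>"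
    "\<forall>p. F (assignment p) = complex_of_real (coeff_eval f p)"
    "mpol_vars g \<subseteq> V" "\<forall>m. Poly_Mapping.lookup g m \<in> \<int>" "\<forall>p. G (assignment p) = complex_of_real (coeff_eval g p)"
    by blast
  have "mpol_vars (f + g) \<subseteq> V" using fg(1,4) mpol_vars_add[of f g] by blast
  with fg show ?case
    by (intro exI[of _ "f + g"]) (auto simp: coeff_eval_def mpol_eval_add lookup_add)
next
  case (gpoly_mult d F e G)
  then obtain f g :: "'n coeff_poly" where fg: "mpol_vars f \<subseteq> V" "\<forall>m. Poly_Mapping.lookup f m \<in> \<int>"
    "\<forall>p. F (assignment p) = complex_of_real (coeff_eval f p)"
    "mpol_vars g \<subseteq> V" "\<forall>m. Poly_Mapping.lookup g m \<in> \<int>" "\<forall>p. G (assignment p) = complex_of_real (coeff_eval g p)"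
    by blast
  have "mpol_vars (f * g) \<subseteq> V" using fg(1,4) mpol_vars_mult[of f g] by blast
  moreover have "Poly_Mapping.lookup (f * g) m \<in> \<int>" for m
    unfolding mult_as_sum lookup_sum lookup_single using fg(2,5)
    by (intro Ints_sum) (auto simp: when_def)
  ultimately show ?case using fg
    by (intro exI[of _ "f * g"]) (auto simp: coeff_eval_def mpol_eval_mult)
qed

text \<open>The slots are treated one at a time. Replacing each polynomial by its components in a
  slot keeps the solution set, because that set is stable under scaling the slot, and keeps
  homogeneity in the slots already treated.\<close>

lemma elimination_polys_exist:
  fixes C :: "('n::finite evar \<Rightarrow> complex) \<Rightarrow> bool"
  assumes C: "zclosed (Par ` pars dg ss) C"
    and inv: "\<And>s t p. s \<in> set ss \<Longrightarrow> t \<noteq> 0 \<Longrightarrow> C (assignment p) \<Longrightarrow> C (assignment (scale_slot s t p))"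
  shows "\<exists>Rs :: 'n coeff_poly list. elimination_polys dg ss (\<lambda>p. C (assignment p)) Rs"
proof -
  obtain Gs where Gs: "finite Gs" "\<forall>G\<in>Gs. ipoly (Par ` pars dg ss) G" "\<forall>x. C x \<longleftrightarrow> (\<forall>G\<in>Gs. G x = 0)"
    using C unfolding zclosed_def by metis
  have "\<forall>G\<in>Gs. \<exists>\<phi> :: 'n coeff_poly. mpol_vars \<phi> \<subseteq> pars dg ss \<and> (\<forall>m. Poly_Mapping.lookup \<phi> m \<in> \<int>) \<and>
    (\<forall>p. G (assignment p) = complex_of_real (coeff_eval \<phi> p))"
    using Gs(2) ipoly_to_coeff_poly by blast
  then obtain \<Psi> :: "_ \<Rightarrow> 'n coeff_poly" where \<Psi>: "\<And>G. G \<in> Gs \<Longrightarrow> mpol_vars (\<Psi> G) \<subseteq> pars dg ss"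
    "\<And>G m. G \<in> Gs \<Longrightarrow> Poly_Mapping.lookup (\<Psi> G) m \<in> \<int>"
    "\<And>G p. G \<in> Gs \<Longrightarrow> G (assignment p) = complex_of_real (coeff_eval (\<Psi> G) p)" by metis
  have "\<exists>Rs. finite Rs \<and> (\<forall>R\<in>Rs. mpol_vars R \<subseteq> pars dg ss \<and> (\<forall>m. Poly_Mapping.lookup R m \<in> \<int>) \<and> (\<forall>s\<in>set us. homogeneous_in_slot s R)) \<and>
      (\<forall>p. (\<forall>R\<in>Rs. coeff_eval R p = 0) \<longleftrightarrow> C (assignment p))" if "set us \<subseteq> set ss" for us
    using that
  proof (induction us)
    case Nil
    have "(\<forall>R\<in>\<Psi> ` Gs. coeff_eval R p = 0) \<longleftrightarrow> C (assignment p)" for p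
    proof -
      have "G (assignment p) = 0 \<longleftrightarrow> coeff_eval (\<Psi> G) p = 0" if "G \<in> Gs" for G
        using \<Psi>(3)[OF that, of p] by simp
      then show ?thesis by (subst Gs(3)[rule_format]) blast
    qed
    then show ?case using Gs(1) \<Psi>(1,2) by (intro exI[of _ "\<Psi> ` Gs"]) simp
  next
    case (Cons s us)
    then obtain Rs where Rs: "finite Rs" "\<forall>R\<in>Rs. mpol_vars R \<subseteq> pars dg ss \<and> (\<forall>m. Poly_Mapping.lookup R m \<in> \<int>) \<and> (\<forall>s\<in>set us. homogeneous_in_slot s R)"
      "\<forall>p. (\<forall>R\<in>Rs. coeff_eval R p = 0) \<longleftrightarrow> C (assignment p)" by auto
    define Rs' where "Rs' = (\<Union>R\<in>Rs. (\<lambda>e. slot_component s e R) ` slot_deg s ` Poly_Mapping.keys R)"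
    have "(\<forall>R\<in>Rs'. coeff_eval R p = 0) \<longleftrightarrow> C (assignment p)" for p
    proof
      assume "\<forall>R\<in>Rs'. coeff_eval R p = 0"
      then have "coeff_eval R p = 0" if "R \<in> Rs" for R
        using that unfolding coeff_eval_component_sum[of R p s] Rs'_def by (intro sum.neutral) auto
      then show "C (assignment p)" using Rs(3) by blast
    next
      assume "C (assignment p)"
      then have "coeff_eval R (scale_slot s t p) = 0" if "R \<in> Rs" "t \<noteq> 0" for R t
        using that Rs(3) inv[of s t p] Cons.prems by auto
      then show "\<forall>R\<in>Rs'. coeff_eval R p = 0"
        unfolding Rs'_def by (auto intro: coeff_eval_components_eq_0)
    qed
    moreover have "mpol_vars (slot_component s e R) \<subseteq> mpol_vars R" for e R
      unfolding mpol_vars_def keys_slot_component by blast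
    ultimately show ?case using Rs(1,2) unfolding Rs'_def
      by (intro exI[of _ Rs'])
         (fastforce simp: Rs'_def lookup_slot_component intro: homogeneous_slot_component)
  qed
  from this[of ss] obtain Rs where Rs: "finite Rs" "\<forall>R\<in>Rs. mpol_vars R \<subseteq> pars dg ss \<and> (\<forall>m. Poly_Mapping.lookup R m \<in> \<int>) \<and> (\<forall>s\<in>set ss. homogeneous_in_slot s R)"
      "\<forall>p. (\<forall>R\<in>Rs. coeff_eval R p = 0) \<longleftrightarrow> C (assignment p)" by auto
  obtain Rl where "set Rl = Rs" using finite_list[OF Rs(1)] by blast
  with Rs show ?thesis
    unfolding elimination_polys_def in_coeffs_of_def integer_coeffs_def pars_def by (intro exI[of _ Rl]) auto
qed

lemma elimination_polys_cong:
  assumes "elimination_polys dg ss C Rs" "\<And>p. inputs_at dg ss p \<Longrightarrow> C p \<longleftrightarrow> C' p"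
  shows "elimination_polys dg ss C' Rs"
  using assms unfolding elimination_polys_def by blast

lemma coeff_eval_sum_squares: "coeff_eval (\<Sum>R\<leftarrow>Rs. R\<^sup>2) p = 0 \<longleftrightarrow> (\<forall>R\<in>set Rs. coeff_eval R p = 0)"
proof -
  have "coeff_eval (\<Sum>R\<leftarrow>Rs. R\<^sup>2) p = (\<Sum>R\<leftarrow>Rs. (coeff_eval R p)\<^sup>2)"
    by (simp add: coeff_eval_def mpol_eval_sum_list power2_eq_square mpol_eval_mult)
  moreover have "(\<Sum>R\<leftarrow>Rs. (coeff_eval R p)\<^sup>2) = 0 \<longleftrightarrow> (\<forall>R\<in>set Rs. coeff_eval R p = 0)"
    by (subst sum_list_nonneg_eq_0_iff) auto
  ultimately show ?thesis by simp
qed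

lemma in_coeffs_of_sum_squares:
  "(\<And>R. R \<in> set Rs \<Longrightarrow> in_coeffs_of dg ss R) \<Longrightarrow> in_coeffs_of dg ss (\<Sum>R\<leftarrow>Rs. R\<^sup>2)"
proof (induction Rs)
  case Nil
  show ?case by (simp add: in_coeffs_of_def mpol_vars_def)
next
  case (Cons R Rs)
  then show ?case
    using mpol_vars_add[of "R\<^sup>2" "\<Sum>R\<leftarrow>Rs. R\<^sup>2"] mpol_vars_mult[of R R]
    unfolding in_coeffs_of_def power2_eq_square by fastforce
qed

section \<open>Existence of the genericity polynomials\<close>

definition updz :: "('n::finite evar \<Rightarrow> complex) \<Rightarrow> complex^('n option) \<Rightarrow> 'n evar \<Rightarrow> complex" where
  "updz x z v = (case v of Zv i \<Rightarrow> z $ i | _ \<Rightarrow> x v)"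

definition updy :: "('n::finite evar \<Rightarrow> complex) \<Rightarrow> complex^'n \<Rightarrow> 'n evar \<Rightarrow> complex" where
  "updy x y v = (case v of Yv i \<Rightarrow> y $ i | _ \<Rightarrow> x v)"

lemma upd_simps [simp]:
  "updz x z (Zv i) = z $ i" "updz x z (Par q) = x (Par q)" "updz x z (Yv j) = x (Yv j)"
  "updy x y (Zv i) = x (Zv i)" "updy x y (Par q) = x (Par q)" "updy x y (Yv j) = y $ j"
  by (simp_all add: updz_def updy_def)

lemma gform_cong: "(\<And>q. x' (Par q) = x (Par q)) \<Longrightarrow> gform dg s x' = gform dg s x"
  by (simp add: gform_def)

text \<open>Up to the factor of the direction, the factors are the powers \<open>d\<close>,
  \<open>d - 1\<close> and \<open>d - 2\<close> of \<open>c\<close> for formal degree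
  \<open>d\<close>; they are written with divisions since \<open>d\<close> may be below 2. In the
  terms of \<open>D_x_scale\<close>, \<tau> is \<sigma> / c.\<close>

lemma form_scale_point:
  assumes "c \<noteq> 0" "\<And>q. x' (Par q) = x (Par q)" "\<And>i. x' (Zv i) = c * x (Zv i)" "\<And>i. x' (Yv i) = \<sigma> * x (Yv i)"
  shows "form_val dg x' s = c ^ dg s * form_val dg x s"
    and "form_grad dg x' s v = c ^ dg s / c * form_grad dg x s v"
    and "form_hess dg x' s i = \<sigma> / c * (c ^ dg s / c) * form_hess dg x s i"
proof -
  have g: "gform dg s x' = gform dg s x" using assms(2) by (rule gform_cong)
  note f = shifted_form_gform[of dg s x]
  show "form_val dg x' s = c ^ dg s * form_val dg x s"
    using shifted_form_eval[OF f, of c] by (simp add: form_val_def g assms(3))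
  show "form_grad dg x' s v = c ^ dg s / c * form_grad dg x s v"
    using shifted_form_eval[OF shifted_form_diff[OF f], of c] assms(1) by (simp add: form_grad_def g assms(3) field_simps)
  have "mpol_eval (mpol_diff (Some i) (mpol_diff (Some j) (gform dg s x))) (\<lambda>i. c * x (Zv i)) * (\<sigma> * x (Yv j)) =
      \<sigma> / c * (c ^ dg s / c) * (mpol_eval (mpol_diff (Some i) (mpol_diff (Some j) (gform dg s x))) (\<lambda>i. x (Zv i)) * x (Yv j))" for j
    using shifted_form_eval[OF shifted_form_diff[OF shifted_form_diff[OF f]], of c "Some i" "Some j"] assms(1)
    by (simp add: field_simps)
  then show "form_hess dg x' s i = \<sigma> / c * (c ^ dg s / c) * form_hess dg x s i"
    by (simp only: form_hess_def g assms(3,4) sum_distrib_left)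
qed

lemma form_scale_slot:
  assumes "\<And>a. x' (Par (s, a)) = t * x (Par (s, a))" "\<And>i. x' (Zv i) = x (Zv i)" "\<And>i. x' (Yv i) = x (Yv i)"
  shows "form_val dg x' s = t * form_val dg x s" "form_grad dg x' s v = t * form_grad dg x s v" "form_hess dg x' s i = t * form_hess dg x s i"
proof -
  have "gform dg s x' = mpol_const t * gform dg s x"
    by (rule poly_mapping_eqI)
      (simp add: lookup_gform lookup_const_mult assms(1) sum_distrib_left if_distrib cong: if_cong)
  then show "form_val dg x' s = t * form_val dg x s" "form_grad dg x' s v = t * form_grad dg x s v" "form_hess dg x' s i = t * form_hess dg x s i"
    by (simp_all add: form_val_def form_grad_def form_hess_def assms mpol_diff_const_mult mpol_eval_mult sum_distrib_left mult.assoc)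
qed

lemma zclosed_ex_z:
  fixes C :: "('n::finite evar \<Rightarrow> complex) \<Rightarrow> bool"
  assumes "zclosed (I \<union> range Zv) C" "range Zv \<inter> I = {}"
    and inv: "\<And>c x x'. c \<noteq> 0 \<Longrightarrow> C x \<Longrightarrow> (\<And>q. x' (Par q) = x (Par q)) \<Longrightarrow> (\<And>i. x' (Zv i) = c * x (Zv i)) \<Longrightarrow>
      (\<And>i. x' (Yv i) = x (Yv i)) \<Longrightarrow> C x'"
  shows "zclosed I (\<lambda>x. \<exists>z. z \<noteq> 0 \<and> C (updz x z))"
proof -
  have "(\<exists>y. (\<forall>i. i \<notin> range Zv \<longrightarrow> y i = x i) \<and> (\<exists>i\<in>range Zv. y i \<noteq> 0) \<and> C y) \<longleftrightarrow> (\<exists>z. z \<noteq> 0 \<and> C (updz x z))" for x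
  proof
    assume "\<exists>y. (\<forall>i. i \<notin> range Zv \<longrightarrow> y i = x i) \<and> (\<exists>i\<in>range Zv. y i \<noteq> 0) \<and> C y"
    then obtain y where y: "\<forall>i. i \<notin> range Zv \<longrightarrow> y i = x i" "\<exists>i\<in>range Zv. y i \<noteq> 0" "C y" by blast
    have "updz x (\<chi> i. y (Zv i)) = y"
    proof
      fix v :: "'n evar" show "updz x (\<chi> i. y (Zv i)) v = y v" using y(1)[rule_format, of v] by (cases v) (simp_all add: image_iff)
    qed
    then show "\<exists>z. z \<noteq> 0 \<and> C (updz x z)"
      using y(2,3) by (intro exI[of _ "\<chi> i. y (Zv i)"]) (auto simp: vec_eq_iff)
  next
    assume "\<exists>z. z \<noteq> 0 \<and> C (updz x z)"
    then obtain z where "z \<noteq> 0" "C (updz x z)" by blast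
    moreover have "\<forall>i. i \<notin> range Zv \<longrightarrow> updz x z i = x i"
    proof (intro allI impI)
      fix v :: "'n evar" assume "v \<notin> range Zv" then show "updz x z v = x v" by (cases v) auto
    qed
    ultimately show "\<exists>y. (\<forall>i. i \<notin> range Zv \<longrightarrow> y i = x i) \<and> (\<exists>i\<in>range Zv. y i \<noteq> 0) \<and> C y"
      by (intro exI[of _ "updz x z"]) (auto simp: vec_eq_iff)
  qed
  moreover have "I \<union> range Zv - range Zv = I" using assms(2) by auto
  moreover have "C (\<lambda>i. if i \<in> range Zv then c * x i else x i)" if "c \<noteq> 0" "C x" for c x
    by (rule inv[OF that]) auto
  ultimately show ?thesis
    using zclosed_projective_elimination[of "range Zv" "I \<union> range Zv" C] assms(1) by simp
qed

lemma zclosed_ex_y: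
  fixes C :: "('n::finite evar \<Rightarrow> complex) \<Rightarrow> bool"
  assumes "zclosed (I \<union> range Yv) C" "range Yv \<inter> I = {}"
    and inv: "\<And>c x x'. c \<noteq> 0 \<Longrightarrow> C x \<Longrightarrow> (\<And>q. x' (Par q) = x (Par q)) \<Longrightarrow> (\<And>i. x' (Zv i) = x (Zv i)) \<Longrightarrow>
      (\<And>i. x' (Yv i) = c * x (Yv i)) \<Longrightarrow> C x'"
  shows "zclosed I (\<lambda>x. \<exists>y. y \<noteq> 0 \<and> C (updy x y))"
proof -
  have "(\<exists>y. (\<forall>i. i \<notin> range Yv \<longrightarrow> y i = x i) \<and> (\<exists>i\<in>range Yv. y i \<noteq> 0) \<and> C y) \<longleftrightarrow> (\<exists>y. y \<noteq> 0 \<and> C (updy x y))" for x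
  proof
    assume "\<exists>y. (\<forall>i. i \<notin> range Yv \<longrightarrow> y i = x i) \<and> (\<exists>i\<in>range Yv. y i \<noteq> 0) \<and> C y"
    then obtain y where y: "\<forall>i. i \<notin> range Yv \<longrightarrow> y i = x i" "\<exists>i\<in>range Yv. y i \<noteq> 0" "C y" by blast
    have "updy x (\<chi> i. y (Yv i)) = y"
    proof
      fix v :: "'n evar" show "updy x (\<chi> i. y (Yv i)) v = y v" using y(1)[rule_format, of v] by (cases v) (simp_all add: image_iff)
    qed
    then show "\<exists>z. z \<noteq> 0 \<and> C (updy x z)"
      using y(2,3) by (intro exI[of _ "\<chi> i. y (Yv i)"]) (auto simp: vec_eq_iff)
  next
    assume "\<exists>z. z \<noteq> 0 \<and> C (updy x z)"
    then obtain z where "z \<noteq> 0" "C (updy x z)" by blast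
    moreover have "\<forall>i. i \<notin> range Yv \<longrightarrow> updy x z i = x i"
    proof (intro allI impI)
      fix v :: "'n evar" assume "v \<notin> range Yv" then show "updy x z v = x v" by (cases v) auto
    qed
    ultimately show "\<exists>y. (\<forall>i. i \<notin> range Yv \<longrightarrow> y i = x i) \<and> (\<exists>i\<in>range Yv. y i \<noteq> 0) \<and> C y"
      by (intro exI[of _ "updy x z"]) (auto simp: vec_eq_iff)
  qed
  moreover have "I \<union> range Yv - range Yv = I" using assms(2) by auto
  moreover have "C (\<lambda>i. if i \<in> range Yv then c * x i else x i)" if "c \<noteq> 0" "C x" for c x
    by (rule inv[OF that]) auto
  ultimately show ?thesis
    using zclosed_projective_elimination[of "range Yv" "I \<union> range Yv" C] assms(1) by simp
qed

section \<open>Generic forms evaluated at the inputs\<close>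

lemma hom_at_eq_gform:
  assumes "inputs_at dg ss p" "s \<in> set ss" "\<And>q. x (Par q) = assignment p (Par q)"
  shows "hom_at dg p s = gform dg s x"
proof -
  have "Poly_Mapping.keys (p s) \<subseteq> {a. expo_deg a \<le> dg s}"
    using assms(1,2) unfolding inputs_at_def polys_deg_le_def by auto
  moreover have "x (Par (s, a)) = complex_of_real (Poly_Mapping.lookup (p s) a)" for a
    using assms(3)[of "(s, a)"] by (simp add: assignment_def)
  ultimately show ?thesis
    by (simp add: hom_at_def gform_def homogenize_superset[OF finite_expo_deg_le])
qed

lemma ceval_hom_at:
  assumes "inputs_at dg ss p" "s \<in> set ss" "\<And>q. x (Par q) = assignment p (Par q)" "\<And>i. x (Zv i) = z $ i"
  shows "ceval (hom_at dg p s) z = form_val dg x s" "full_gradient (hom_at dg p s) z $ v = form_grad dg x s v"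
    "x_gradient (hom_at dg p s) z $ i = form_grad dg x s (Some i)"
    "(\<And>i. x (Yv i) = y $ i) \<Longrightarrow> (x_hessian (hom_at dg p s) z *v y) $ i = form_hess dg x s i"
  using hom_at_eq_gform[OF assms(1-3)] assms(4)
  by (simp_all add: ceval_def form_val_def form_grad_def form_hess_def full_gradient_def x_gradient_def x_hessian_def matrix_vector_mult_def)

lemma ceval_hom_at_updz:
  assumes "inputs_at dg ss p" "s \<in> set ss"
  shows "ceval (hom_at dg p s) z = form_val dg (updz (assignment p) z) s"
    "full_gradient (hom_at dg p s) z $ v = form_grad dg (updz (assignment p) z) s v"
    "x_gradient (hom_at dg p s) z $ i = form_grad dg (updz (assignment p) z) s (Some i)"
  by (rule ceval_hom_at[OF assms]; simp)+

lemma ceval_hom_at_updy: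
  assumes "inputs_at dg ss p" "s \<in> set ss"
  shows "ceval (hom_at dg p s) z = form_val dg (updy (updz (assignment p) z) y) s"
    "x_gradient (hom_at dg p s) z $ i = form_grad dg (updy (updz (assignment p) z) y) s (Some i)"
    "(x_hessian (hom_at dg p s) z *v y) $ i = form_hess dg (updy (updz (assignment p) z) y) s i"
  by (rule ceval_hom_at[OF assms]; simp)+

lemma assignment_updz_scale:
  "updz (assignment (scale_slot s t p)) z (Par (s', a)) = complex_of_real (if s' = s then t else 1) * updz (assignment p) z (Par (s', a))"
  "updz (assignment (scale_slot s t p)) z (Zv i) = updz (assignment p) z (Zv i)"
  "updz (assignment (scale_slot s t p)) z (Yv j) = updz (assignment p) z (Yv j)"
  by (simp_all add: assignment_def lookup_scale_slot)

lemma elim_var_ranges_disjoint: "range Zv \<inter> Par ` A = {}" "range Yv \<inter> (Par ` A \<union> range Zv) = {}"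
  by auto

section \<open>Elimination polynomials for the four conditions\<close>

lemma res_condition_iff:
  fixes p :: "slot \<Rightarrow> ('n::finite, real) mpol"
  assumes inp: "inputs_at dg ss p"
  shows "(\<exists>z. z \<noteq> 0 \<and> Res_x dg ss (updz (assignment p) z)) \<longleftrightarrow> res_condition (map (hom_at dg p) ss)"
proof -
  have "Res_x dg ss (updz (assignment p) z) \<longleftrightarrow> (\<forall>P\<in>set (map (hom_at dg p) ss). ceval P z = 0)" for z
    using ceval_hom_at_updz(1)[OF inp] by (simp add: Res_x_def)
  then show ?thesis unfolding res_condition_def by simp
qed

lemma elimination_Res:
  fixes ss :: "slot list"
  shows "\<exists>Rs :: 'n::finite coeff_poly list. elimination_polys dg ss (\<lambda>p. res_condition (map (hom_at dg p) ss)) Rs"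
proof -
  have z: "zclosed (Par ` pars dg ss) (\<lambda>x. \<exists>z :: complex^('n option). z \<noteq> 0 \<and> Res_x dg ss (updz x z))"
    by (rule zclosed_ex_z[OF zclosed_Res_x[of dg ss] elim_var_ranges_disjoint(1)], simp, simp)
      (rule Res_x_scale, assumption, rule form_scale_point(1)[where \<sigma> = 1], auto)
  have inv: "\<exists>z :: complex^('n option). z \<noteq> 0 \<and> Res_x dg ss (updz (assignment (scale_slot s t p)) z)"
    if "t \<noteq> 0" "\<exists>z. z \<noteq> 0 \<and> Res_x dg ss (updz (assignment p) z)" for s t p
  proof -
    from that(2) obtain z where z: "z \<noteq> 0" "Res_x dg ss (updz (assignment p) z)" by blast
    have "Res_x dg ss (updz (assignment (scale_slot s t p)) z)"
      by (rule Res_x_scale[OF z(2)]) (rule form_scale_slot(1), (rule assignment_updz_scale)+)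
    with z(1) show ?thesis by blast
  qed
  from elimination_polys_exist[OF z inv] obtain Rs :: "'n coeff_poly list"
    where Rs: "elimination_polys dg ss (\<lambda>p. \<exists>z. z \<noteq> 0 \<and> Res_x dg ss (updz (assignment p) z)) Rs" by auto
  from elimination_polys_cong[OF Rs res_condition_iff] show ?thesis by (rule exI)
qed

lemma disc_condition_iff:
  fixes p :: "slot \<Rightarrow> ('n::finite, real) mpol"
  assumes inp: "inputs_at dg ss p"
  shows "(\<exists>z. z \<noteq> 0 \<and> Disc_x dg ss (updz (assignment p) z)) \<longleftrightarrow> disc_condition (map (hom_at dg p) ss)"
proof -
  have "Disc_x dg ss (updz (assignment p) z) \<longleftrightarrow> (\<forall>P\<in>set (map (hom_at dg p) ss). ceval P z = 0) \<and>
     columns_rank (map (\<lambda>P. full_gradient P z) (map (hom_at dg p) ss)) < length (map (hom_at dg p) ss)" for z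
  proof -
    note E = ceval_hom_at_updz[OF inp, where z = z]
    have "columns_rank (map (\<lambda>P. full_gradient P z) (map (hom_at dg p) ss)) < length (map (hom_at dg p) ss) \<longleftrightarrow>
        dependent_columns (\<lambda>r j. map (\<lambda>P. full_gradient P z) (map (hom_at dg p) ss) ! j $ r) (length ss)"
      using columns_rank_less_iff[of "map (\<lambda>P. full_gradient P z) (map (hom_at dg p) ss)"] by simp
    also have "\<dots> \<longleftrightarrow> dependent_columns (\<lambda>r j. form_grad dg (updz (assignment p) z) (ss ! j) r) (length ss)"
      unfolding dependent_columns_def using E(2)[OF nth_mem] by simp
    finally show ?thesis using E(1) by (simp add: Disc_x_def Res_x_def)
  qed
  then show ?thesis unfolding disc_condition_def by simp
qed

lemma elimination_Disc:
  fixes ss :: "slot list"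
  shows "\<exists>Rs :: 'n::finite coeff_poly list. elimination_polys dg ss (\<lambda>p. disc_condition (map (hom_at dg p) ss)) Rs"
proof -
  have z: "zclosed (Par ` pars dg ss) (\<lambda>x. \<exists>z :: complex^('n option). z \<noteq> 0 \<and> Disc_x dg ss (updz x z))"
  proof (rule zclosed_ex_z[OF zclosed_Disc_x elim_var_ranges_disjoint(1)])
    fix c :: complex and x x' :: "'n evar \<Rightarrow> complex"
    assume c: "c \<noteq> 0" and x: "Disc_x dg ss x" and x': "\<And>q. x' (Par q) = x (Par q)"
      "\<And>i. x' (Zv i) = c * x (Zv i)" "\<And>i. x' (Yv i) = x (Yv i)"
    note E = form_scale_point[of c x' x 1, unfolded mult_1, OF c x']
    show "Disc_x dg ss x'"
      by (rule Disc_x_scale[OF x E(1) E(2)]) (use c in simp)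
  qed simp
  have inv: "\<exists>z :: complex^('n option). z \<noteq> 0 \<and> Disc_x dg ss (updz (assignment (scale_slot s t p)) z)"
    if "t \<noteq> 0" "\<exists>z. z \<noteq> 0 \<and> Disc_x dg ss (updz (assignment p) z)" for s t p
  proof -
    from that(2) obtain z where z: "z \<noteq> 0" "Disc_x dg ss (updz (assignment p) z)" by blast
    have "Disc_x dg ss (updz (assignment (scale_slot s t p)) z)"
      by (rule Disc_x_scale[OF z(2)], rule form_scale_slot(1), (rule assignment_updz_scale)+,
          rule form_scale_slot(2), (rule assignment_updz_scale)+) (use that(1) in auto)
    with z(1) show ?thesis by blast
  qed
  from elimination_polys_exist[OF z inv] obtain Rs :: "'n coeff_poly list"
    where Rs: "elimination_polys dg ss (\<lambda>p. \<exists>z. z \<noteq> 0 \<and> Disc_x dg ss (updz (assignment p) z)) Rs" by auto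
  from elimination_polys_cong[OF Rs disc_condition_iff] show ?thesis by (rule exI)
qed

lemma R_condition_iff:
  fixes p :: "slot \<Rightarrow> ('n::finite, real) mpol"
  assumes inp: "inputs_at dg (s0 # ss @ [t]) p"
  shows "(\<exists>z. z \<noteq> 0 \<and> R_x dg s0 ss t (updz (assignment p) z)) \<longleftrightarrow>
    R_condition (hom_at dg p s0) (map (hom_at dg p) ss) (hom_at dg p t)"
proof -
  let ?us = "s0 # ss @ [t]"
  have "R_x dg s0 ss t (updz (assignment p) z) \<longleftrightarrow>
     columns_rank (map (\<lambda>P. x_gradient P z) (hom_at dg p s0 # map (hom_at dg p) ss)) \<le> length (map (hom_at dg p) ss) \<and>
     (\<forall>P\<in>set (map (hom_at dg p) ss). ceval P z = 0) \<and> ceval (hom_at dg p t) z = 0" for z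
  proof -
    note E = ceval_hom_at_updz[OF inp, where z = z]
    let ?cs = "map (\<lambda>s. x_gradient (hom_at dg p s) z) (s0 # ss)"
    have mem: "(s0 # ss) ! j \<in> set ?us" if "j < Suc (length ss)" for j
      using that nth_mem[of j "s0 # ss"] by auto
    have nth: "?cs ! j $ r = form_grad dg (updz (assignment p) z) ((s0 # ss) ! j) (Some r)" if "j < Suc (length ss)" for j r
      using E(3)[OF mem[OF that], of r] nth_map[of j "s0 # ss" "\<lambda>s. x_gradient (hom_at dg p s) z"] that by (simp del: nth_Cons_Suc)
    have "columns_rank ?cs \<le> length ss \<longleftrightarrow> dependent_columns (\<lambda>r j. ?cs ! j $ r) (Suc (length ss))"
      using columns_rank_less_iff[of ?cs] by (simp add: less_Suc_eq_le)
    also have "\<dots> \<longleftrightarrow> dependent_columns (\<lambda>r j. form_grad dg (updz (assignment p) z) ((s0 # ss) ! j) (Some r)) (Suc (length ss))"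
      unfolding dependent_columns_def using nth by simp
    finally show ?thesis using E(1) by (simp add: R_x_def Res_x_def comp_def conj_ac)
  qed
  then show ?thesis unfolding R_condition_def by simp
qed

lemma elimination_R:
  fixes ss :: "slot list"
  shows "\<exists>Rs :: 'n::finite coeff_poly list. elimination_polys dg (s0 # ss @ [t])
    (\<lambda>p. R_condition (hom_at dg p s0) (map (hom_at dg p) ss) (hom_at dg p t)) Rs"
proof -
  let ?us = "s0 # ss @ [t]"
  have z: "zclosed (Par ` pars dg ?us) (\<lambda>x. \<exists>z :: complex^('n option). z \<noteq> 0 \<and> R_x dg s0 ss t (updz x z))"
  proof (rule zclosed_ex_z[OF zclosed_R_x elim_var_ranges_disjoint(1)])
    fix c :: complex and x x' :: "'n evar \<Rightarrow> complex"
    assume c: "c \<noteq> 0" and x: "R_x dg s0 ss t x" and x': "\<And>q. x' (Par q) = x (Par q)"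
      "\<And>i. x' (Zv i) = c * x (Zv i)" "\<And>i. x' (Yv i) = x (Yv i)"
    note E = form_scale_point[of c x' x 1, unfolded mult_1, OF c x']
    show "R_x dg s0 ss t x'"
      by (rule R_x_scale[OF x E(1) E(2)]) (use c in simp)
  qed simp
  have inv: "\<exists>z :: complex^('n option). z \<noteq> 0 \<and> R_x dg s0 ss t (updz (assignment (scale_slot s k p)) z)"
    if "k \<noteq> 0" "\<exists>z. z \<noteq> 0 \<and> R_x dg s0 ss t (updz (assignment p) z)" for s k p
  proof -
    from that(2) obtain z where z: "z \<noteq> 0" "R_x dg s0 ss t (updz (assignment p) z)" by blast
    have "R_x dg s0 ss t (updz (assignment (scale_slot s k p)) z)"
      by (rule R_x_scale[OF z(2)], rule form_scale_slot(1), (rule assignment_updz_scale)+,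
          rule form_scale_slot(2), (rule assignment_updz_scale)+) (use that(1) in auto)
    with z(1) show ?thesis by blast
  qed
  from elimination_polys_exist[OF z inv] obtain Rs :: "'n coeff_poly list"
    where Rs: "elimination_polys dg ?us (\<lambda>p. \<exists>z. z \<noteq> 0 \<and> R_x dg s0 ss t (updz (assignment p) z)) Rs" by auto
  from elimination_polys_cong[OF Rs R_condition_iff] show ?thesis by (rule exI)
qed

lemma D_condition_iff:
  fixes p :: "slot \<Rightarrow> ('n::finite, real) mpol"
  assumes inp: "inputs_at dg (s0 # ss) p"
  shows "(\<exists>z. z \<noteq> 0 \<and> (\<exists>y. y \<noteq> 0 \<and> D_x dg s0 ss (updy (updz (assignment p) z) y))) \<longleftrightarrow>
    D_condition (hom_at dg p s0) (map (hom_at dg p) ss)"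
proof -
  let ?us = "s0 # ss"
  have "D_x dg s0 ss (updy (updz (assignment p) z) y) \<longleftrightarrow>
     columns_rank (D_columns (hom_at dg p s0) (map (hom_at dg p) ss) z y) \<le> 2 * length (map (hom_at dg p) ss) \<and>
     (\<forall>P\<in>set (map (hom_at dg p) ss). ceval P z = 0 \<and> (\<Sum>i\<in>UNIV. x_gradient P z $ i * y $ i) = 0)" for z y
  proof -
    let ?x = "updy (updz (assignment p) z) y"
    note E = ceval_hom_at_updy[OF inp, where z = z and y = y]
    let ?cs = "D_columns (hom_at dg p s0) (map (hom_at dg p) ss) z y"
    have len: "length ?cs = Suc (2 * length ss)" by (simp add: D_columns_def)
    have cs: "?cs = map (\<lambda>s. stack (x_gradient (hom_at dg p s) z) (x_hessian (hom_at dg p s) z *v y)) (s0 # ss) @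
          map (\<lambda>s. stack 0 (x_gradient (hom_at dg p s) z)) ss"
        by (simp add: D_columns_def comp_def)
    have nth: "?cs ! j $ r = D_matrix dg s0 ss ?x r j" if j: "j < Suc (2 * length ss)" for j r
    proof (cases "j \<le> length ss")
      case True
      then have m: "(s0 # ss) ! j \<in> set ?us" by (intro nth_mem) simp
      from cs have "?cs ! j = map (\<lambda>s. stack (x_gradient (hom_at dg p s) z) (x_hessian (hom_at dg p s) z *v y)) (s0 # ss) ! j"
        using True by (simp only: nth_append length_map) simp
      also have "\<dots> = stack (x_gradient (hom_at dg p ((s0 # ss) ! j)) z) (x_hessian (hom_at dg p ((s0 # ss) ! j)) z *v y)"
        using True by (intro nth_map) simp
      finally show ?thesis using True E(2,3)[OF m]
        by (cases r) (simp_all add: stack_def D_matrix_def del: nth_Cons_Suc)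
    next
      case False
      then have m: "ss ! (j - Suc (length ss)) \<in> set ?us" using j by auto
      from cs have "?cs ! j = map (\<lambda>s. stack 0 (x_gradient (hom_at dg p s) z)) ss ! (j - Suc (length ss))"
        using False by (simp only: nth_append length_map) simp
      also have "\<dots> = stack 0 (x_gradient (hom_at dg p (ss ! (j - Suc (length ss)))) z)"
        using False j by (intro nth_map) simp
      finally have "?cs ! j = stack 0 (x_gradient (hom_at dg p (ss ! (j - Suc (length ss)))) z)" .
      then show ?thesis using False E(2)[OF m]
        by (cases r) (simp_all add: stack_def D_matrix_def)
    qed
    have "columns_rank ?cs \<le> 2 * length ss \<longleftrightarrow> dependent_columns (\<lambda>r j. ?cs ! j $ r) (Suc (2 * length ss))"
      using columns_rank_less_iff[of ?cs] by (simp add: less_Suc_eq_le len)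
    also have "\<dots> \<longleftrightarrow> dependent_columns (D_matrix dg s0 ss ?x) (Suc (2 * length ss))"
      unfolding dependent_columns_def using nth by simp
    finally show ?thesis using E(1,2) by (simp add: D_x_def conj_ac)
  qed
  then show ?thesis unfolding D_condition_def by auto
qed

text \<open>The condition is homogeneous in the direction and in the point separately, so two
  projective eliminations apply: of the direction with the point as parameter, then of the
  point.\<close>

lemma elimination_D:
  fixes ss :: "slot list"
  shows "\<exists>Rs :: 'n::finite coeff_poly list. elimination_polys dg (s0 # ss)
    (\<lambda>p. D_condition (hom_at dg p s0) (map (hom_at dg p) ss)) Rs"
proof -
  let ?us = "s0 # ss"
  let ?Y = "\<lambda>x. \<exists>y :: complex^'n. y \<noteq> 0 \<and> D_x dg s0 ss (updy x y)"
  have y: "zclosed (Par ` pars dg ?us \<union> range Zv) ?Y"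
  proof (rule zclosed_ex_y[OF zclosed_D_x elim_var_ranges_disjoint(2)])
    fix c :: complex and x x' :: "'n evar \<Rightarrow> complex"
    assume "c \<noteq> 0" "D_x dg s0 ss x" "\<And>q. x' (Par q) = x (Par q)" "\<And>i. x' (Zv i) = x (Zv i)" "\<And>i. x' (Yv i) = c * x (Yv i)"
    note E = form_scale_point[of 1 x' x c dg, simplified, OF this(3-5)]
    show "D_x dg s0 ss x'"
      by (rule D_x_scale[where \<kappa> = "\<lambda>_. 1" and \<mu> = "\<lambda>_. 1" and \<tau> = c and \<sigma> = c and x = x])
        (use E \<open>c \<noteq> 0\<close> \<open>D_x dg s0 ss x\<close> \<open>\<And>i. x' (Yv i) = c * x (Yv i)\<close> in auto)
  qed simp
  have z: "zclosed (Par ` pars dg ?us) (\<lambda>x. \<exists>z :: complex^('n option). z \<noteq> 0 \<and> ?Y (updz x z))"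
  proof (rule zclosed_ex_z[OF y elim_var_ranges_disjoint(1)])
    fix c :: complex and x x' :: "'n evar \<Rightarrow> complex"
    assume c: "c \<noteq> 0" and "?Y x" and x': "\<And>q. x' (Par q) = x (Par q)" "\<And>i. x' (Zv i) = c * x (Zv i)"
    then obtain y where y: "y \<noteq> 0" "D_x dg s0 ss (updy x y)" by blast
    \<comment> \<open>Scaling the direction along with the point gives gradients and Hessian
      products of a slot the same factor.\<close>
    have E: "form_val dg (updy x' (c *s y)) s = c ^ dg s * form_val dg (updy x y) s"
      "form_grad dg (updy x' (c *s y)) s v = c ^ dg s / c * form_grad dg (updy x y) s v"
      "form_hess dg (updy x' (c *s y)) s i = c / c * (c ^ dg s / c) * form_hess dg (updy x y) s i" for s v i
      by (rule form_scale_point[OF c, where \<sigma> = c]; simp add: x')+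
    have "D_x dg s0 ss (updy x' (c *s y))"
      by (rule D_x_scale[OF y(2) E(1) E(2) _ E(3), where \<sigma> = c]) (use c in simp_all)
    moreover have "c *s y \<noteq> 0" using y(1) c by (simp add: vector_mul_eq_0)
    ultimately show "?Y x'" by blast
  qed
  have inv: "\<exists>z :: complex^('n option). z \<noteq> 0 \<and> ?Y (updz (assignment (scale_slot s k p)) z)"
    if "k \<noteq> 0" "\<exists>z. z \<noteq> 0 \<and> ?Y (updz (assignment p) z)" for s k p
  proof -
    from that(2) obtain z y where z: "z \<noteq> 0" "y \<noteq> 0" "D_x dg s0 ss (updy (updz (assignment p) z) y)" by blast
    let ?k = "\<lambda>s'. complex_of_real (if s' = s then k else 1)"
    let ?x' = "updy (updz (assignment (scale_slot s k p)) z) y" and ?x = "updy (updz (assignment p) z) y"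
    have E: "form_val dg ?x' s' = ?k s' * form_val dg ?x s'" "form_grad dg ?x' s' v = ?k s' * form_grad dg ?x s' v"
      "form_hess dg ?x' s' i = ?k s' * form_hess dg ?x s' i" for s' v i
      by (rule form_scale_slot; simp add: assignment_def lookup_scale_slot)+
    have E3: "form_hess dg ?x' s' i = 1 * ?k s' * form_hess dg ?x s' i" for s' i
      unfolding mult_1 by (rule E(3))
    have "D_x dg s0 ss ?x'"
      by (rule D_x_scale[OF z(3) E(1) E(2) _ E3, where \<sigma> = 1]) (use that(1) in simp_all)
    with z(1,2) show ?thesis by blast
  qed
  from elimination_polys_exist[OF z inv] obtain Rs :: "'n coeff_poly list"
    where Rs: "elimination_polys dg ?us (\<lambda>p. \<exists>z. z \<noteq> 0 \<and> ?Y (updz (assignment p) z)) Rs" by auto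
  from elimination_polys_cong[OF Rs D_condition_iff] show ?thesis by (rule exI)
qed

section \<open>One polynomial for each tuple\<close>

lemma is_Res_exists: "\<exists>\<phi> :: 'n::finite coeff_poly. is_Res dg ss \<phi>"
proof -
  obtain Rs :: "'n coeff_poly list" where "elimination_polys dg ss (\<lambda>p. res_condition (map (hom_at dg p) ss)) Rs"
    using elimination_Res by blast
  then have "is_Res dg ss (\<Sum>R\<leftarrow>Rs. R\<^sup>2)"
    by (auto simp: elimination_polys_def is_Res_def coeff_eval_sum_squares intro!: in_coeffs_of_sum_squares)
  then show ?thesis by blast
qed

lemma is_Disc_exists: "\<exists>\<phi> :: 'n::finite coeff_poly. is_Disc dg ss \<phi>"
proof -
  obtain Rs :: "'n coeff_poly list" where "elimination_polys dg ss (\<lambda>p. disc_condition (map (hom_at dg p) ss)) Rs"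
    using elimination_Disc by blast
  then have "is_Disc dg ss (\<Sum>R\<leftarrow>Rs. R\<^sup>2)"
    by (auto simp: elimination_polys_def is_Disc_def coeff_eval_sum_squares intro!: in_coeffs_of_sum_squares)
  then show ?thesis by blast
qed

lemma is_R_exists: "\<exists>\<phi> :: 'n::finite coeff_poly. is_R dg s0 ss t \<phi>"
  using elimination_R[of dg s0 ss t] unfolding is_R_def by blast

lemma is_D_exists: "\<exists>\<phi> :: 'n::finite coeff_poly. is_D dg s0 ss \<phi>"
  using elimination_D[of dg s0 ss] unfolding is_D_def by blast

lemma finite_constr_tuples: "finite (constr_tuples m1 m2 r)"
proof -
  have "constr_tuples m1 m2 r \<subseteq> (\<lambda>js. map Eqn [1..<Suc m1] @ map Ineq js) ` {js. set js \<subseteq> {1..m2} \<and> length js = r}"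
    unfolding constr_tuples_def by blast
  then show ?thesis by (rule finite_subset) (intro finite_imageI finite_lists_length_eq, simp)
qed

lemma finite_tuples: "finite (tuples_a n m1 m2)" "finite (tuples_b n m1 m2)" "finite (tuples_c n m1 m2)" "finite (tuples_d n m1 m2)"
proof -
  show "finite (tuples_a n m1 m2)" by (simp add: tuples_a_def finite_constr_tuples)
  show d: "finite (tuples_d n m1 m2)" by (simp add: tuples_d_def finite_constr_tuples)
  then show b: "finite (tuples_b n m1 m2)" by (simp add: tuples_b_def)
  have "tuples_c n m1 m2 = (\<Union>ss\<in>tuples_b n m1 m2. {ts. mset ts = mset ss})" by (auto simp: tuples_c_def)
  then show "finite (tuples_c n m1 m2)" using b by (simp add: mset_eq_finite)
qed

lemma genericity_list_exists: "\<exists>\<Phi> :: 'n::finite coeff_poly set. finite \<Phi> \<and> genericity_list dg m1 m2 \<Phi>"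
proof -
  let ?n = "CARD('n)"
  obtain A :: "slot list \<Rightarrow> 'n coeff_poly" where A: "\<And>ss. is_Res dg ss (A ss)" using is_Res_exists by metis
  obtain B :: "slot list \<Rightarrow> 'n coeff_poly" where B: "\<And>ss. is_Disc dg ss (B ss)" using is_Disc_exists by metis
  have "\<forall>ss. \<exists>\<phi> :: 'n coeff_poly. is_R dg Obj (butlast ss) (last ss) \<phi>" using is_R_exists by blast
  from choice[OF this] obtain C :: "slot list \<Rightarrow> 'n coeff_poly"
    where C: "\<forall>ss. is_R dg Obj (butlast ss) (last ss) (C ss)" ..
  obtain D :: "slot list \<Rightarrow> 'n coeff_poly" where D: "\<And>ss. is_D dg Obj ss (D ss)" using is_D_exists by metis
  let ?\<Phi> = "A ` tuples_a ?n m1 m2 \<union> B ` tuples_b ?n m1 m2 \<union> C ` tuples_c ?n m1 m2 \<union> D ` tuples_d ?n m1 m2"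
  have "genericity_list dg m1 m2 ?\<Phi>"
    unfolding genericity_list_def Let_def
    by (rule exI[of _ A], rule exI[of _ B], rule exI[of _ C], rule exI[of _ D]) (simp add: A B C D)
  moreover have "finite ?\<Phi>" by (simp add: finite_tuples)
  ultimately show ?thesis by (intro exI[of _ ?\<Phi>] conjI)
qed

section \<open>Curves along the constraints\<close>

text \<open>Each function is indexed by its own gradient at \<open>u\<close>, so the derivative of
  \<Psi> there sends \<open>h\<close> to the sum of the \<open>(b \<bullet> h) *\<^sub>R b\<close>.
  This is injective because \<open>B\<close> is a basis, and the inverse function theorem applies.
  The curve is the preimage of a straight line, whence every \<open>q b\<close> is exactly affine in
  \<open>t\<close> along it.\<close>

lemma curve_along_family:
  fixes B :: "(real^'n) set" and q :: "real^'n \<Rightarrow> real^'n \<Rightarrow> real" and q' :: "real^'n \<Rightarrow> real^'n \<Rightarrow> real^'n"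
  assumes ind: "independent B" and span: "span B = UNIV"
    and der: "\<And>b x. b \<in> B \<Longrightarrow> (q b has_derivative (\<lambda>h. q' b x \<bullet> h)) (at x)"
    and cont: "\<And>b. b \<in> B \<Longrightarrow> continuous_on UNIV (q' b)"
    and u: "\<And>b. b \<in> B \<Longrightarrow> q' b u = b"
  shows "\<exists>\<gamma>. \<gamma> 0 = u \<and> (\<gamma> has_vector_derivative v) (at 0) \<and>
    (\<forall>\<^sub>F t in at_right 0. \<forall>b\<in>B. q b (\<gamma> t) = q b u + t * (b \<bullet> v))"
proof -
  have fin: "finite B" using ind by (rule independent_imp_finite)
  define \<Psi> where "\<Psi> x = (\<Sum>b\<in>B. (q b x - q b u) *\<^sub>R b)" for x
  define F where "F x h = (\<Sum>b\<in>B. (q' b x \<bullet> h) *\<^sub>R b)" for x h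
  have blF: "bounded_linear (F x)" for x
    unfolding F_def
    by (intro bounded_linear_sum bounded_linear_scaleR_const bounded_linear_inner_right)
  have der\<Psi>: "(\<Psi> has_derivative F x) (at x)" for x
    unfolding \<Psi>_def F_def
    by (intro has_derivative_sum has_derivative_scaleR_left)
       (auto intro!: derivative_eq_intros der)
  have inj: "inj (F u)"
  proof (rule linear_injective_0[THEN iffD2, rule_format])
    show "linear (F u)" using blF by (rule bounded_linear.linear)
    fix h assume "F u h = 0"
    then have "(\<Sum>b\<in>B. (b \<bullet> h) *\<^sub>R b) = 0" by (simp add: F_def u)
    then have "b \<bullet> h = 0" if "b \<in> B" for b
      using that independentD[OF ind fin, of "\<lambda>b. b \<bullet> h"] by auto
    then have "orthogonal h h"
      using span by (intro orthogonal_to_span[of h B]) (auto simp: orthogonal_def inner_commute)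
    then show "h = 0" by (simp add: orthogonal_def)
  qed
  obtain L where L: "linear L" "L \<circ> F u = id"
    using linear_injective_left_inverse[OF bounded_linear.linear[OF blF] inj] by blast
  have contB: "continuous_on UNIV (\<lambda>x. Blinfun (F x))"
    by (rule continuous_on_blinfun_componentwise)
      (auto simp: bounded_linear_Blinfun_apply[OF blF] F_def intro!: continuous_intros cont)
  have der\<Psi>': "(\<Psi> has_derivative blinfun_apply (Blinfun (F x))) (at x)" for x
    by (simp add: bounded_linear_Blinfun_apply[OF blF] der\<Psi>)
  have "Blinfun L o\<^sub>L Blinfun (F u) = id_blinfun"
    using L by (intro blinfun_eqI) (simp add: bounded_linear_Blinfun_apply blF linear_conv_bounded_linear pointfree_idE)
  then obtain U' V g g' where "open U'" "U' \<subseteq> UNIV" and u': "u \<in> U'" and V: "open V" "\<Psi> u \<in> V"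
    and hom: "homeomorphism U' V \<Psi> g"
    and g: "\<And>y. y \<in> V \<Longrightarrow> (g has_derivative (g' y)) (at y)"
      "\<And>y. y \<in> V \<Longrightarrow> g' y = inv (blinfun_apply (Blinfun (F (g y))))"
    and "\<And>y. y \<in> V \<Longrightarrow> bij (blinfun_apply (Blinfun (F (g y))))"
    by (rule inverse_function_theorem[OF open_UNIV der\<Psi>' contB UNIV_I]) (rule that)
  have \<Psi>u: "\<Psi> u = 0" by (simp add: \<Psi>_def)
  have gu: "g 0 = u" using homeomorphism_apply1[OF hom u'] \<Psi>u by simp
  define \<gamma> where "\<gamma> t = g (t *\<^sub>R F u v)" for t
  have g0: "(g has_derivative inv (F u)) (at 0)"
    using g[of 0] V(2) \<Psi>u gu by (simp add: bounded_linear_Blinfun_apply[OF blF])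
  have "(\<gamma> has_vector_derivative v) (at 0)"
  proof -
    have "((g \<circ> (\<lambda>t. t *\<^sub>R F u v)) has_derivative (inv (F u) \<circ> (\<lambda>t. t *\<^sub>R F u v))) (at 0)"
      by (rule diff_chain_at) (auto intro!: derivative_eq_intros g0)
    moreover have "inv (F u) \<circ> (\<lambda>t. t *\<^sub>R F u v) = (\<lambda>t. t *\<^sub>R v)"
    proof
      fix t
      have "t *\<^sub>R F u v = F u (t *\<^sub>R v)" using linear_cmul[OF bounded_linear.linear[OF blF]] by metis
      then show "(inv (F u) \<circ> (\<lambda>t. t *\<^sub>R F u v)) t = t *\<^sub>R v" using inj by simp
    qed
    ultimately show ?thesis by (simp add: has_vector_derivative_def \<gamma>_def[abs_def] comp_def)
  qed
  moreover have "\<forall>\<^sub>F t in at_right 0. \<forall>b\<in>B. q b (\<gamma> t) = q b u + t * (b \<bullet> v)"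
  proof -
    have "((\<lambda>t. t *\<^sub>R F u v) \<longlongrightarrow> 0 *\<^sub>R F u v) (at_right 0)"
      by (intro tendsto_intros)
    then have "\<forall>\<^sub>F t in at_right 0. t *\<^sub>R F u v \<in> V"
      using V \<Psi>u by (auto simp: tendsto_def)
    then show ?thesis
    proof (rule eventually_mono)
      fix t assume "t *\<^sub>R F u v \<in> V"
      then have "\<Psi> (\<gamma> t) = t *\<^sub>R F u v" using homeomorphism_apply2[OF hom] by (simp add: \<gamma>_def)
      then have "(\<Sum>b\<in>B. (q b (\<gamma> t) - q b u - t * (b \<bullet> v)) *\<^sub>R b) = 0"
        by (simp add: \<Psi>_def F_def u scaleR_sum_right algebra_simps sum_subtractf sum.distrib)
      then have "q b (\<gamma> t) - q b u - t * (b \<bullet> v) = 0" if "b \<in> B" for b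
        using that independentD[OF ind fin, of "\<lambda>b. q b (\<gamma> t) - q b u - t * (b \<bullet> v)"] by auto
      then show "\<forall>b\<in>B. q b (\<gamma> t) = q b u + t * (b \<bullet> v)" by fastforce
    qed
  qed
  moreover have "\<gamma> 0 = u" using gu by (simp add: \<gamma>_def)
  ultimately show ?thesis by blast
qed

lemma mpol_diff_commute: "mpol_diff i (mpol_diff j p) = mpol_diff j (mpol_diff i p)"
  by (rule poly_mapping_eqI)
    (cases "i = j"; simp add: lookup_mpol_diff lookup_add lookup_single when_def add_ac mult_ac)

lemma has_derivative_mpol_gradient:
  fixes p :: "('n::finite, real) mpol"
  shows "(mpol_gradient p has_derivative (\<lambda>h. mpol_hessian p u *v h)) (at u)"
proof -
  have "((\<lambda>x. mpol_gradient p x $ i) has_derivative (\<lambda>h. (mpol_hessian p u *v h) $ i)) (at u)" for i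
  proof -
    have "(mpol_hessian p u *v h) $ i = mpol_gradient (mpol_diff i p) u \<bullet> h" for h
      by (simp add: matrix_vector_mult_def mpol_hessian_def mpol_gradient_def inner_vec_def mpol_diff_commute[of i])
    then show ?thesis
      using has_derivative_mpol_eval[of "mpol_diff i p" u] by (simp add: mpol_gradient_def)
  qed
  then show ?thesis
    by (subst has_derivative_componentwise_within) (auto simp: Basis_vec_def inner_axis)
qed

lemma mpol_hessian_symmetric: "transpose (mpol_hessian p u) = mpol_hessian p u"
  by (simp add: vec_eq_iff transpose_def mpol_hessian_def mpol_diff_commute)

lemma continuous_on_mpol_gradient: "continuous_on S (mpol_gradient p)"
  by (intro continuous_at_imp_continuous_on ballI has_derivative_continuous[OF has_derivative_mpol_gradient])

text \<open>The independent gradients are completed to a basis; an added basis vector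
  \<open>b\<close> is the gradient of the linear function with coefficient vector
  \<open>b\<close>.\<close>

lemma curve_along_constraints:
  fixes P :: "'k \<Rightarrow> ('n::finite, real) mpol"
  assumes inj: "inj_on (\<lambda>s. mpol_gradient (P s) u) K" and ind: "independent ((\<lambda>s. mpol_gradient (P s) u) ` K)"
  shows "\<exists>\<gamma>. \<gamma> 0 = u \<and> (\<gamma> has_vector_derivative v) (at 0) \<and>
    (\<forall>\<^sub>F t in at_right 0. \<forall>s\<in>K. mpol_eval (P s) (($) (\<gamma> t)) = mpol_eval (P s) (($) u) + t * (mpol_gradient (P s) u \<bullet> v))"
proof -
  let ?G = "\<lambda>s. mpol_gradient (P s) u"
  obtain B where B: "?G ` K \<subseteq> B" "independent B" "span B = UNIV"
    using maximal_independent_subset_extend[OF subset_UNIV ind] by (metis top.extremum_uniqueI)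
  define k where "k = the_inv_into K ?G"
  have kG: "k (?G s) = s" if "s \<in> K" for s unfolding k_def using inj that by (rule the_inv_into_f_f)
  then have k: "?G (k b) = b" if "b \<in> ?G ` K" for b using that by auto
  define q where "q b = (if b \<in> ?G ` K then (\<lambda>x. mpol_eval (P (k b)) (($) x)) else (\<lambda>x. b \<bullet> x))" for b
  define q' where "q' b = (if b \<in> ?G ` K then mpol_gradient (P (k b)) else (\<lambda>x. b))" for b
  have "\<exists>\<gamma>. \<gamma> 0 = u \<and> (\<gamma> has_vector_derivative v) (at 0) \<and>
    (\<forall>\<^sub>F t in at_right 0. \<forall>b\<in>B. q b (\<gamma> t) = q b u + t * (b \<bullet> v))"
  proof (rule curve_along_family[OF B(2,3)])
    fix b x
    show "(q b has_derivative (\<lambda>h. q' b x \<bullet> h)) (at x)"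
      by (auto simp: q_def q'_def intro!: has_derivative_mpol_eval derivative_eq_intros)
    show "continuous_on UNIV (q' b)" by (simp add: q'_def continuous_on_mpol_gradient)
    show "q' b u = b" using k[of b] by (simp add: q'_def)
  qed
  then obtain \<gamma> where \<gamma>: "\<gamma> 0 = u" "(\<gamma> has_vector_derivative v) (at 0)"
    "\<forall>\<^sub>F t in at_right 0. \<forall>b\<in>B. q b (\<gamma> t) = q b u + t * (b \<bullet> v)" by blast
  have "\<forall>\<^sub>F t in at_right 0. \<forall>s\<in>K. mpol_eval (P s) (($) (\<gamma> t)) = mpol_eval (P s) (($) u) + t * (?G s \<bullet> v)"
    using \<gamma>(3)
  proof (rule eventually_mono)
    fix t assume a: "\<forall>b\<in>B. q b (\<gamma> t) = q b u + t * (b \<bullet> v)"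
    show "\<forall>s\<in>K. mpol_eval (P s) (($) (\<gamma> t)) = mpol_eval (P s) (($) u) + t * (?G s \<bullet> v)"
    proof
      fix s assume s: "s \<in> K"
      then have "?G s \<in> B" "?G s \<in> ?G ` K" using B(1) by auto
      then show "mpol_eval (P s) (($) (\<gamma> t)) = mpol_eval (P s) (($) u) + t * (?G s \<bullet> v)"
        using a[rule_format, of "?G s"] kG[OF s] by (simp add: q_def)
    qed
  qed
  with \<gamma>(1,2) show ?thesis by blast
qed

section \<open>One-sided minima along curves\<close>

lemma derivative_nonneg_of_right_minimum:
  fixes \<phi> :: "real \<Rightarrow> real"
  assumes "(\<phi> has_real_derivative D) (at 0)" "\<forall>\<^sub>F t in at_right 0. \<phi> 0 \<le> \<phi> t"
  shows "0 \<le> D"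
proof (rule ccontr)
  assume "\<not> 0 \<le> D"
  then obtain d where d: "d > 0" "\<And>h. h > 0 \<Longrightarrow> h < d \<Longrightarrow> \<phi> h < \<phi> 0"
    using has_real_derivative_neg_dec_right[OF assms(1)] by auto
  have "\<forall>\<^sub>F t in at_right 0. t > 0 \<and> t < d"
    using d(1) by (auto simp: eventually_at_right intro!: exI[of _ d])
  with assms(2) have "\<forall>\<^sub>F t in at_right (0::real). False"
    by eventually_elim (use d(2) in force)
  then show False by simp
qed

text \<open>Writing \<open>w = \<gamma> t - u\<close>, the mean value theorem gives \<open>\<phi> (u + w) - \<phi> u = g (u + \<theta> w) \<bullet> w\<close>; as
  \<open>g (u + \<theta> w) = \<theta> H w + o(\<theta> |w|)\<close>, the unknown factor \<open>\<theta>\<close> does not affect the sign.\<close>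

lemma second_order_necessary_along_curve:
  fixes \<phi> :: "'a::euclidean_space \<Rightarrow> real"
  assumes der: "\<And>x. (\<phi> has_derivative (\<lambda>h. g x \<bullet> h)) (at x)"
    and der2: "(g has_derivative H) (at u)" and g0: "g u = 0"
    and \<gamma>: "\<gamma> 0 = u" "(\<gamma> has_vector_derivative v) (at 0)" "\<forall>\<^sub>F t in at_right 0. \<phi> u \<le> \<phi> (\<gamma> t)"
  shows "0 \<le> v \<bullet> H v"
proof (rule ccontr)
  assume "\<not> 0 \<le> v \<bullet> H v"
  then have neg: "v \<bullet> H v < 0" by simp
  define \<delta> where "\<delta> = - (v \<bullet> H v)"
  have \<delta>: "\<delta> > 0" using neg by (simp add: \<delta>_def)
  \<comment> \<open>Half of the gap \<delta> absorbs the error term, because the squared norm of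
    \<open>(1 / t) *\<^sub>R w t\<close> is eventually below
    \<open>(norm v)\<^sup>2 + 1\<close>.\<close>
  define \<epsilon> where "\<epsilon> = \<delta> / (2 * ((norm v)\<^sup>2 + 1))"
  have nv: "(norm v)\<^sup>2 + 1 > 0" by (simp add: add_nonneg_pos)
  have \<epsilon>: "\<epsilon> > 0" "\<epsilon> * ((norm v)\<^sup>2 + 1) = \<delta> / 2" using \<delta> nv by (simp_all add: \<epsilon>_def field_simps)
  have blH: "bounded_linear H" using der2 by (rule has_derivative_bounded_linear)
  obtain d where d: "d > 0" "\<And>y. norm (y - u) < d \<Longrightarrow> norm (g y - H (y - u)) \<le> \<epsilon> * norm (y - u)"
    using der2 \<epsilon>(1) unfolding has_derivative_at_alt by (auto simp: g0)
  define w where "w t = \<gamma> t - u" for t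
  have lim: "((\<lambda>t. (1 / t) *\<^sub>R w t) \<longlongrightarrow> v) (at_right 0)"
  proof -
    have "(\<gamma> has_derivative (\<lambda>h. h *\<^sub>R v)) (at_right 0)"
      using \<gamma>(2) unfolding has_vector_derivative_def by (rule has_derivative_at_withinI)
    then have "((\<lambda>t. norm (w t - t *\<^sub>R v) / norm t) \<longlongrightarrow> 0) (at_right 0)"
      by (simp add: has_derivative_iff_norm w_def \<gamma>(1))
    moreover have "\<forall>\<^sub>F t in at_right 0. norm (w t - t *\<^sub>R v) / norm t = norm ((1 / t) *\<^sub>R w t - v)"
      unfolding eventually_at_filter
    proof (intro always_eventually allI impI)
      fix t :: real assume t: "t \<noteq> 0" "t \<in> {0<..}"
      have "norm ((1 / t) *\<^sub>R w t - v) = norm ((1 / t) *\<^sub>R (w t - t *\<^sub>R v))"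
        using t(1) by (simp add: scaleR_diff_right)
      then show "norm (w t - t *\<^sub>R v) / norm t = norm ((1 / t) *\<^sub>R w t - v)" by simp
    qed
    ultimately have "((\<lambda>t. norm ((1 / t) *\<^sub>R w t - v)) \<longlongrightarrow> 0) (at_right 0)"
      by (rule Lim_transform_eventually)
    then show ?thesis by (rule LIM_zero_cancel[OF tendsto_norm_zero_cancel])
  qed
  have "((\<lambda>t. w t) \<longlongrightarrow> 0) (at_right 0)"
  proof -
    have "isCont \<gamma> 0" using \<gamma>(2) has_vector_derivative_continuous by blast
    then have "(\<gamma> \<longlongrightarrow> u) (at 0)" using \<gamma>(1) by (simp add: isCont_def)
    then have "(\<gamma> \<longlongrightarrow> u) (at_right 0)" by (rule tendsto_within_subset) simp
    then show ?thesis unfolding w_def by (rule LIM_zero)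
  qed
  then have "\<forall>\<^sub>F t in at_right 0. norm (w t) < d"
    using order_tendstoD(2)[OF tendsto_norm_zero, of w "at_right 0" d] d(1) by simp
  moreover have "((\<lambda>t. ((1 / t) *\<^sub>R w t) \<bullet> H ((1 / t) *\<^sub>R w t)) \<longlongrightarrow> v \<bullet> H v) (at_right 0)"
    by (intro tendsto_inner lim bounded_linear.tendsto[OF blH])
  then have "\<forall>\<^sub>F t in at_right 0. ((1 / t) *\<^sub>R w t) \<bullet> H ((1 / t) *\<^sub>R w t) < - \<delta> / 2"
    by (rule order_tendstoD(2)) (use \<delta> in \<open>simp add: \<delta>_def\<close>)
  moreover have "((\<lambda>t. (norm ((1 / t) *\<^sub>R w t))\<^sup>2) \<longlongrightarrow> (norm v)\<^sup>2) (at_right 0)"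
    by (intro tendsto_intros lim)
  then have "\<forall>\<^sub>F t in at_right 0. (norm ((1 / t) *\<^sub>R w t))\<^sup>2 < (norm v)\<^sup>2 + 1"
    by (rule order_tendstoD(2)) simp
  moreover have "\<forall>\<^sub>F t in at_right 0. (t::real) > 0" by (simp add: eventually_at_right_less)
  ultimately have "\<forall>\<^sub>F t in at_right (0::real). False"
    using \<gamma>(3)
  proof eventually_elim
    fix t :: real
    assume t: "norm (w t) < d" "((1 / t) *\<^sub>R w t) \<bullet> H ((1 / t) *\<^sub>R w t) < - \<delta> / 2"
      "(norm ((1 / t) *\<^sub>R w t))\<^sup>2 < (norm v)\<^sup>2 + 1" "t > 0" "\<phi> u \<le> \<phi> (\<gamma> t)"
    have "\<exists>\<theta>\<in>{0<..<1}. \<phi> (u + 1 *\<^sub>R w t) - \<phi> (u + 0 *\<^sub>R w t) = (1 - 0) * (g (u + \<theta> *\<^sub>R w t) \<bullet> w t)"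
    proof (rule mvt_simple[where f = "\<lambda>s. \<phi> (u + s *\<^sub>R w t)" and f' = "\<lambda>s h. h * (g (u + s *\<^sub>R w t) \<bullet> w t)", of 0 1])
      fix s :: real
      have "((\<phi> \<circ> (\<lambda>s. u + s *\<^sub>R w t)) has_derivative ((\<lambda>h. g (u + s *\<^sub>R w t) \<bullet> h) \<circ> (\<lambda>h. h *\<^sub>R w t))) (at s)"
      proof (rule diff_chain_at[OF _ der])
        show "((\<lambda>s. u + s *\<^sub>R w t) has_derivative (\<lambda>h. h *\<^sub>R w t)) (at s)"
          using has_derivative_add[OF has_derivative_const[of u] has_derivative_scaleR_left[OF has_derivative_ident, of "w t"]] by simp
      qed
      then have "((\<lambda>s. \<phi> (u + s *\<^sub>R w t)) has_derivative (\<lambda>h. h * (g (u + s *\<^sub>R w t) \<bullet> w t))) (at s)"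
        by (simp add: comp_def)
      then show "((\<lambda>s. \<phi> (u + s *\<^sub>R w t)) has_derivative (\<lambda>h. h * (g (u + s *\<^sub>R w t) \<bullet> w t))) (at s within {0..1})"
        by (rule has_derivative_at_withinI)
    qed simp
    then obtain \<theta> where \<theta>: "0 < \<theta>" "\<theta> < 1" "\<phi> (\<gamma> t) - \<phi> u = g (u + \<theta> *\<^sub>R w t) \<bullet> w t" by (auto simp: w_def)
    let ?e = "g (u + \<theta> *\<^sub>R w t) - H (\<theta> *\<^sub>R w t)"
    have "norm (\<theta> *\<^sub>R w t) \<le> norm (w t)" using \<theta> by (simp add: mult_left_le_one_le)
    then have "norm ?e \<le> \<epsilon> * norm (\<theta> *\<^sub>R w t)" using d(2)[of "u + \<theta> *\<^sub>R w t"] t(1) by simp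
    then have "norm ?e * norm (w t) \<le> \<epsilon> * norm (\<theta> *\<^sub>R w t) * norm (w t)"
      by (rule mult_right_mono) simp
    then have "?e \<bullet> w t \<le> \<epsilon> * norm (\<theta> *\<^sub>R w t) * norm (w t)"
      using norm_cauchy_schwarz[of ?e "w t"] by linarith
    then have e: "?e \<bullet> w t \<le> \<theta> * (\<epsilon> * (norm (w t))\<^sup>2)" using \<theta> by (simp add: power2_eq_square mult_ac)
    have "g (u + \<theta> *\<^sub>R w t) \<bullet> w t = \<theta> * (w t \<bullet> H (w t)) + ?e \<bullet> w t"
      by (simp add: inner_diff_left inner_diff_right linear_cmul[OF bounded_linear.linear[OF blH]] inner_commute)
    also have "\<dots> \<le> \<theta> * (w t \<bullet> H (w t) + \<epsilon> * (norm (w t))\<^sup>2)" using e by (simp add: distrib_left)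
    also have "\<dots> < 0"
    proof -
      \<comment> \<open>Both terms are quadratic in \<open>w t\<close>; dividing by the square of
        \<open>t\<close> replaces \<open>w t\<close> by a vector close to \<open>v\<close>.\<close>
      have wH: "w t \<bullet> H (w t) = t\<^sup>2 * (((1 / t) *\<^sub>R w t) \<bullet> H ((1 / t) *\<^sub>R w t))"
        using t(4) by (simp add: linear_cmul[OF bounded_linear.linear[OF blH]] power2_eq_square)
      have wn: "(norm (w t))\<^sup>2 = t\<^sup>2 * (norm ((1 / t) *\<^sub>R w t))\<^sup>2"
        using t(4) by (simp add: power_divide)
      have "\<epsilon> * (norm ((1 / t) *\<^sub>R w t))\<^sup>2 < \<delta> / 2" using mult_strict_left_mono[OF t(3) \<epsilon>(1)] \<epsilon>(2) by simp
      with t(2) have "((1 / t) *\<^sub>R w t) \<bullet> H ((1 / t) *\<^sub>R w t) + \<epsilon> * (norm ((1 / t) *\<^sub>R w t))\<^sup>2 < 0" by linarith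
      then have "t\<^sup>2 * (((1 / t) *\<^sub>R w t) \<bullet> H ((1 / t) *\<^sub>R w t) + \<epsilon> * (norm ((1 / t) *\<^sub>R w t))\<^sup>2) < 0"
        using t(4) by (intro mult_pos_neg) simp_all
      also have "t\<^sup>2 * (((1 / t) *\<^sub>R w t) \<bullet> H ((1 / t) *\<^sub>R w t) + \<epsilon> * (norm ((1 / t) *\<^sub>R w t))\<^sup>2) =
         w t \<bullet> H (w t) + \<epsilon> * (norm (w t))\<^sup>2"
        unfolding wH wn by (simp only: distrib_left mult.left_commute)
      finally show ?thesis using \<theta>(1) by (simp add: mult_pos_neg)
    qed
    finally show False using \<theta>(3) t(5) by linarith
  qed
  then show False by simp
qed

section \<open>Spans and families of vectors\<close>

lemma in_span_if_orthogonal: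
  fixes a :: "'a::euclidean_space"
  assumes "\<And>v. (\<And>b. b \<in> B \<Longrightarrow> b \<bullet> v = 0) \<Longrightarrow> a \<bullet> v = 0"
  shows "a \<in> span B"
proof -
  obtain y z where yz: "y \<in> span B" "\<And>w. w \<in> span B \<Longrightarrow> orthogonal z w" "a = y + z"
    using orthogonal_subspace_decomp_exists[of B a] by metis
  have "b \<bullet> z = 0" if "b \<in> B" for b
    using yz(2)[OF span_base[OF that]] by (simp add: orthogonal_def inner_commute)
  \<comment> \<open>The component of \<open>a\<close> orthogonal to the span is itself an admissible
    test vector.\<close>
  then have "a \<bullet> z = 0" by (rule assms)
  moreover have "y \<bullet> z = 0" using yz(2)[OF yz(1)] by (simp add: orthogonal_def inner_commute)
  ultimately have "z = 0" using yz(3) by (simp add: inner_add_left)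
  with yz show ?thesis by simp
qed

lemma span_family:
  assumes "finite K" "inj_on G K" "a \<in> span (G ` K)"
  shows "\<exists>c. a = (\<Sum>s\<in>K. c s *\<^sub>R G s)"
proof -
  obtain c where "a = (\<Sum>v\<in>G ` K. c v *\<^sub>R v)"
    using assms(1,3) by (auto simp: span_finite)
  then show ?thesis using assms(2) by (intro exI[of _ "\<lambda>s. c (G s)"]) (simp add: sum.reindex)
qed

text \<open>Independence keeps \<open>G s0\<close> outside the span of the others, so some vector
  orthogonal to these is not orthogonal to it; a change of sign does the rest.\<close>

lemma dual_vector:
  fixes G :: "'k \<Rightarrow> 'a::euclidean_space"
  assumes "inj_on G K" "independent (G ` K)" "s0 \<in> K"
  shows "\<exists>v. (\<forall>s\<in>K - {s0}. G s \<bullet> v = 0) \<and> G s0 \<bullet> v > 0"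
proof -
  have "G s0 \<notin> span (G ` K - {G s0})" using assms(2,3) by (auto simp: dependent_def)
  moreover have "G ` K - {G s0} = G ` (K - {s0})" using assms(1,3) by (auto simp: inj_on_def)
  ultimately have "G s0 \<notin> span (G ` (K - {s0}))" by simp
  then obtain v where v: "\<And>b. b \<in> G ` (K - {s0}) \<Longrightarrow> b \<bullet> v = 0" "G s0 \<bullet> v \<noteq> 0"
    using in_span_if_orthogonal[of "G ` (K - {s0})" "G s0"] by blast
  show ?thesis
  proof (cases "G s0 \<bullet> v > 0")
    case True
    with v show ?thesis by blast
  next
    case False
    with v show ?thesis by (intro exI[of _ "- v"]) auto
  qed
qed

lemma family_dependence:
  fixes G :: "'k \<Rightarrow> 'a::real_vector"
  assumes "finite K" "\<not> (inj_on G K \<and> independent (G ` K))"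
  shows "\<exists>c. (\<exists>s\<in>K. c s \<noteq> 0) \<and> (\<Sum>s\<in>K. c s *\<^sub>R G s) = 0"
proof (cases "inj_on G K")
  case True
  with assms have "dependent (G ` K)" by blast
  then obtain c where c: "\<exists>v\<in>G ` K. c v \<noteq> 0" "(\<Sum>v\<in>G ` K. c v *\<^sub>R v) = 0"
    using assms(1) by (auto simp: dependent_finite)
  then show ?thesis using True by (intro exI[of _ "\<lambda>s. c (G s)"]) (auto simp: sum.reindex)
next
  case False
  then obtain s t where st: "s \<in> K" "t \<in> K" "s \<noteq> t" "G s = G t" by (auto simp: inj_on_def)
  \<comment> \<open>A repeated value gives the dependency with coefficients 1 and -1.\<close>
  define c where "c = (\<lambda>k. (if k = s then 1 else 0) - (if k = t then 1 else 0 :: real))"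
  have "(\<Sum>k\<in>K. c k *\<^sub>R G k) = (\<Sum>k\<in>K. (if k = s then G k else 0) - (if k = t then G k else 0))"
    by (intro sum.cong) (auto simp: c_def)
  also have "\<dots> = 0" using st assms(1) by (simp add: sum_subtractf)
  finally show ?thesis using st by (intro exI[of _ c]) (auto simp: c_def)
qed

section \<open>Necessary optimality conditions\<close>

lemma mpol_gradient_minus: "mpol_gradient (p - q) u = mpol_gradient p u - mpol_gradient q u"
  by (simp add: mpol_gradient_def vec_eq_iff mpol_diff_diff mpol_eval_diff)

lemma mpol_gradient_sum: "mpol_gradient (\<Sum>i\<in>A. p i) u = (\<Sum>i\<in>A. mpol_gradient (p i) u)"
  by (simp add: mpol_gradient_def vec_eq_iff mpol_diff_sum mpol_eval_sum)

lemma mpol_gradient_const_mult: "mpol_gradient (mpol_const c * p) u = c *\<^sub>R mpol_gradient p u"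
  by (simp add: mpol_gradient_def vec_eq_iff mpol_diff_const_mult mpol_eval_mult)

lemma mpol_hessian_minus: "mpol_hessian (p - q) u *v v = mpol_hessian p u *v v - mpol_hessian q u *v v"
  by (simp add: mpol_hessian_def vec_eq_iff mpol_diff_diff mpol_eval_diff matrix_vector_mult_def
      left_diff_distrib sum_subtractf)

lemma mpol_hessian_sum: "mpol_hessian (\<Sum>i\<in>A. p i) u *v v = (\<Sum>i\<in>A. mpol_hessian (p i) u *v v)"
  by (simp add: mpol_hessian_def vec_eq_iff mpol_diff_sum mpol_eval_sum matrix_vector_mult_def sum_distrib_right)
     (subst sum.swap, simp)

lemma mpol_hessian_const_mult: "mpol_hessian (mpol_const c * p) u *v v = c *\<^sub>R (mpol_hessian p u *v v)"
  by (simp add: mpol_hessian_def vec_eq_iff mpol_diff_const_mult mpol_eval_mult matrix_vector_mult_def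
      sum_distrib_left mult.assoc)

definition constr_slots :: "nat \<Rightarrow> nat set \<Rightarrow> slot set" where
  "constr_slots m1 J = Eqn ` {1..m1} \<union> Ineq ` J"

lemma sum_constr_slots:
  assumes "finite J"
  shows "(\<Sum>s\<in>constr_slots m1 J. F s) = (\<Sum>i\<in>{1..m1}. F (Eqn i)) + (\<Sum>j\<in>J. F (Ineq j))"
  unfolding constr_slots_def using assms
  by (subst sum.union_disjoint) (auto simp: sum.reindex inj_on_def)

lemma finite_active_set: "finite (active_set m2 g u)"
  by (simp add: active_set_def)

text \<open>Along the curve the equations hold exactly, active inequalities grow linearly with
  nonnegative slope, and inactive ones stay positive by continuity; hence it is feasible for small
  \<open>t > 0\<close>.\<close>

lemma feasible_curve:
  fixes f :: "('n::finite, real) mpol"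
  assumes cq: "constraint_qualification m1 m2 h g u" and lm: "local_minimizer m1 m2 f h g u"
    and vh: "\<And>i. i \<in> {1..m1} \<Longrightarrow> mpol_gradient (h i) u \<bullet> v = 0"
    and vg: "\<And>j. j \<in> active_set m2 g u \<Longrightarrow> mpol_gradient (g j) u \<bullet> v \<ge> 0"
  shows "\<exists>\<gamma>. \<gamma> 0 = u \<and> (\<gamma> has_vector_derivative v) (at 0) \<and>
    (\<forall>\<^sub>F t in at_right 0. mpol_eval f (($) u) \<le> mpol_eval f (($) (\<gamma> t)) \<and>
      (\<forall>i\<in>{1..m1}. mpol_eval (h i) (($) (\<gamma> t)) = 0) \<and>
      (\<forall>j\<in>active_set m2 g u. mpol_eval (g j) (($) (\<gamma> t)) = t * (mpol_gradient (g j) u \<bullet> v)))"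
proof -
  let ?J = "active_set m2 g u"
  have "inj_on (\<lambda>s. mpol_gradient (case_slot 0 h g s) u) (constr_slots m1 ?J)"
    "independent ((\<lambda>s. mpol_gradient (case_slot 0 h g s) u) ` constr_slots m1 ?J)"
    using cq unfolding constraint_qualification_def Let_def constr_slots_def by blast+
  from curve_along_constraints[OF this, of v] obtain \<gamma> where \<gamma>: "\<gamma> 0 = u" "(\<gamma> has_vector_derivative v) (at 0)"
    and ev: "\<forall>\<^sub>F t in at_right 0. \<forall>s\<in>constr_slots m1 ?J. mpol_eval (case_slot 0 h g s) (($) (\<gamma> t)) =
      mpol_eval (case_slot 0 h g s) (($) u) + t * (mpol_gradient (case_slot 0 h g s) u \<bullet> v)" by blast
  from lm obtain \<epsilon> where u: "u \<in> feasible_set m1 m2 h g" and \<epsilon>: "\<epsilon> > 0"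
    "\<And>x. x \<in> feasible_set m1 m2 h g \<Longrightarrow> x \<in> ball u \<epsilon> \<Longrightarrow> mpol_eval f (($) u) \<le> mpol_eval f (($) x)"
    unfolding local_minimizer_def by blast
  have "isCont \<gamma> 0" using \<gamma>(2) has_vector_derivative_continuous by blast
  then have "(\<gamma> \<longlongrightarrow> u) (at 0)" using \<gamma>(1) by (simp add: isCont_def)
  then have lim: "(\<gamma> \<longlongrightarrow> u) (at_right 0)" by (rule tendsto_within_subset) simp
  then have ball: "\<forall>\<^sub>F t in at_right 0. \<gamma> t \<in> ball u \<epsilon>"
    by (rule topological_tendstoD) (use \<epsilon>(1) in auto)
  have inact: "\<forall>\<^sub>F t in at_right 0. \<forall>j\<in>{1..m2} - ?J. mpol_eval (g j) (($) (\<gamma> t)) > 0"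
  proof (rule eventually_ball_finite, simp, rule ballI)
    fix j assume j: "j \<in> {1..m2} - ?J"
    then have "mpol_eval (g j) (($) u) > 0"
      using u by (force simp: feasible_set_def active_set_def)
    moreover have "((\<lambda>t. mpol_eval (g j) (($) (\<gamma> t))) \<longlongrightarrow> mpol_eval (g j) (($) u)) (at_right 0)"
      by (rule isCont_tendsto_compose[OF has_derivative_continuous[OF has_derivative_mpol_eval] lim])
    ultimately show "\<forall>\<^sub>F t in at_right 0. mpol_eval (g j) (($) (\<gamma> t)) > 0"
      by (rule order_tendstoD(1)[rotated])
  qed
  have pos: "\<forall>\<^sub>F t in at_right 0. (t::real) > 0" by (simp add: eventually_at_right_less)
  have "\<forall>\<^sub>F t in at_right 0. mpol_eval f (($) u) \<le> mpol_eval f (($) (\<gamma> t)) \<and>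
      (\<forall>i\<in>{1..m1}. mpol_eval (h i) (($) (\<gamma> t)) = 0) \<and>
      (\<forall>j\<in>?J. mpol_eval (g j) (($) (\<gamma> t)) = t * (mpol_gradient (g j) u \<bullet> v))"
    using ev ball inact pos
  proof eventually_elim
    case (elim t)
    have H: "mpol_eval (h i) (($) (\<gamma> t)) = 0" if "i \<in> {1..m1}" for i
      using elim(1)[rule_format, of "Eqn i"] vh[OF that] u that by (simp add: constr_slots_def feasible_set_def)
    have G: "mpol_eval (g j) (($) (\<gamma> t)) = t * (mpol_gradient (g j) u \<bullet> v)" if "j \<in> ?J" for j
      using elim(1)[rule_format, of "Ineq j"] that by (simp add: constr_slots_def active_set_def)
    have "mpol_eval (g j) (($) (\<gamma> t)) \<ge> 0" if "j \<in> {1..m2}" for j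
      using elim(3) elim(4) G[of j] vg[of j] that by (cases "j \<in> ?J") (auto intro: less_imp_le)
    then have "\<gamma> t \<in> feasible_set m1 m2 h g" using H unfolding feasible_set_def by blast
    with \<epsilon>(2) elim(2) H G show ?case by blast
  qed
  with \<gamma> show ?thesis by blast
qed

lemma first_order_necessary:
  fixes f :: "('n::finite, real) mpol"
  assumes "constraint_qualification m1 m2 h g u" "local_minimizer m1 m2 f h g u"
    and "\<And>i. i \<in> {1..m1} \<Longrightarrow> mpol_gradient (h i) u \<bullet> v = 0"
    and "\<And>j. j \<in> active_set m2 g u \<Longrightarrow> mpol_gradient (g j) u \<bullet> v \<ge> 0"
  shows "mpol_gradient f u \<bullet> v \<ge> 0"
proof -
  obtain \<gamma> where \<gamma>: "\<gamma> 0 = u" "(\<gamma> has_vector_derivative v) (at 0)"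
    and ev: "\<forall>\<^sub>F t in at_right 0. mpol_eval f (($) u) \<le> mpol_eval f (($) (\<gamma> t)) \<and>
      (\<forall>i\<in>{1..m1}. mpol_eval (h i) (($) (\<gamma> t)) = 0) \<and>
      (\<forall>j\<in>active_set m2 g u. mpol_eval (g j) (($) (\<gamma> t)) = t * (mpol_gradient (g j) u \<bullet> v))"
    using feasible_curve[OF assms] by blast
  have min: "\<forall>\<^sub>F t in at_right 0. mpol_eval f (($) u) \<le> mpol_eval f (($) (\<gamma> t))"
    using ev by (rule eventually_mono) blast
  have "((\<lambda>x. mpol_eval f (($) x)) \<circ> \<gamma> has_derivative ((\<lambda>h. mpol_gradient f u \<bullet> h) \<circ> (\<lambda>t. t *\<^sub>R v))) (at 0)"
    using \<gamma>(1,2) has_derivative_mpol_eval[of f "\<gamma> 0"]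
    by (intro diff_chain_at) (simp_all add: has_vector_derivative_def)
  then have "((\<lambda>t. mpol_eval f (($) (\<gamma> t))) has_real_derivative (mpol_gradient f u \<bullet> v)) (at 0)"
    by (intro has_derivative_imp_has_field_derivative[of _ "\<lambda>t. t * (mpol_gradient f u \<bullet> v)"])
      (simp_all add: comp_def)
  then show ?thesis
    by (rule derivative_nonneg_of_right_minimum) (use \<gamma>(1) min in simp)
qed

text \<open>Independence of the active gradients takes the place of a Farkas argument. On tangent
  vectors both signs are admissible, which puts the objective gradient in the span; moving into the
  feasible side of a single active inequality then gives the sign of its multiplier.\<close>

lemma lagrange_multipliers_exist:
  fixes f :: "('n::finite, real) mpol"
  assumes cq: "constraint_qualification m1 m2 h g u" and lm: "local_minimizer m1 m2 f h g u"
  shows "\<exists>lam mu. lagrange_multipliers m1 m2 f h g u lam mu"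
proof -
  let ?J = "active_set m2 g u" and ?G = "\<lambda>s. mpol_gradient (case_slot 0 h g s) u"
  let ?K = "constr_slots m1 ?J"
  have inj: "inj_on ?G ?K" and ind: "independent (?G ` ?K)"
    using cq unfolding constraint_qualification_def Let_def constr_slots_def by blast+
  have fin: "finite ?K" by (simp add: constr_slots_def finite_active_set)
  have hs: "mpol_gradient (h i) u \<in> ?G ` ?K" if "i \<in> {1..m1}" for i
    using that by (auto simp: constr_slots_def intro!: image_eqI[of _ _ "Eqn i"])
  have gs: "mpol_gradient (g j) u \<in> ?G ` ?K" if "j \<in> ?J" for j
    using that by (auto simp: constr_slots_def intro!: image_eqI[of _ _ "Ineq j"])
  have "mpol_gradient f u \<in> span (?G ` ?K)"
  proof (rule in_span_if_orthogonal)
    fix v assume v: "\<And>b. b \<in> ?G ` ?K \<Longrightarrow> b \<bullet> v = 0"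
    have "mpol_gradient f u \<bullet> v \<ge> 0" "mpol_gradient f u \<bullet> (- v) \<ge> 0"
      using v hs gs by (intro first_order_necessary[OF cq lm]; simp)+
    then show "mpol_gradient f u \<bullet> v = 0" by simp
  qed
  from span_family[OF fin inj this] obtain c where c: "mpol_gradient f u = (\<Sum>s\<in>?K. c s *\<^sub>R ?G s)" by blast
  have nonneg: "c (Ineq j) \<ge> 0" if j: "j \<in> ?J" for j
  proof -
    have jK: "Ineq j \<in> ?K" using j by (simp add: constr_slots_def)
    from dual_vector[OF inj ind this] obtain v where v: "\<And>s. s \<in> ?K - {Ineq j} \<Longrightarrow> ?G s \<bullet> v = 0"
      and v': "?G (Ineq j) \<bullet> v > 0" by blast
    have "mpol_gradient f u \<bullet> v \<ge> 0"
    proof (rule first_order_necessary[OF cq lm])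
      fix i assume "i \<in> {1..m1}"
      then show "mpol_gradient (h i) u \<bullet> v = 0" using v[of "Eqn i"] by (simp add: constr_slots_def)
    next
      fix k assume "k \<in> ?J"
      then show "mpol_gradient (g k) u \<bullet> v \<ge> 0"
        using v[of "Ineq k"] v' by (cases "k = j") (simp_all add: constr_slots_def)
    qed
    also have "mpol_gradient f u \<bullet> v = c (Ineq j) * (?G (Ineq j) \<bullet> v) + (\<Sum>s\<in>?K - {Ineq j}. c s * (?G s \<bullet> v))"
      unfolding c inner_sum_left inner_scaleR_left by (rule sum.remove[OF fin jK])
    also have "(\<Sum>s\<in>?K - {Ineq j}. c s * (?G s \<bullet> v)) = 0" using v by (intro sum.neutral) simp
    finally show ?thesis using v' by (simp add: zero_le_mult_iff)
  qed
  define mu where "mu j = (if j \<in> ?J then c (Ineq j) else 0)" for j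
  have "(\<Sum>j\<in>{1..m2}. mu j *\<^sub>R mpol_gradient (g j) u) = (\<Sum>j\<in>?J. c (Ineq j) *\<^sub>R mpol_gradient (g j) u)"
    unfolding mu_def by (intro sum.mono_neutral_cong_right) (auto simp: active_set_def)
  then have "mpol_gradient f u = (\<Sum>i\<in>{1..m1}. c (Eqn i) *\<^sub>R mpol_gradient (h i) u) + (\<Sum>j\<in>{1..m2}. mu j *\<^sub>R mpol_gradient (g j) u)"
    by (simp add: c sum_constr_slots finite_active_set)
  moreover have "mu j * mpol_eval (g j) (($) u) = 0 \<and> mu j \<ge> 0" for j
    using nonneg by (simp add: mu_def) (simp add: active_set_def)
  ultimately show ?thesis unfolding lagrange_multipliers_def
    by (intro exI[of _ "\<lambda>i. c (Eqn i)"] exI[of _ mu]) blast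
qed

lemma multipliers_inactive:
  "lagrange_multipliers m1 m2 f h g u lam mu \<Longrightarrow> j \<in> {1..m2} \<Longrightarrow> j \<notin> active_set m2 g u \<Longrightarrow> mu j = 0"
  by (auto simp: lagrange_multipliers_def active_set_def)

lemma gradient_as_active_sum:
  assumes "lagrange_multipliers m1 m2 f h g u lam mu"
  shows "mpol_gradient f u = (\<Sum>i\<in>{1..m1}. lam i *\<^sub>R mpol_gradient (h i) u) +
    (\<Sum>j\<in>active_set m2 g u. mu j *\<^sub>R mpol_gradient (g j) u)"
proof -
  have "(\<Sum>j\<in>{1..m2}. mu j *\<^sub>R mpol_gradient (g j) u) = (\<Sum>j\<in>active_set m2 g u. mu j *\<^sub>R mpol_gradient (g j) u)"
    using multipliers_inactive[OF assms] by (intro sum.mono_neutral_right) (auto simp: active_set_def)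
  with assms show ?thesis unfolding lagrange_multipliers_def by simp
qed

text \<open>For tangent \<open>v\<close> the curve keeps all active constraints at 0, so the
  Lagrangian agrees with the objective on it and inherits the minimum. Its gradient at
  \<open>u\<close> vanishes, which makes a curve differentiable at 0 sufficient.\<close>

lemma second_order_necessary:
  fixes f :: "('n::finite, real) mpol"
  assumes cq: "constraint_qualification m1 m2 h g u" and lm: "local_minimizer m1 m2 f h g u"
    and mult: "lagrange_multipliers m1 m2 f h g u lam mu"
    and vh: "\<And>i. i \<in> {1..m1} \<Longrightarrow> mpol_gradient (h i) u \<bullet> v = 0"
    and vg: "\<And>j. j \<in> active_set m2 g u \<Longrightarrow> mpol_gradient (g j) u \<bullet> v = 0"
  shows "0 \<le> v \<bullet> (mpol_hessian (lagrangian m1 (active_set m2 g u) f h g lam mu) u *v v)"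
proof -
  let ?J = "active_set m2 g u"
  let ?L = "lagrangian m1 ?J f h g lam mu"
  have "\<And>j. j \<in> ?J \<Longrightarrow> mpol_gradient (g j) u \<bullet> v \<ge> 0" using vg by simp
  from feasible_curve[OF cq lm vh this] obtain \<gamma> where \<gamma>: "\<gamma> 0 = u" "(\<gamma> has_vector_derivative v) (at 0)"
    and ev: "\<forall>\<^sub>F t in at_right 0. mpol_eval f (($) u) \<le> mpol_eval f (($) (\<gamma> t)) \<and>
      (\<forall>i\<in>{1..m1}. mpol_eval (h i) (($) (\<gamma> t)) = 0) \<and>
      (\<forall>j\<in>?J. mpol_eval (g j) (($) (\<gamma> t)) = t * (mpol_gradient (g j) u \<bullet> v))" by blast
  have L: "mpol_eval ?L (($) x) = mpol_eval f (($) x)"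
    if "\<forall>i\<in>{1..m1}. mpol_eval (h i) (($) x) = 0" "\<forall>j\<in>?J. mpol_eval (g j) (($) x) = 0" for x
    using that by (simp add: lagrangian_def mpol_eval_diff mpol_eval_sum mpol_eval_mult)
  have Lu: "mpol_eval ?L (($) u) = mpol_eval f (($) u)"
    using lm by (intro L) (auto simp: local_minimizer_def feasible_set_def active_set_def)
  have "\<forall>\<^sub>F t in at_right 0. mpol_eval ?L (($) u) \<le> mpol_eval ?L (($) (\<gamma> t))"
    using ev by eventually_elim (simp add: L Lu vg)
  moreover have "mpol_gradient ?L u = 0"
    by (simp add: lagrangian_def mpol_gradient_minus mpol_gradient_sum mpol_gradient_const_mult gradient_as_active_sum[OF mult])
  ultimately show ?thesis
    using second_order_necessary_along_curve[OF has_derivative_mpol_eval has_derivative_mpol_gradient _ \<gamma>] by blast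
qed

section \<open>Degenerate directions of semidefinite forms\<close>

lemma quadratic_nonneg_linear_zero:
  fixes b c :: real
  assumes "\<And>s. 0 \<le> 2 * s * b + s\<^sup>2 * c" "c \<ge> 0"
  shows "b = 0"
proof (rule ccontr)
  assume "b \<noteq> 0"
  \<comment> \<open>Any small positive \<open>e\<close> with \<open>e * c < 2\<close> makes the
    value at \<open>s = - b * e\<close> negative; this choice also covers
    \<open>c = 0\<close>.\<close>
  define e where "e = 1 / (c + 1)"
  have e: "e > 0" "e * c < 1" using assms(2) by (simp_all add: e_def)
  have "2 * (- b * e) * b + (- b * e)\<^sup>2 * c = (b\<^sup>2 * e) * (e * c - 2)"
    by (simp add: power2_eq_square algebra_simps)
  also have "\<dots> < 0" using \<open>b \<noteq> 0\<close> e by (intro mult_pos_neg) simp_all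
  finally show False using assms(1)[of "- b * e"] by linarith
qed

text \<open>A degenerate direction minimizes the quadratic form on the tangent space, so its image
  under the Hessian is orthogonal to the tangent space.\<close>

lemma degenerate_direction_in_span:
  fixes H :: "real^'n^'n"
  assumes sym: "transpose H = H" and psd: "\<And>w. (\<And>b. b \<in> B \<Longrightarrow> b \<bullet> w = 0) \<Longrightarrow> 0 \<le> w \<bullet> (H *v w)"
    and v: "\<And>b. b \<in> B \<Longrightarrow> b \<bullet> v = 0" and "v \<bullet> (H *v v) = 0"
  shows "H *v v \<in> span B"
proof (rule in_span_if_orthogonal)
  fix w assume w: "\<And>b. b \<in> B \<Longrightarrow> b \<bullet> w = 0"
  have vw: "v \<bullet> (H *v w) = w \<bullet> (H *v v)"
    using sym by (metis dot_lmul_matrix inner_commute transpose_matrix_vector)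
  have "w \<bullet> (H *v v) = 0"
  proof (rule quadratic_nonneg_linear_zero)
    fix s :: real
    have "0 \<le> (v + s *\<^sub>R w) \<bullet> (H *v (v + s *\<^sub>R w))"
      using v w by (intro psd) (simp add: inner_add_right)
    also have "\<dots> = 2 * s * (w \<bullet> (H *v v)) + s\<^sup>2 * (w \<bullet> (H *v w))"
      using assms(4) vw by (simp add: matrix_vector_right_distrib matrix_vector_mult_scaleR inner_add_left inner_add_right
          algebra_simps power2_eq_square)
    finally show "0 \<le> 2 * s * (w \<bullet> (H *v v)) + s\<^sup>2 * (w \<bullet> (H *v w))" .
  qed (use psd[OF w] in simp)
  then show "(H *v v) \<bullet> w = 0" by (simp add: inner_commute)
qed

section \<open>The point (1, u) on the excluded varieties\<close>

definition affine_point :: "real^'n \<Rightarrow> complex^('n::finite option)" where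
  "affine_point u = (\<chi> i. case i of None \<Rightarrow> 1 | Some i \<Rightarrow> complex_of_real (u $ i))"

lemma affine_point_simps [simp]:
  "affine_point u $ None = 1" "affine_point u $ Some i = complex_of_real (u $ i)"
  by (simp_all add: affine_point_def)

lemma affine_point_nonzero: "affine_point u \<noteq> 0"
  using affine_point_simps(1)[of u] by (metis zero_index zero_neq_one)

text \<open>At x_0 = 1 homogenization gives back the polynomial and its derivatives in x_1, ...,
  x_n. The remaining derivative, in x_0, follows from Euler's identity at a zero of the
  polynomial.\<close>

lemma form_affine_point:
  fixes u :: "real^'n::finite"
  assumes "inputs_at dg ss p" "s \<in> set ss"
  defines "x \<equiv> updz (assignment p) (affine_point u)"
  shows "form_val dg x s = complex_of_real (mpol_eval (p s) (($) u))"
    "form_grad dg x s (Some i) = complex_of_real (mpol_gradient (p s) u $ i)"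
    "mpol_eval (p s) (($) u) = 0 \<Longrightarrow> form_grad dg x s None = - (\<Sum>i\<in>UNIV. complex_of_real (u $ i) * form_grad dg x s (Some i))"
proof -
  note E = ceval_hom_at_updz[OF assms(1,2), where z = "affine_point u", folded x_def]
  note H = mpol_eval_homogenize[of "($) (affine_point u)" "($) u", simplified]
  show form_val: "form_val dg x s = complex_of_real (mpol_eval (p s) (($) u))"
    using E(1) by (simp add: ceval_def hom_at_def H)
  show "form_grad dg x s (Some i) = complex_of_real (mpol_gradient (p s) u $ i)"
    using E(3)[of i] by (simp add: x_gradient_def ceval_def hom_at_def mpol_diff_homogenize H mpol_gradient_def)
  assume "mpol_eval (p s) (($) u) = 0"
  then have "mpol_eval (gform dg s x) (\<lambda>i. x (Zv i)) = 0" using form_val by (simp add: form_val_def)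
  then have "(\<Sum>v\<in>UNIV. x (Zv v) * form_grad dg x s v) = 0"
    using euler_homogeneous[OF shifted_form_gform, of "\<lambda>i. x (Zv i)" dg s x] by (simp add: form_grad_def)
  then show "form_grad dg x s None = - (\<Sum>i\<in>UNIV. complex_of_real (u $ i) * form_grad dg x s (Some i))"
    by (simp add: UNIV_option_sum x_def add_eq_0_iff2)
qed

lemma form_affine_point_direction:
  fixes u v :: "real^'n::finite"
  assumes "inputs_at dg ss p" "s \<in> set ss"
  defines "x \<equiv> updy (updz (assignment p) (affine_point u)) (\<chi> i. complex_of_real (v $ i))"
  shows "form_val dg x s = complex_of_real (mpol_eval (p s) (($) u))"
    "form_grad dg x s (Some i) = complex_of_real (mpol_gradient (p s) u $ i)"
    "form_hess dg x s i = complex_of_real ((mpol_hessian (p s) u *v v) $ i)"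
proof -
  note E = ceval_hom_at_updy[OF assms(1,2), where z = "affine_point u" and y = "\<chi> i. complex_of_real (v $ i)", folded x_def]
  note H = mpol_eval_homogenize[of "($) (affine_point u)" "($) u", simplified]
  show "form_val dg x s = complex_of_real (mpol_eval (p s) (($) u))"
    using E(1) by (simp add: ceval_def hom_at_def H)
  show "form_grad dg x s (Some i) = complex_of_real (mpol_gradient (p s) u $ i)"
    using E(2)[of i] by (simp add: x_gradient_def ceval_def hom_at_def mpol_diff_homogenize H mpol_gradient_def)
  show "form_hess dg x s i = complex_of_real ((mpol_hessian (p s) u *v v) $ i)"
    using E(3)[of i]
    by (simp add: x_hessian_def ceval_def hom_at_def mpol_diff_homogenize H mpol_hessian_def matrix_vector_mult_def)
qed

lemma sum_nth_distinct: "distinct ss \<Longrightarrow> (\<Sum>j\<in>{..<length ss}. F (ss ! j)) = (\<Sum>s\<in>set ss. F s)"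
  by (rule sum.reindex_bij_betw[OF bij_betw_nth]) auto

text \<open>The shape shared by the dependencies for \<open>R_condition\<close> and
  \<open>D_condition\<close>: the objective with coefficient 1 minus a combination of
  constraints.\<close>

lemma sum_nth_Cons_distinct:
  fixes F :: "'s \<Rightarrow> complex"
  assumes "distinct ss"
  shows "(\<Sum>j\<in>{..<Suc (length ss)}. F ((s0 # ss) ! j) * (case j of 0 \<Rightarrow> 1 | Suc i \<Rightarrow> - C (ss ! i))) =
    F s0 - (\<Sum>s\<in>set ss. F s * C s)"
  unfolding sum.lessThan_Suc_shift using sum_nth_distinct[OF assms, of "\<lambda>s. F s * C s"]
  by (simp add: sum_negf)

lemma sum_lessThan_add: "(\<Sum>j\<in>{..<m + n}. F j) = (\<Sum>j\<in>{..<m}. F j) + (\<Sum>j\<in>{..<n}. F (m + j))"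
  for F :: "nat \<Rightarrow> 'a::comm_monoid_add"
  by (induction n) (auto simp: add.assoc)

text \<open>At common zeros the x_0 row of the gradient matrix is minus the combination of the other
  rows with weights \<open>u\<close>, so a dependency of the affine gradients annihilates it
  too.\<close>

lemma disc_conditionI:
  assumes inp: "inputs_at dg ss p" and ss: "distinct ss" and zero: "\<And>s. s \<in> set ss \<Longrightarrow> mpol_eval (p s) (($) u) = 0"
    and c: "\<exists>s\<in>set ss. c s \<noteq> 0" "(\<Sum>s\<in>set ss. c s *\<^sub>R mpol_gradient (p s) u) = 0"
  shows "disc_condition (map (hom_at dg p) ss)"
proof -
  define x where "x = updz (assignment p) (affine_point u)"
  note E = form_affine_point[OF inp, of _ u, folded x_def]
  have S: "(\<Sum>s\<in>set ss. form_grad dg x s (Some i) * complex_of_real (c s)) = 0" for i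
  proof -
    have "(\<Sum>s\<in>set ss. form_grad dg x s (Some i) * complex_of_real (c s)) =
        complex_of_real ((\<Sum>s\<in>set ss. c s *\<^sub>R mpol_gradient (p s) u) $ i)"
      using E(2) by (simp add: mult.commute)
    then show ?thesis using c(2) by simp
  qed
  have N: "(\<Sum>s\<in>set ss. form_grad dg x s None * complex_of_real (c s)) = 0"
  proof -
    have "(\<Sum>s\<in>set ss. form_grad dg x s None * complex_of_real (c s)) =
        (\<Sum>s\<in>set ss. - (\<Sum>i\<in>UNIV. complex_of_real (u $ i) * (form_grad dg x s (Some i) * complex_of_real (c s))))"
      using E(3) zero by (intro sum.cong) (simp_all add: sum_distrib_right mult.assoc)
    also have "\<dots> = - (\<Sum>i\<in>UNIV. complex_of_real (u $ i) * (\<Sum>s\<in>set ss. form_grad dg x s (Some i) * complex_of_real (c s)))"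
      unfolding sum_negf sum_distrib_left by (subst sum.swap) simp
    finally show ?thesis using S by simp
  qed
  have "dependent_columns (\<lambda>r j. form_grad dg x (ss ! j) r) (length ss)"
    unfolding dependent_columns_def
  proof (intro exI[of _ "\<lambda>j. complex_of_real (c (ss ! j))"] conjI ballI)
    show "\<exists>j\<in>{..<length ss}. complex_of_real (c (ss ! j)) \<noteq> 0" using c(1) by (auto simp: in_set_conv_nth)
    fix r :: "'a option"
    show "(\<Sum>j\<in>{..<length ss}. form_grad dg x (ss ! j) r * complex_of_real (c (ss ! j))) = 0"
      using sum_nth_distinct[OF ss, of "\<lambda>s. form_grad dg x s r * complex_of_real (c s)"] S N by (cases r) auto
  qed
  moreover have "Res_x dg ss x" using E(1) zero by (simp add: Res_x_def)
  ultimately have "Disc_x dg ss (updz (assignment p) (affine_point u))" by (simp add: Disc_x_def x_def)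
  then show ?thesis using disc_condition_iff[OF inp] affine_point_nonzero by blast
qed

lemma R_conditionI:
  assumes inp: "inputs_at dg (s0 # ss @ [t]) p" and ss: "distinct ss"
    and zero: "\<And>s. s \<in> set (ss @ [t]) \<Longrightarrow> mpol_eval (p s) (($) u) = 0"
    and c: "mpol_gradient (p s0) u = (\<Sum>s\<in>set ss. c s *\<^sub>R mpol_gradient (p s) u)"
  shows "R_condition (hom_at dg p s0) (map (hom_at dg p) ss) (hom_at dg p t)"
proof -
  define x where "x = updz (assignment p) (affine_point u)"
  note E = form_affine_point[OF inp, of _ u, folded x_def]
  let ?c = "\<lambda>j. case j of 0 \<Rightarrow> 1 | Suc i \<Rightarrow> - complex_of_real (c (ss ! i))"
  have "dependent_columns (\<lambda>r j. form_grad dg x ((s0 # ss) ! j) (Some r)) (Suc (length ss))"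
    unfolding dependent_columns_def
  proof (intro exI[of _ ?c] conjI ballI)
    show "\<exists>j\<in>{..<Suc (length ss)}. ?c j \<noteq> 0" by (rule bexI[of _ 0]) simp_all
    fix r
    have "(\<Sum>j\<in>{..<Suc (length ss)}. form_grad dg x ((s0 # ss) ! j) (Some r) * ?c j) =
        form_grad dg x s0 (Some r) - (\<Sum>s\<in>set ss. form_grad dg x s (Some r) * complex_of_real (c s))"
      by (rule sum_nth_Cons_distinct[OF ss])
    also have "\<dots> = complex_of_real ((mpol_gradient (p s0) u - (\<Sum>s\<in>set ss. c s *\<^sub>R mpol_gradient (p s) u)) $ r)"
      using E(2) by (simp add: mult.commute)
    also have "\<dots> = 0" using c by simp
    finally show "(\<Sum>j\<in>{..<Suc (length ss)}. form_grad dg x ((s0 # ss) ! j) (Some r) * ?c j) = 0" .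
  qed
  moreover have "Res_x dg ss x" "form_val dg x t = 0" using E(1) zero by (simp_all add: Res_x_def)
  ultimately have "R_x dg s0 ss t (updz (assignment p) (affine_point u))" by (simp add: R_x_def x_def)
  then show ?thesis using R_condition_iff[OF inp] affine_point_nonzero by blast
qed

text \<open>The dependency has coefficient 1 on the objective column, \<open>- c\<close> on the
  constraint columns and \<open>- b\<close> on the pure gradient columns. Its upper block is the
  stationarity equation \<open>c\<close>, its lower block the equation \<open>b\<close>.\<close>

lemma D_conditionI:
  fixes p :: "slot \<Rightarrow> ('n::finite, real) mpol"
  assumes inp: "inputs_at dg (s0 # ss) p" and ss: "distinct ss"
    and zero: "\<And>s. s \<in> set ss \<Longrightarrow> mpol_eval (p s) (($) u) = 0"
    and orth: "\<And>s. s \<in> set ss \<Longrightarrow> mpol_gradient (p s) u \<bullet> v = 0" and v: "v \<noteq> 0"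
    and c: "mpol_gradient (p s0) u = (\<Sum>s\<in>set ss. c s *\<^sub>R mpol_gradient (p s) u)"
    and b: "mpol_hessian (p s0) u *v v - (\<Sum>s\<in>set ss. c s *\<^sub>R (mpol_hessian (p s) u *v v)) =
      (\<Sum>s\<in>set ss. b s *\<^sub>R mpol_gradient (p s) u)"
  shows "D_condition (hom_at dg p s0) (map (hom_at dg p) ss)"
proof -
  define y where "y = (\<chi> i. complex_of_real (v $ i))"
  define x where "x = updy (updz (assignment p) (affine_point u)) y"
  note E = form_affine_point_direction[OF inp, of _ u v, folded y_def, folded x_def]
  let ?k = "length ss"
  define a where "a j = (if j \<le> ?k then (case j of 0 \<Rightarrow> 1 | Suc i \<Rightarrow> - complex_of_real (c (ss ! i)))
    else - complex_of_real (b (ss ! (j - Suc ?k))))" for j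
  have "dependent_columns (D_matrix dg s0 ss x) (Suc (2 * ?k))"
    unfolding dependent_columns_def
  proof (intro exI[of _ a] conjI ballI)
    show "\<exists>j\<in>{..<Suc (2 * ?k)}. a j \<noteq> 0" by (rule bexI[of _ 0]) (simp_all add: a_def)
    fix r :: "'n + 'n"
    have "(\<Sum>j\<in>{..<Suc (2 * ?k)}. D_matrix dg s0 ss x r j * a j) =
        (\<Sum>j\<in>{..<Suc ?k}. D_matrix dg s0 ss x r j * a j) + (\<Sum>j\<in>{..<?k}. D_matrix dg s0 ss x r (Suc ?k + j) * a (Suc ?k + j))"
      using sum_lessThan_add[of _ "Suc ?k" ?k] by (simp add: mult_2 del: sum.lessThan_Suc)
    also have "\<dots> = 0"
    proof (cases r)
      case (Inl i)
      have "(\<Sum>j\<in>{..<Suc ?k}. D_matrix dg s0 ss x r j * a j) =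
          (\<Sum>j\<in>{..<Suc ?k}. form_grad dg x ((s0 # ss) ! j) (Some i) * (case j of 0 \<Rightarrow> 1 | Suc i \<Rightarrow> - complex_of_real (c (ss ! i))))"
        by (intro sum.cong) (simp_all add: Inl D_matrix_def a_def)
      also have "\<dots> = form_grad dg x s0 (Some i) - (\<Sum>s\<in>set ss. form_grad dg x s (Some i) * complex_of_real (c s))"
        by (rule sum_nth_Cons_distinct[OF ss])
      also have "\<dots> = complex_of_real ((mpol_gradient (p s0) u - (\<Sum>s\<in>set ss. c s *\<^sub>R mpol_gradient (p s) u)) $ i)"
        using E(2) by (simp add: mult.commute)
      also have "\<dots> = 0" using c by simp
      finally show ?thesis by (simp add: Inl D_matrix_def)
    next
      case (Inr i)
      have "(\<Sum>j\<in>{..<Suc ?k}. D_matrix dg s0 ss x r j * a j) =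
          (\<Sum>j\<in>{..<Suc ?k}. form_hess dg x ((s0 # ss) ! j) i * (case j of 0 \<Rightarrow> 1 | Suc i \<Rightarrow> - complex_of_real (c (ss ! i))))"
        by (intro sum.cong) (simp_all add: Inr D_matrix_def a_def)
      also have "\<dots> = form_hess dg x s0 i - (\<Sum>s\<in>set ss. form_hess dg x s i * complex_of_real (c s))"
        by (rule sum_nth_Cons_distinct[OF ss])
      also have "\<dots> = complex_of_real ((mpol_hessian (p s0) u *v v - (\<Sum>s\<in>set ss. c s *\<^sub>R (mpol_hessian (p s) u *v v))) $ i)"
        using E(3) by (simp add: mult.commute)
      also have "\<dots> = complex_of_real ((\<Sum>s\<in>set ss. b s *\<^sub>R mpol_gradient (p s) u) $ i)"
        using b by simp
      finally have 1: "(\<Sum>j\<in>{..<Suc ?k}. D_matrix dg s0 ss x r j * a j) =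
          complex_of_real ((\<Sum>s\<in>set ss. b s *\<^sub>R mpol_gradient (p s) u) $ i)" .
      have "(\<Sum>j\<in>{..<?k}. D_matrix dg s0 ss x r (Suc ?k + j) * a (Suc ?k + j)) =
          (\<Sum>j\<in>{..<?k}. - (form_grad dg x (ss ! j) (Some i) * complex_of_real (b (ss ! j))))"
        by (intro sum.cong) (simp_all add: Inr D_matrix_def a_def)
      also have "\<dots> = - (\<Sum>s\<in>set ss. form_grad dg x s (Some i) * complex_of_real (b s))"
        using sum_nth_distinct[OF ss, of "\<lambda>s. form_grad dg x s (Some i) * complex_of_real (b s)"] by (simp add: sum_negf)
      also have "\<dots> = - complex_of_real ((\<Sum>s\<in>set ss. b s *\<^sub>R mpol_gradient (p s) u) $ i)"
        using E(2) by (simp add: mult.commute)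
      finally show ?thesis using 1 by simp
    qed
    finally show "(\<Sum>j\<in>{..<Suc (2 * ?k)}. D_matrix dg s0 ss x r j * a j) = 0" .
  qed
  moreover have "form_val dg x s = 0 \<and> (\<Sum>i\<in>UNIV. form_grad dg x s (Some i) * x (Yv i)) = 0" if s: "s \<in> set ss" for s
  proof
    show "form_val dg x s = 0" using E(1)[of s] zero[OF s] s by simp
    have "(\<Sum>i\<in>UNIV. form_grad dg x s (Some i) * x (Yv i)) = complex_of_real (mpol_gradient (p s) u \<bullet> v)"
      using E(2)[of s] s by (simp add: inner_vec_def x_def y_def)
    then show "(\<Sum>i\<in>UNIV. form_grad dg x s (Some i) * x (Yv i)) = 0" using orth[OF s] by simp
  qed
  ultimately have "D_x dg s0 ss (updy (updz (assignment p) (affine_point u)) y)" unfolding D_x_def x_def by blast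
  moreover have "y \<noteq> 0" using v by (auto simp: y_def vec_eq_iff)
  ultimately show ?thesis using D_condition_iff[OF inp] affine_point_nonzero by blast
qed

lemma not_R_condition:
  assumes "is_R dg s0 ss t \<phi>" "inputs_at dg (s0 # ss @ [t]) p" "coeff_eval \<phi> p \<noteq> 0"
  shows "\<not> R_condition (hom_at dg p s0) (map (hom_at dg p) ss) (hom_at dg p t)"
  using assms unfolding is_R_def elimination_polys_def by (metis coeff_eval_sum_squares)

lemma not_D_condition:
  assumes "is_D dg s0 ss \<phi>" "inputs_at dg (s0 # ss) p" "coeff_eval \<phi> p \<noteq> 0"
  shows "\<not> D_condition (hom_at dg p s0) (map (hom_at dg p) ss)"
  using assms unfolding is_D_def elimination_polys_def by (metis coeff_eval_sum_squares)

section \<open>Genericity implies the optimality conditions\<close>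

definition active_tuple :: "nat \<Rightarrow> nat set \<Rightarrow> slot list" where
  "active_tuple m1 J = map Eqn [1..<Suc m1] @ map Ineq (sorted_list_of_set J)"

lemma set_active_tuple: "finite J \<Longrightarrow> set (active_tuple m1 J) = constr_slots m1 J"
  by (simp add: active_tuple_def constr_slots_def atLeastLessThanSuc_atLeastAtMost del: upt_Suc)

lemma distinct_active_tuple: "distinct (active_tuple m1 J)"
  by (auto simp: active_tuple_def distinct_map inj_on_def simp del: upt_Suc)

lemma active_tuple_in_constr_tuples:
  assumes "J \<subseteq> {1..m2}" shows "active_tuple m1 J \<in> constr_tuples m1 m2 (card J)"
proof -
  have "finite J" using assms by (rule finite_subset) simp
  then show ?thesis using assms unfolding constr_tuples_def active_tuple_def
    by (intro CollectI exI[of _ "sorted_list_of_set J"]) (simp add: strict_sorted_list_of_set)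
qed

lemma genericity_implies_optimality_conditions:
  fixes f :: "('n::finite, real) mpol"
  assumes m1: "m1 \<le> CARD('n)"
    and gen: "genericity_list (case_slot d0 d d') m1 m2 \<Phi>"
    and deg: "f \<in> polys_deg_le d0" "\<forall>i\<in>{1..m1}. h i \<in> polys_deg_le (d i)" "\<forall>j\<in>{1..m2}. g j \<in> polys_deg_le (d' j)"
    and nz: "\<forall>\<phi>\<in>\<Phi>. coeff_eval \<phi> (case_slot f h g) \<noteq> 0"
    and lm: "local_minimizer m1 m2 f h g u"
  shows "constraint_qualification m1 m2 h g u \<and> (\<exists>lam mu. lagrange_multipliers m1 m2 f h g u lam mu \<and>
     strict_complementarity m2 g u mu \<and> second_order_sufficiency m1 m2 f h g u lam mu)"
proof -
  let ?n = "CARD('n)" and ?dg = "case_slot d0 d d'" and ?p = "case_slot f h g"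
  define J where "J = active_set m2 g u"
  define K where "K = constr_slots m1 J"
  define ss where "ss = active_tuple m1 J"
  let ?G = "\<lambda>s. mpol_gradient (?p s) u"
  obtain A B C D where
    A: "\<And>ts. ts \<in> tuples_a ?n m1 m2 \<Longrightarrow> is_Res ?dg ts (A ts)" and
    B: "\<And>ts. ts \<in> tuples_b ?n m1 m2 \<Longrightarrow> is_Disc ?dg ts (B ts)" and
    C: "\<And>ts. ts \<in> tuples_c ?n m1 m2 \<Longrightarrow> is_R ?dg Obj (butlast ts) (last ts) (C ts)" and
    D: "\<And>ts. ts \<in> tuples_d ?n m1 m2 \<Longrightarrow> is_D ?dg Obj ts (D ts)" and
    \<Phi>: "\<Phi> = A ` tuples_a ?n m1 m2 \<union> B ` tuples_b ?n m1 m2 \<union> C ` tuples_c ?n m1 m2 \<union> D ` tuples_d ?n m1 m2"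
    using gen unfolding genericity_list_def Let_def by blast
  have inp: "inputs_at ?dg ts ?p" if "set ts \<subseteq> insert Obj (constr_slots m1 {1..m2})" for ts
    unfolding inputs_at_def
  proof
    fix s assume "s \<in> set ts"
    with that have "s \<in> insert Obj (constr_slots m1 {1..m2})" by blast
    then show "?p s \<in> polys_deg_le (?dg s)" using deg by (auto simp: constr_slots_def)
  qed
  have J: "J \<subseteq> {1..m2}" "finite J" by (auto simp: J_def active_set_def)
  have ssK: "set ss = K" by (simp add: ss_def K_def set_active_tuple J)
  have Ksub: "K \<subseteq> constr_slots m1 {1..m2}" using J by (auto simp: K_def constr_slots_def)
  have dist: "distinct ss" by (simp add: ss_def distinct_active_tuple)
  have Obj: "Obj \<notin> K" by (auto simp: K_def constr_slots_def)
  have zero: "mpol_eval (?p s) (($) u) = 0" if "s \<in> K" for s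
    using that lm by (auto simp: K_def constr_slots_def J_def active_set_def local_minimizer_def feasible_set_def)
  have G0: "mpol_gradient (case_slot 0 h g s) u = ?G s" if "s \<in> K" for s
    using that by (auto simp: K_def constr_slots_def)
  have "card J \<le> ?n - m1"
  proof (rule ccontr)
    assume "\<not> card J \<le> ?n - m1"
    then have c: "?n - m1 + 1 \<le> card J" by simp
    \<comment> \<open>This number of inequalities brings the tuple to exactly n + 1 forms in n + 1
      variables, an entry of the resultant family.\<close>
    then obtain J' where J': "J' \<subseteq> J" "card J' = ?n - m1 + 1" by (meson obtain_subset_with_card_n)
    have fJ': "finite J'" using J J' finite_subset by blast
    have "card J \<le> m2" using card_mono[OF _ J(1)] by simp
    with c m1 have ge: "m1 + m2 \<ge> ?n + 1" by linarith
    define ts where "ts = active_tuple m1 J'"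
    have "J' \<subseteq> {1..m2}" using J J' by blast
    from active_tuple_in_constr_tuples[OF this, of m1] have ta: "ts \<in> tuples_a ?n m1 m2"
      using J'(2) ge by (simp add: tuples_a_def ts_def)
    have sub: "set ts \<subseteq> K" using J' by (auto simp: ts_def set_active_tuple[OF fJ'] K_def constr_slots_def)
    have in_ts: "inputs_at ?dg ts ?p" using sub Ksub by (intro inp) blast
    have "Res_x ?dg ts (updz (assignment ?p) (affine_point u))"
      using form_affine_point(1)[OF in_ts] zero sub by (auto simp: Res_x_def)
    then have "res_condition (map (hom_at ?dg ?p) ts)"
      using res_condition_iff[OF in_ts] affine_point_nonzero by blast
    then have "coeff_eval (A ts) ?p = 0" using A[OF ta] in_ts unfolding is_Res_def by blast
    then show False using nz ta \<Phi> by blast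
  qed
  then have td: "ss \<in> tuples_d ?n m1 m2"
    using active_tuple_in_constr_tuples[OF J(1), of m1] by (auto simp: tuples_d_def ss_def)
  then have tb: "ss \<in> tuples_b ?n m1 m2" if "K \<noteq> {}" using that ssK by (auto simp: tuples_b_def)
  have in_ss: "inputs_at ?dg ss ?p" using ssK Ksub by (intro inp) blast
  have fK: "finite K" using ssK by (metis List.finite_set)
  have "inj_on ?G K \<and> independent (?G ` K)"
  proof (rule ccontr)
    assume "\<not> (inj_on ?G K \<and> independent (?G ` K))"
    from family_dependence[OF fK this] obtain c where c: "\<exists>s\<in>K. c s \<noteq> 0" "(\<Sum>s\<in>K. c s *\<^sub>R ?G s) = 0" by blast
    \<comment> \<open>The empty tuple has no discriminant in the list, but it has no dependency
      either.\<close>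
    then have "K \<noteq> {}" by blast
    have "disc_condition (map (hom_at ?dg ?p) ss)"
      using c zero ssK by (intro disc_conditionI[OF in_ss dist, of u c]) simp_all
    then have "coeff_eval (B ss) ?p = 0" using B[OF tb[OF \<open>K \<noteq> {}\<close>]] in_ss unfolding is_Disc_def by blast
    then show False using nz tb[OF \<open>K \<noteq> {}\<close>] \<Phi> by blast
  qed
  then have ind: "inj_on ?G K" "independent (?G ` K)" by blast+
  have cq: "constraint_qualification m1 m2 h g u"
    using ind inj_on_cong[of K "\<lambda>s. mpol_gradient (case_slot 0 h g s) u" ?G, OF G0]
      image_cong[of K K "\<lambda>s. mpol_gradient (case_slot 0 h g s) u" ?G, OF refl G0]
    unfolding constraint_qualification_def Let_def K_def constr_slots_def J_def by simp
  obtain lam mu where mult: "lagrange_multipliers m1 m2 f h g u lam mu"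
    using lagrange_multipliers_exist[OF cq lm] by blast
  \<comment> \<open>\<open>Obj\<close> is not a constraint slot; its value 0 is a
    placeholder.\<close>
  define c where "c s = (case s of Obj \<Rightarrow> 0 | Eqn i \<Rightarrow> lam i | Ineq j \<Rightarrow> mu j)" for s
  have grad: "mpol_gradient f u = (\<Sum>s\<in>K. c s *\<^sub>R ?G s)"
    using gradient_as_active_sum[OF mult] by (simp add: K_def sum_constr_slots J c_def flip: J_def)
  have pos: "mu j > 0" if j: "j \<in> J" for j
  proof (rule ccontr)
    assume "\<not> mu j > 0"
    moreover have "mu j \<ge> 0" using mult j J by (auto simp: lagrange_multipliers_def)
    ultimately have mu0: "mu j = 0" by simp
    let ?t = "Ineq j"
    have tK: "?t \<in> K" using j by (simp add: K_def constr_slots_def)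
    \<comment> \<open>The inequality with vanishing multiplier goes to the end of the tuple:
      \<open>u\<close> is a zero of it, while its gradient drops out of the combination. This is why
      the third family runs over all re-orderings.\<close>
    define ts where "ts = remove1 ?t ss"
    have set_ts: "set ts = K - {?t}" using dist ssK by (simp add: ts_def set_remove1_eq)
    have dts: "distinct ts" using dist by (simp add: ts_def)
    have "mset (ts @ [?t]) = mset ss" using tK ssK by (simp add: ts_def)
    then have tc: "ts @ [?t] \<in> tuples_c ?n m1 m2" using tb tK by (auto simp: tuples_c_def)
    have in_ts: "inputs_at ?dg (Obj # ts @ [?t]) ?p" using set_ts tK Ksub by (intro inp) auto
    have "mpol_gradient (?p Obj) u = (\<Sum>s\<in>set ts. c s *\<^sub>R ?G s)"
      using grad tK fK mu0 by (simp add: set_ts sum.remove c_def)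
    then have "R_condition (hom_at ?dg ?p Obj) (map (hom_at ?dg ?p) ts) (hom_at ?dg ?p ?t)"
      using zero tK by (intro R_conditionI[OF in_ts dts, of u c]) (auto simp: set_ts)
    moreover have "is_R ?dg Obj ts ?t (C (ts @ [?t]))" using C[OF tc] by simp
    moreover have "coeff_eval (C (ts @ [?t])) ?p \<noteq> 0" using nz tc \<Phi> by blast
    ultimately show False using not_R_condition in_ts by blast
  qed
  have strict: "strict_complementarity m2 g u mu"
    unfolding strict_complementarity_def
  proof
    fix j assume j: "j \<in> {1..m2}"
    show "mu j + mpol_eval (g j) (($) u) > 0"
    proof (cases "j \<in> J")
      case True
      then have "mpol_eval (g j) (($) u) = 0" by (simp add: J_def active_set_def)
      with pos[OF True] show ?thesis by simp
    next
      case False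
      have "mpol_eval (g j) (($) u) \<ge> 0" using lm j by (auto simp: local_minimizer_def feasible_set_def)
      moreover have "mpol_eval (g j) (($) u) \<noteq> 0" using False j by (simp add: J_def active_set_def)
      moreover have "mu j = 0" using multipliers_inactive[OF mult j] False by (simp add: J_def)
      ultimately show ?thesis by simp
    qed
  qed
  let ?H = "mpol_hessian (lagrangian m1 J f h g lam mu) u"
  have tangent: "(\<forall>s\<in>K. ?G s \<bullet> v = 0) \<longleftrightarrow> (\<forall>i\<in>{1..m1}. mpol_gradient (h i) u \<bullet> v = 0) \<and> (\<forall>j\<in>J. mpol_gradient (g j) u \<bullet> v = 0)" for v
    by (simp add: K_def constr_slots_def ball_Un)
  have psd: "0 \<le> v \<bullet> (?H *v v)" if "\<forall>s\<in>K. ?G s \<bullet> v = 0" for v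
    using second_order_necessary[OF cq lm mult, of v] that unfolding tangent J_def by blast
  have Hv: "?H *v v = mpol_hessian f u *v v - (\<Sum>s\<in>K. c s *\<^sub>R (mpol_hessian (?p s) u *v v))" for v
    by (simp add: lagrangian_def mpol_hessian_minus mpol_hessian_sum mpol_hessian_const_mult K_def
        sum_constr_slots J c_def)
  have "v \<bullet> (?H *v v) > 0" if v: "v \<noteq> 0" "\<forall>s\<in>K. ?G s \<bullet> v = 0" for v
  proof (rule ccontr)
    assume "\<not> v \<bullet> (?H *v v) > 0"
    then have "v \<bullet> (?H *v v) = 0" using psd[OF v(2)] by simp
    then have "?H *v v \<in> span (?G ` K)"
      using psd v by (intro degenerate_direction_in_span mpol_hessian_symmetric) auto
    from span_family[OF fK ind(1) this] obtain b where b: "?H *v v = (\<Sum>s\<in>K. b s *\<^sub>R ?G s)" by blast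
    have in_Obj: "inputs_at ?dg (Obj # ss) ?p" using ssK Ksub by (intro inp) auto
    have "D_condition (hom_at ?dg ?p Obj) (map (hom_at ?dg ?p) ss)"
      using zero v grad b Hv[of v] by (intro D_conditionI[OF in_Obj dist, of u v c b]) (simp_all add: ssK)
    moreover have "coeff_eval (D ss) ?p \<noteq> 0" using nz td \<Phi> by blast
    ultimately show False using not_D_condition[OF D[OF td] in_Obj] by blast
  qed
  then have "second_order_sufficiency m1 m2 f h g u lam mu"
    unfolding second_order_sufficiency_def Let_def tangent J_def[symmetric] by blast
  with cq mult strict show ?thesis by blast
qed

theorem theorem1p2:
  fixes d0 m1 m2 :: nat and d d' :: "nat \<Rightarrow> nat"
  assumes "d0 > 0"
    and "\<And>i. i \<in> {1..m1} \<Longrightarrow> d i > 0"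
    and "\<And>j. j \<in> {1..m2} \<Longrightarrow> d' j > 0"
    and "m1 \<le> CARD('n::finite)"
  shows "(\<exists>\<Phi> :: 'n coeff_poly set. finite \<Phi> \<and> genericity_list (case_slot d0 d d') m1 m2 \<Phi>) \<and>
    (\<forall>\<Phi> :: 'n coeff_poly set. genericity_list (case_slot d0 d d') m1 m2 \<Phi> \<longrightarrow>
      (\<forall>f h g.
        f \<in> polys_deg_le d0 \<and> (\<forall>i\<in>{1..m1}. h i \<in> polys_deg_le (d i)) \<and>
        (\<forall>j\<in>{1..m2}. g j \<in> polys_deg_le (d' j)) \<longrightarrow>
        (\<forall>\<phi>\<in>\<Phi>. coeff_eval \<phi> (case_slot f h g) \<noteq> 0) \<longrightarrow>
        (\<forall>u. local_minimizer m1 m2 f h g u \<longrightarrow>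
          constraint_qualification m1 m2 h g u \<and>
          (\<exists>lam mu. lagrange_multipliers m1 m2 f h g u lam mu \<and>
             strict_complementarity m2 g u mu \<and>
             second_order_sufficiency m1 m2 f h g u lam mu))))"
proof (rule conjI[OF genericity_list_exists], intro allI impI, elim conjE)
qed (rule genericity_implies_optimality_conditions[OF assms(4)])

end
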